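(* Let $(M,g,J,\omega)$ be a Kähler surface and let $\varphi=\varphi_0+\frac32\sigma\,\omega$ be a hamiltonian $2$-form. Then the trace $\sigma$ and the pfaffian $\pi$ of $\tilde\varphi=\frac12\varphi_0+\frac14\sigma\,\omega$ are Poisson-commuting holomorphic potentials.
   Context: A Kähler surface $(M,g,J,\omega)$ is an oriented Riemannian $4$-manifold with a $g$-orthogonal complex structure $J$ inducing the given orientation and satisfying $\nabla J=0$; $\omega(\cdot,\cdot)=g(J\cdot,\cdot)$. Anti-selfdual $2$-forms (sections of $\Lambda^-M$) are exactly the trace-free $J$-invariant $2$-forms. An anti-selfdual $2$-form $\Phi$ is a twistor $2$-form if $\nabla\Phi$ is a section of $V^{(0)}M$, where $T^*M\otimes\Lambda^-M=V^{(0)}M\oplus V^{(1)}M$, $V^{(1)}M$ is the kernel of the natural contraction $T^*M\otimes\Lambda^-M\to T^*M$, and $V^{(0)}M\cong T^*M$ is its orthogonal complement. A hamiltonian $2$-form is a closed $J$-invariant $2$-form $\varphi$ whose trace-free part $\varphi_0$ is a twistor $2$-form; it is written $\varphi=\varphi_0+\frac32\sigma\,\omega$ with $\sigma$ a function, called the trace of $\tilde\varphi$. The pfaffian $\mathrm{pf}(\psi)$ of a $2$-form $\psi$ is defined by $\psi\wedge\psi=\frac14\mathrm{pf}(\psi)\,\omega\wedge\omega$; $\pi=\mathrm{pf}(\tilde\varphi)$. A real function $f$ is a holomorphic potential if $\mathrm{grad}_gf$ preserves $J$, equivalently if $J\,\mathrm{grad}_gf$ is a Killing vector field. Poisson-commuting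 refers to the Poisson bracket of $\omega$. *)

theory Defs
  imports "HOL-Analysis.Analysis"
begin

section \<open>Smooth functions on open subsets of a Euclidean space\<close>

fun Ck_on :: "nat \<Rightarrow> 'a::euclidean_space set \<Rightarrow> ('a \<Rightarrow> 'b::real_normed_vector) \<Rightarrow> bool" where
  "Ck_on 0 S f \<longleftrightarrow> continuous_on S f"
| "Ck_on (Suc k) S f \<longleftrightarrow> (\<forall>x\<in>S. f differentiable at x) \<and>
     (\<forall>v. Ck_on k S (\<lambda>x. frechet_derivative f (at x) v))"

definition smooth_on :: "'a::euclidean_space set \<Rightarrow> ('a \<Rightarrow> 'b::real_normed_vector) \<Rightarrow> bool" where
  "smooth_on S f \<longleftrightarrow> (\<forall>k. Ck_on k S f)"

definition partial_deriv :: "4 \<Rightarrow> (real^4 \<Rightarrow> 'b::real_normed_vector) \<Rightarrow> real^4 \<Rightarrow> 'b" where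
  "partial_deriv i f x = frechet_derivative f (at x) (axis i 1)"


section \<open>Oriented 4-manifolds and tensor fields\<close>

text \<open>A chart is a pair of its domain and its coordinate map. Only the values of the
  coordinate map on the domain matter.\<close>

type_synonym 'a chart = "'a set \<times> ('a \<Rightarrow> real^4)"

definition chart_dom :: "'a chart \<Rightarrow> 'a set" where
  "chart_dom c = fst c"

definition chart_map :: "'a chart \<Rightarrow> 'a \<Rightarrow> real^4" where
  "chart_map c = snd c"

definition chart_img :: "'a chart \<Rightarrow> (real^4) set" where
  "chart_img c = chart_map c ` chart_dom c"

definition chart_inv :: "'a chart \<Rightarrow> real^4 \<Rightarrow> 'a" where
  "chart_inv c = inv_into (chart_dom c) (chart_map c)"

definition transition :: "'a chart \<Rightarrow> 'a chart \<Rightarrow> real^4 \<Rightarrow> real^4" where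
  "transition c d = chart_map d \<circ> chart_inv c"

definition overlap :: "'a chart \<Rightarrow> 'a chart \<Rightarrow> (real^4) set" where
  "overlap c d = chart_map c ` (chart_dom c \<inter> chart_dom d)"

definition is_chart :: "'a topology \<Rightarrow> 'a chart \<Rightarrow> bool" where
  "is_chart M c \<longleftrightarrow> openin M (chart_dom c) \<and> open (chart_img c) \<and>
     homeomorphic_map (subtopology M (chart_dom c)) (top_of_set (chart_img c)) (chart_map c)"

definition oriented_atlas :: "'a topology \<Rightarrow> 'a chart set \<Rightarrow> bool" where
  "oriented_atlas M A \<longleftrightarrow>
     (\<forall>c\<in>A. is_chart M c) \<and> (\<Union>c\<in>A. chart_dom c) = topspace M \<and>
     (\<forall>c\<in>A. \<forall>d\<in>A. smooth_on (overlap c d) (transition c d) \<and>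
        (\<forall>x\<in>overlap c d. 0 < det (jacobian (transition c d) (at x))))"

definition oriented_4_manifold :: "'a topology \<Rightarrow> 'a chart set \<Rightarrow> bool" where
  "oriented_4_manifold M A \<longleftrightarrow>
     Hausdorff_space M \<and> second_countable M \<and> oriented_atlas M A"

text \<open>Functions on the manifold are maps on points. Tensor fields of rank two are given by
  their component matrices in every chart of the atlas, as functions of the coordinates, subject
  to the transformation law on overlaps. For a covariant tensor \<open>T\<close> the entry \<open>T c x $ i $ j\<close> is
  the value on the \<open>i\<close>-th and \<open>j\<close>-th coordinate vector fields; for an endomorphism \<open>J\<close>, the
  matrix \<open>J c x\<close> acts on column vectors of components, so \<open>J c x $ i $ j\<close> has upper index
  \<open>i\<close> and lower index \<open>j\<close>.\<close>

type_synonym 'a tensor2 = "'a chart \<Rightarrow> real^4 \<Rightarrow> real^4^4"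

definition coord_rep :: "'a chart \<Rightarrow> ('a \<Rightarrow> real) \<Rightarrow> real^4 \<Rightarrow> real" where
  "coord_rep c f = f \<circ> chart_inv c"

definition smooth_function :: "'a chart set \<Rightarrow> ('a \<Rightarrow> real) \<Rightarrow> bool" where
  "smooth_function A f \<longleftrightarrow> (\<forall>c\<in>A. smooth_on (chart_img c) (coord_rep c f))"

definition covariant_2_tensor :: "'a chart set \<Rightarrow> 'a tensor2 \<Rightarrow> bool" where
  "covariant_2_tensor A T \<longleftrightarrow>
     (\<forall>c\<in>A. smooth_on (chart_img c) (T c)) \<and>
     (\<forall>c\<in>A. \<forall>d\<in>A. \<forall>x\<in>overlap c d.
        let D = jacobian (transition c d) (at x)
        in T c x = transpose D ** T d (transition c d x) ** D)"

definition endomorphism_field :: "'a chart set \<Rightarrow> 'a tensor2 \<Rightarrow> bool" where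
  "endomorphism_field A J \<longleftrightarrow>
     (\<forall>c\<in>A. smooth_on (chart_img c) (J c)) \<and>
     (\<forall>c\<in>A. \<forall>d\<in>A. \<forall>x\<in>overlap c d.
        let D = jacobian (transition c d) (at x)
        in D ** J c x = J d (transition c d x) ** D)"

definition two_form :: "'a chart set \<Rightarrow> 'a tensor2 \<Rightarrow> bool" where
  "two_form A \<psi> \<longleftrightarrow> covariant_2_tensor A \<psi> \<and>
     (\<forall>c\<in>A. \<forall>x\<in>chart_img c. transpose (\<psi> c x) = - \<psi> c x)"

definition closed_form :: "'a chart set \<Rightarrow> 'a tensor2 \<Rightarrow> bool" where
  "closed_form A \<psi> \<longleftrightarrow> (\<forall>c\<in>A. \<forall>x\<in>chart_img c. \<forall>i j k.
     partial_deriv i (\<psi> c) x $ j $ k + partial_deriv j (\<psi> c) x $ k $ i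
       + partial_deriv k (\<psi> c) x $ i $ j = 0)"


section \<open>Linear algebra in one tangent space\<close>

text \<open>Below, \<open>G\<close> is the matrix of the metric at a point.\<close>

definition inner_2forms :: "real^4^4 \<Rightarrow> real^4^4 \<Rightarrow> real^4^4 \<Rightarrow> real" where
  "inner_2forms G \<alpha> \<beta> = (\<Sum>i\<in>UNIV. \<Sum>j\<in>UNIV. \<Sum>k\<in>UNIV. \<Sum>l\<in>UNIV.
     matrix_inv G $ i $ k * matrix_inv G $ j $ l * \<alpha> $ i $ j * \<beta> $ k $ l)"

definition inner_3tensors :: "real^4^4 \<Rightarrow> real^4^4^4 \<Rightarrow> real^4^4^4 \<Rightarrow> real" where
  "inner_3tensors G T S = (\<Sum>a\<in>UNIV. \<Sum>b\<in>UNIV.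
     matrix_inv G $ a $ b * inner_2forms G (T $ a) (S $ b))"

definition volume_form ::
    "real^4^4 \<Rightarrow> real^4 \<Rightarrow> real^4 \<Rightarrow> real^4 \<Rightarrow> real^4 \<Rightarrow> real" where
  "volume_form G X Y Z W = sqrt (det G) * det (vector [X, Y, Z, W] :: real^4^4)"

definition hodge_star :: "real^4^4 \<Rightarrow> real^4^4 \<Rightarrow> real^4^4" where
  "hodge_star G \<psi> = (\<chi> k l. (1/2) * (\<Sum>i\<in>UNIV. \<Sum>j\<in>UNIV. \<Sum>a\<in>UNIV. \<Sum>b\<in>UNIV.
     matrix_inv G $ i $ a * matrix_inv G $ j $ b * \<psi> $ a $ b
       * volume_form G (axis i 1) (axis j 1) (axis k 1) (axis l 1)))"

definition asd_forms :: "real^4^4 \<Rightarrow> (real^4^4) set" where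
  "asd_forms G = {\<psi>. transpose \<psi> = - \<psi> \<and> hodge_star G \<psi> = - \<psi>}"

text \<open>The fibre of \<open>T\<^sup>*M \<otimes> \<Lambda>\<^sup>-M\<close> and its two summands; the first index of \<open>T\<close> is the one
  of \<open>T\<^sup>*M\<close>.\<close>

definition cotangent_asd :: "real^4^4 \<Rightarrow> (real^4^4^4) set" where
  "cotangent_asd G = {T. \<forall>i. T $ i \<in> asd_forms G}"

definition contraction :: "real^4^4 \<Rightarrow> real^4^4^4 \<Rightarrow> real^4" where
  "contraction G T = (\<chi> k. \<Sum>i\<in>UNIV. \<Sum>j\<in>UNIV. matrix_inv G $ i $ j * T $ i $ j $ k)"

definition V1 :: "real^4^4 \<Rightarrow> (real^4^4^4) set" where
  "V1 G = {T \<in> cotangent_asd G. contraction G T = 0}"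

definition V0 :: "real^4^4 \<Rightarrow> (real^4^4^4) set" where
  "V0 G = {T \<in> cotangent_asd G. \<forall>S\<in>V1 G. inner_3tensors G T S = 0}"

definition wedge_2forms :: "real^4^4 \<Rightarrow> real^4^4 \<Rightarrow> 4 \<Rightarrow> 4 \<Rightarrow> 4 \<Rightarrow> 4 \<Rightarrow> real" where
  "wedge_2forms \<alpha> \<beta> i j k l =
     \<alpha> $ i $ j * \<beta> $ k $ l - \<alpha> $ i $ k * \<beta> $ j $ l + \<alpha> $ i $ l * \<beta> $ j $ k
     + \<alpha> $ j $ k * \<beta> $ i $ l - \<alpha> $ j $ l * \<beta> $ i $ k + \<alpha> $ k $ l * \<beta> $ i $ j"


section \<open>Levi-Civita connection and other local differential operators\<close>

text \<open>Here \<open>g\<close>, \<open>\<psi>\<close>, \<open>J\<close>, \<open>X\<close> are component functions in one chart.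
  \<open>christoffel g x k i j\<close> has upper index \<open>k\<close>. In the covariant derivatives the first index
  is the direction of differentiation.\<close>

definition christoffel :: "(real^4 \<Rightarrow> real^4^4) \<Rightarrow> real^4 \<Rightarrow> 4 \<Rightarrow> 4 \<Rightarrow> 4 \<Rightarrow> real" where
  "christoffel g x k i j = (1/2) * (\<Sum>l\<in>UNIV. matrix_inv (g x) $ k $ l *
     (partial_deriv i g x $ j $ l + partial_deriv j g x $ i $ l - partial_deriv l g x $ i $ j))"

definition nabla_form ::
    "(real^4 \<Rightarrow> real^4^4) \<Rightarrow> (real^4 \<Rightarrow> real^4^4) \<Rightarrow> real^4 \<Rightarrow> real^4^4^4" where
  "nabla_form g \<psi> x = (\<chi> i j k. partial_deriv i \<psi> x $ j $ k
     - (\<Sum>l\<in>UNIV. christoffel g x l i j * \<psi> x $ l $ k)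
     - (\<Sum>l\<in>UNIV. christoffel g x l i k * \<psi> x $ j $ l))"

definition nabla_endo ::
    "(real^4 \<Rightarrow> real^4^4) \<Rightarrow> (real^4 \<Rightarrow> real^4^4) \<Rightarrow> real^4 \<Rightarrow> real^4^4^4" where
  "nabla_endo g J x = (\<chi> i k j. partial_deriv i J x $ k $ j
     + (\<Sum>l\<in>UNIV. christoffel g x k i l * J x $ l $ j)
     - (\<Sum>l\<in>UNIV. christoffel g x l i j * J x $ k $ l))"

text \<open>Components of \<open>N(X,Y) = [JX,JY] - J[JX,Y] - J[X,JY] - [X,Y]\<close> for \<open>J\<close> with square \<open>-1\<close>.\<close>

definition nijenhuis :: "(real^4 \<Rightarrow> real^4^4) \<Rightarrow> real^4 \<Rightarrow> 4 \<Rightarrow> 4 \<Rightarrow> 4 \<Rightarrow> real" where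
  "nijenhuis J x k i j = (\<Sum>l\<in>UNIV.
     J x $ l $ i * partial_deriv l J x $ k $ j - J x $ l $ j * partial_deriv l J x $ k $ i
     - J x $ k $ l * (partial_deriv i J x $ l $ j - partial_deriv j J x $ l $ i))"

definition lie_deriv_endo ::
    "(real^4 \<Rightarrow> real^4) \<Rightarrow> (real^4 \<Rightarrow> real^4^4) \<Rightarrow> real^4 \<Rightarrow> real^4^4" where
  "lie_deriv_endo X J x = (\<chi> i j. \<Sum>l\<in>UNIV.
     X x $ l * partial_deriv l J x $ i $ j
     - J x $ l $ j * partial_deriv l X x $ i
     + J x $ i $ l * partial_deriv j X x $ l)"

definition differential :: "'a chart \<Rightarrow> ('a \<Rightarrow> real) \<Rightarrow> real^4 \<Rightarrow> real^4" where
  "differential c f x = (\<chi> i. partial_deriv i (coord_rep c f) x)"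


section \<open>Kaehler surfaces\<close>

definition riemannian_metric :: "'a chart set \<Rightarrow> 'a tensor2 \<Rightarrow> bool" where
  "riemannian_metric A g \<longleftrightarrow> covariant_2_tensor A g \<and>
     (\<forall>c\<in>A. \<forall>x\<in>chart_img c. transpose (g c x) = g c x \<and>
        (\<forall>v. v \<noteq> 0 \<longrightarrow> 0 < v \<bullet> (g c x *v v)))"

definition complex_structure :: "'a chart set \<Rightarrow> 'a tensor2 \<Rightarrow> bool" where
  "complex_structure A J \<longleftrightarrow> endomorphism_field A J \<and>
     (\<forall>c\<in>A. \<forall>x\<in>chart_img c. J c x ** J c x = - mat 1 \<and>
        (\<forall>i j k. nijenhuis (J c) x k i j = 0))"

text \<open>Every basis of the form \<open>X, JX, Y, JY\<close> is positively oriented.\<close>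

definition induces_orientation :: "'a chart set \<Rightarrow> 'a tensor2 \<Rightarrow> bool" where
  "induces_orientation A J \<longleftrightarrow> (\<forall>c\<in>A. \<forall>x\<in>chart_img c. \<forall>X Y.
     let B = vector [X, J c x *v X, Y, J c x *v Y] :: real^4^4
     in det B \<noteq> 0 \<longrightarrow> 0 < det B)"

definition orthogonal_structure :: "'a chart set \<Rightarrow> 'a tensor2 \<Rightarrow> 'a tensor2 \<Rightarrow> bool" where
  "orthogonal_structure A g J \<longleftrightarrow> (\<forall>c\<in>A. \<forall>x\<in>chart_img c.
     transpose (J c x) ** g c x ** J c x = g c x)"

definition parallel_structure :: "'a chart set \<Rightarrow> 'a tensor2 \<Rightarrow> 'a tensor2 \<Rightarrow> bool" where
  "parallel_structure A g J \<longleftrightarrow> (\<forall>c\<in>A. \<forall>x\<in>chart_img c. nabla_endo (g c) (J c) x = 0)"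

definition kaehler_surface ::
    "'a topology \<Rightarrow> 'a chart set \<Rightarrow> 'a tensor2 \<Rightarrow> 'a tensor2 \<Rightarrow> bool" where
  "kaehler_surface M A g J \<longleftrightarrow> oriented_4_manifold M A \<and> riemannian_metric A g \<and>
     complex_structure A J \<and> orthogonal_structure A g J \<and> induces_orientation A J \<and>
     parallel_structure A g J"

text \<open>\<open>\<omega>(X,Y) = g(JX,Y)\<close>\<close>

definition kaehler_form :: "'a tensor2 \<Rightarrow> 'a tensor2 \<Rightarrow> 'a tensor2" where
  "kaehler_form g J = (\<lambda>c x. transpose (J c x) ** g c x)"


section \<open>Hamiltonian 2-forms\<close>

definition J_invariant :: "'a chart set \<Rightarrow> 'a tensor2 \<Rightarrow> 'a tensor2 \<Rightarrow> bool" where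
  "J_invariant A J \<psi> \<longleftrightarrow> (\<forall>c\<in>A. \<forall>x\<in>chart_img c.
     transpose (J c x) ** \<psi> c x ** J c x = \<psi> c x)"

definition trace_free_part :: "'a tensor2 \<Rightarrow> 'a tensor2 \<Rightarrow> 'a tensor2 \<Rightarrow> 'a tensor2" where
  "trace_free_part g J \<psi> = (\<lambda>c x.
     let \<omega> = kaehler_form g J c x
     in \<psi> c x - (inner_2forms (g c x) (\<psi> c x) \<omega> / inner_2forms (g c x) \<omega> \<omega>) *\<^sub>R \<omega>)"

definition twistor_2_form :: "'a chart set \<Rightarrow> 'a tensor2 \<Rightarrow> 'a tensor2 \<Rightarrow> bool" where
  "twistor_2_form A g \<Phi> \<longleftrightarrow> two_form A \<Phi> \<and>
     (\<forall>c\<in>A. \<forall>x\<in>chart_img c. \<Phi> c x \<in> asd_forms (g c x) \<and>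
        nabla_form (g c) (\<Phi> c) x \<in> V0 (g c x))"

definition hamiltonian_2_form ::
    "'a chart set \<Rightarrow> 'a tensor2 \<Rightarrow> 'a tensor2 \<Rightarrow> 'a tensor2 \<Rightarrow> bool" where
  "hamiltonian_2_form A g J \<phi> \<longleftrightarrow> two_form A \<phi> \<and> closed_form A \<phi> \<and> J_invariant A J \<phi> \<and>
     twistor_2_form A g (trace_free_part g J \<phi>)"

text \<open>The number \<open>r\<close> below exists, is unique and does not depend on the chart, since
  \<open>\<omega> \<and> \<omega>\<close> spans the space of 4-forms at each point.\<close>

definition pfaffian ::
    "'a chart set \<Rightarrow> 'a tensor2 \<Rightarrow> 'a tensor2 \<Rightarrow> 'a tensor2 \<Rightarrow> 'a \<Rightarrow> real" where
  "pfaffian A g J \<psi> p = (THE r. \<forall>c\<in>A. p \<in> chart_dom c \<longrightarrow>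
     (let x = chart_map c p; \<omega> = kaehler_form g J c x
      in \<forall>i j k l. wedge_2forms (\<psi> c x) (\<psi> c x) i j k l
           = (1/4) * r * wedge_2forms \<omega> \<omega> i j k l))"


section \<open>Holomorphic potentials and the Poisson bracket\<close>

definition gradient :: "'a tensor2 \<Rightarrow> 'a chart \<Rightarrow> ('a \<Rightarrow> real) \<Rightarrow> real^4 \<Rightarrow> real^4" where
  "gradient g c f x = matrix_inv (g c x) *v differential c f x"

definition holomorphic_potential ::
    "'a chart set \<Rightarrow> 'a tensor2 \<Rightarrow> 'a tensor2 \<Rightarrow> ('a \<Rightarrow> real) \<Rightarrow> bool" where
  "holomorphic_potential A g J f \<longleftrightarrow> smooth_function A f \<and>
     (\<forall>c\<in>A. \<forall>x\<in>chart_img c. lie_deriv_endo (gradient g c f) (J c) x = 0)"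

text \<open>The hamiltonian vector field \<open>X\<close> of \<open>f\<close> is given by \<open>\<omega>(X,\<cdot>) = df\<close>, and the bracket of
  \<open>f\<close> and \<open>h\<close> is \<open>\<omega>\<close> evaluated on their hamiltonian vector fields.\<close>

definition hamiltonian_field ::
    "'a tensor2 \<Rightarrow> 'a tensor2 \<Rightarrow> 'a chart \<Rightarrow> ('a \<Rightarrow> real) \<Rightarrow> real^4 \<Rightarrow> real^4" where
  "hamiltonian_field g J c f x =
     matrix_inv (transpose (kaehler_form g J c x)) *v differential c f x"

definition poisson_bracket ::
    "'a tensor2 \<Rightarrow> 'a tensor2 \<Rightarrow> 'a chart \<Rightarrow> ('a \<Rightarrow> real) \<Rightarrow> ('a \<Rightarrow> real) \<Rightarrow> real^4 \<Rightarrow> real" where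
  "poisson_bracket g J c f h x =
     hamiltonian_field g J c f x \<bullet> (kaehler_form g J c x *v hamiltonian_field g J c h x)"

definition poisson_commute ::
    "'a chart set \<Rightarrow> 'a tensor2 \<Rightarrow> 'a tensor2 \<Rightarrow> ('a \<Rightarrow> real) \<Rightarrow> ('a \<Rightarrow> real) \<Rightarrow> bool" where
  "poisson_commute A g J f h \<longleftrightarrow>
     (\<forall>c\<in>A. \<forall>x\<in>chart_img c. poisson_bracket g J c f h x = 0)"

end

theory Submission
  imports Defs
begin

text \<open>
  Put \<open>\<psi> = 2 \<phi>t = \<phi>\<^sub>0 + (\<sigma>/2) \<omega>\<close> and \<open>p = d\<sigma>\<close>. Everything rests on one formula: for a hamiltonian
  two-form the covariant derivative of \<open>\<psi>\<close> is determined by \<open>p\<close>,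
  \<open>2 \<nabla>\<^sub>u\<psi> = g(u,\<cdot>) \<and> \<omega>(\<Lambda>,\<cdot>) + p \<and> \<omega>(u,\<cdot>)\<close> with \<open>\<Lambda> = grad \<sigma>\<close> (\<open>twistor_derivative\<close>,
  \<open>nabla_\<psi>\<close>). The right-hand side, corrected by a multiple of \<open>\<omega>\<close>, takes anti-selfdual values and
  satisfies the same closedness condition as \<open>\<nabla>\<phi>\<^sub>0\<close>. The difference of the two is thus
  anti-selfdual and closed, hence divergence-free, so it lies in the summand \<open>V1\<close> and is orthogonal both to
  \<open>\<nabla>\<phi>\<^sub>0\<close> and to the candidate; therefore it vanishes.

  A gradient field on a Kaehler manifold preserves \<open>J\<close> as soon as the covariant Hessian of its
  potential is \<open>J\<close>-invariant (\<open>lie_deriv_gradient\<close>).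

  For \<open>\<sigma>\<close>, antisymmetrise the second covariant derivatives of \<open>\<psi>\<close>. By the Ricci identity the
  result is a curvature term, and the curvature \<open>R(a,c)\<close> of a Kaehler metric satisfies
  \<open>R(Ja,Jc) = R(a,c)\<close> (\<open>curvature_J_invariant\<close>). By the formula above the result is also an
  expression in the Hessian of \<open>\<sigma>\<close>. In dimension four its invariance under \<open>J\<close> in \<open>a, c\<close> forces the
  Hessian to be \<open>J\<close>-invariant (\<open>hessian_J_invariant\<close>, \<open>h_J_invariant\<close>).

  For \<open>\<pi>\<close>, let \<open>S\<close> be the endomorphism with \<open>\<psi>(X,Y) = \<omega>(SX,Y)\<close>. It commutes with \<open>J\<close> and has two
  double eigenvalues, whose sum is \<open>\<sigma>\<close> and whose product is \<open>\<pi>\<close>; so \<open>\<pi> = \<sigma>\<^sup>2/2 - tr(S\<^sup>2)/4\<close>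
  (\<open>pfaffian_trace\<close>). The formula for \<open>\<nabla>\<psi>\<close> yields \<open>d\<pi> = \<sigma> p - p \<circ> S\<close> (\<open>D_pf\<close>), and one more
  derivative expresses the Hessian of \<open>\<pi>\<close> through the Hessian of \<open>\<sigma>\<close> and visibly \<open>J\<close>-invariant
  terms (\<open>dpf_hessian\<close>). The Poisson bracket of \<open>\<sigma>\<close> and \<open>\<pi>\<close> is the value at \<open>(p,p)\<close> of a skew form
  (\<open>poisson_zero\<close>).

  All of this is done in one chart, with matrix fields in place of components. A covariant
  derivative in direction \<open>v\<close> is the directional derivative \<open>D T x v\<close> corrected by the matrix of the
  connection, and identities in one tangent space are checked in an oriented orthonormal frame
  \<open>b\<^sub>1, Jb\<^sub>1, b\<^sub>3, Jb\<^sub>3\<close>.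
\<close>

section \<open>Smooth functions and the symmetry of second derivatives\<close>

(* \<open>transpose A *v x\<close> and not \<open>x v* A\<close> serves as normal form in the matrix identities below. *)
declare transpose_matrix_vector [simp del]

abbreviation D :: "('a::euclidean_space \<Rightarrow> 'b::real_normed_vector) \<Rightarrow> 'a \<Rightarrow> 'a \<Rightarrow> 'b" where
  "D f x v \<equiv> frechet_derivative f (at x) v"

lemma D_eq: "(f has_derivative f') (at x) \<Longrightarrow> D f x v = f' v"
  using frechet_derivative_at by metis

lemma has_D: "f differentiable at x \<Longrightarrow> (f has_derivative D f x) (at x)"
  using frechet_derivative_works by blast

lemma D_cong:
  assumes "open S" "x \<in> S" "\<And>y. y \<in> S \<Longrightarrow> f y = g y"
  shows "D f x v = D g x v"
proof (cases "f differentiable at x")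
  case True
  show ?thesis
    using frechet_derivative_transform_within_open[OF True assms(1,2)] assms(3) by simp
next
  case False
  have "(f has_derivative h) (at x) \<longleftrightarrow> (g has_derivative h) (at x)" for h
    using has_derivative_transform_within_open[OF _ assms(1,2)] assms(3) by metis
  then have "(\<lambda>h. (f has_derivative h) (at x)) = (\<lambda>h. (g has_derivative h) (at x))" by auto
  then show ?thesis unfolding frechet_derivative_def by simp
qed

lemma differentiable_cong_open:
  assumes "open S" "x \<in> S" "\<And>y. y \<in> S \<Longrightarrow> f y = g y" "f differentiable at x"
  shows "g differentiable at x"
  using has_derivative_transform_within_open[OF _ assms(1,2)] assms(3,4)
  unfolding differentiable_def by metis

lemma Ck_on_cong:
  assumes "open S" "\<And>y. y \<in> S \<Longrightarrow> f y = g y" "Ck_on k S f"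
  shows "Ck_on k S g"
  using assms(2,3)
proof (induction k arbitrary: f g)
  case 0
  then show ?case using continuous_on_cong by (metis Ck_on.simps(1))
next
  case (Suc k)
  have "g differentiable at x" if "x \<in> S" for x
    using differentiable_cong_open[OF assms(1) that Suc.prems(1)] Suc.prems(2) that by auto
  moreover have "Ck_on k S (\<lambda>x. D g x v)" for v
    using Suc.IH[of "\<lambda>x. D f x v"] D_cong[OF assms(1) _ Suc.prems(1)] Suc.prems(2) by auto
  ultimately show ?case by simp
qed

lemma Ck_on_SucD:
  assumes "Ck_on (Suc k) S f"
  shows "Ck_on k S f"
  using assms
proof (induction k arbitrary: f)
  case 0
  then show ?case
    by (auto intro!: continuous_at_imp_continuous_on differentiable_imp_continuous_within)
qed auto

lemma Ck_on_const: "Ck_on k S (\<lambda>x. c)"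
  by (induction k arbitrary: c) (auto simp: frechet_derivative_const)

lemma Ck_on_add:
  assumes "open S" "Ck_on k S f" "Ck_on k S g"
  shows "Ck_on k S (\<lambda>x. f x + g x)"
  using assms(2,3)
proof (induction k arbitrary: f g)
  case 0 then show ?case by (auto intro: continuous_intros)
next
  case (Suc k)
  have "Ck_on k S (\<lambda>x. D (\<lambda>x. f x + g x) x v)" for v
    by (rule Ck_on_cong[OF assms(1) _ Suc.IH[of "\<lambda>x. D f x v" "\<lambda>x. D g x v"]])
       (use Suc.prems in \<open>auto intro!: D_eq[symmetric] derivative_intros has_D\<close>)
  then show ?case using Suc.prems by (auto intro: derivative_intros)
qed

lemma Ck_on_bilinear:
  assumes bb: "bounded_bilinear pr" and "open S" "Ck_on k S f" "Ck_on k S g"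
  shows "Ck_on k S (\<lambda>x. pr (f x) (g x))"
  using assms(3,4)
proof (induction k arbitrary: f g)
  case 0 then show ?case by (auto intro: bounded_bilinear.continuous_on[OF bb])
next
  case (Suc k)
  have d: "((\<lambda>x. pr (f x) (g x)) has_derivative (\<lambda>v. pr (f x) (D g x v) + pr (D f x v) (g x))) (at x)"
    if "x \<in> S" for x
    by (rule bounded_bilinear.FDERIV[OF bb]) (use Suc.prems that in \<open>auto intro: has_D\<close>)
  have "Ck_on k S (\<lambda>x. D (\<lambda>x. pr (f x) (g x)) x v)" for v
  proof (rule Ck_on_cong[OF assms(2)])
    show "Ck_on k S (\<lambda>x. pr (f x) (D g x v) + pr (D f x v) (g x))"
      using Suc.prems Ck_on_SucD[OF Suc.prems(1)] Ck_on_SucD[OF Suc.prems(2)]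
      by (intro Ck_on_add assms(2) Suc.IH) auto
  qed (use d D_eq in metis)
  then show ?case using d unfolding Ck_on.simps differentiable_def by blast
qed

lemma Ck_on_inverse:
  fixes f :: "'a::euclidean_space \<Rightarrow> real"
  assumes "open S" "Ck_on k S f" "\<And>x. x \<in> S \<Longrightarrow> f x \<noteq> 0"
  shows "Ck_on k S (\<lambda>x. inverse (f x))"
  using assms(2)
proof (induction k)
  case 0 then show ?case using assms(3) by (auto intro!: continuous_intros)
next
  case (Suc k)
  have d: "((\<lambda>x. inverse (f x)) has_derivative (\<lambda>v. - (inverse (f x) * D f x v * inverse (f x)))) (at x)"
    if "x \<in> S" for x
    by (rule Deriv.has_derivative_inverse) (use Suc.prems assms(3) that in \<open>auto intro: has_D\<close>)
  have k: "Ck_on k S f" using Suc.prems Ck_on_SucD by blast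
  have "Ck_on k S (\<lambda>x. D (\<lambda>x. inverse (f x)) x v)" for v
  proof (rule Ck_on_cong[OF assms(1)])
    show "Ck_on k S (\<lambda>x. (- 1) * (inverse (f x) * D f x v * inverse (f x)))"
      using Suc.prems Suc.IH[OF k]
      by (intro Ck_on_bilinear[OF bounded_bilinear_mult] assms(1) Ck_on_const) auto
  qed (use d D_eq in \<open>metis (no_types, lifting) mult_minus1\<close>)
  then show ?case using d unfolding Ck_on.simps differentiable_def by blast
qed

lemma smooth_on_const: "smooth_on S (\<lambda>x. c)"
  by (simp add: smooth_on_def Ck_on_const)

lemma smooth_on_cong:
  "open S \<Longrightarrow> (\<And>y. y \<in> S \<Longrightarrow> f y = g y) \<Longrightarrow> smooth_on S f \<Longrightarrow> smooth_on S g"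
  unfolding smooth_on_def using Ck_on_cong by metis

lemma smooth_on_add:
  "open S \<Longrightarrow> smooth_on S f \<Longrightarrow> smooth_on S g \<Longrightarrow> smooth_on S (\<lambda>x. f x + g x)"
  by (simp add: smooth_on_def Ck_on_add)

lemma smooth_on_bilinear:
  "bounded_bilinear pr \<Longrightarrow> open S \<Longrightarrow> smooth_on S f \<Longrightarrow> smooth_on S g \<Longrightarrow>
    smooth_on S (\<lambda>x. pr (f x) (g x))"
  by (simp add: smooth_on_def Ck_on_bilinear)

lemmas smooth_on_mult = smooth_on_bilinear[OF bounded_bilinear_mult]
lemmas smooth_on_scaleR = smooth_on_bilinear[OF bounded_bilinear_scaleR]

lemma smooth_on_linear:
  assumes "bounded_linear L" "open S" "smooth_on S f"
  shows "smooth_on S (\<lambda>x. L (f x))"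
proof -
  have "bounded_bilinear (\<lambda>(r::real) y. r *\<^sub>R L y)"
    using bounded_bilinear.comp[OF bounded_bilinear_scaleR bounded_linear_ident assms(1)] .
  from smooth_on_bilinear[OF this assms(2) smooth_on_const assms(3), of 1]
  show ?thesis by simp
qed

lemma smooth_on_divide:
  fixes f g :: "'a::euclidean_space \<Rightarrow> real"
  assumes "open S" "smooth_on S f" "smooth_on S g" "\<And>x. x \<in> S \<Longrightarrow> g x \<noteq> 0"
  shows "smooth_on S (\<lambda>x. f x / g x)"
proof -
  have "smooth_on S (\<lambda>x. inverse (g x))"
    using assms(3) Ck_on_inverse[OF assms(1) _ assms(4)] by (auto simp: smooth_on_def)
  from smooth_on_mult[OF assms(1,2) this] show ?thesis by (simp add: divide_inverse)
qed

lemma smooth_on_minus: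
  assumes "open S" "smooth_on S f" shows "smooth_on S (\<lambda>x. - f x)"
  using smooth_on_linear[OF bounded_linear_minus[OF bounded_linear_ident] assms] .

lemma smooth_on_diff:
  assumes "open S" "smooth_on S f" "smooth_on S g" shows "smooth_on S (\<lambda>x. f x - g x)"
  using smooth_on_add[OF assms(1,2) smooth_on_minus[OF assms(1,3)]] by simp

lemma smooth_on_sum:
  assumes "open S" "\<And>i. i \<in> I \<Longrightarrow> smooth_on S (f i)"
  shows "smooth_on S (\<lambda>x. \<Sum>i\<in>I. f i x)"
  using assms(2)
  by (induction I rule: infinite_finite_induct) (auto intro: smooth_on_const smooth_on_add[OF assms(1)])

lemma smooth_on_prod:
  fixes f :: "'i \<Rightarrow> 'a::euclidean_space \<Rightarrow> real"
  assumes "open S" "\<And>i. i \<in> I \<Longrightarrow> smooth_on S (f i)"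
  shows "smooth_on S (\<lambda>x. \<Prod>i\<in>I. f i x)"
  using assms(2)
  by (induction I rule: infinite_finite_induct) (auto intro: smooth_on_const smooth_on_mult[OF assms(1)])

lemma smooth_on_nth:
  "open S \<Longrightarrow> smooth_on S f \<Longrightarrow> smooth_on S (\<lambda>x. f x $ i)"
  by (rule smooth_on_linear[OF bounded_linear_vec_nth])

lemma smooth_on_matrix_nth:
  assumes "open S" "smooth_on S (A :: _ \<Rightarrow> real^'n^'m)"
  shows "smooth_on S (\<lambda>x. A x $ i $ j)"
  by (intro smooth_on_nth assms)

lemma smooth_on_euclideanI:
  fixes f :: "'a::euclidean_space \<Rightarrow> 'b::euclidean_space"
  assumes "open S" "\<And>b. b \<in> Basis \<Longrightarrow> smooth_on S (\<lambda>x. f x \<bullet> b)"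
  shows "smooth_on S f"
proof -
  have "smooth_on S (\<lambda>x. \<Sum>b\<in>Basis. (f x \<bullet> b) *\<^sub>R b)"
    by (intro smooth_on_sum smooth_on_scaleR smooth_on_const assms)
  then show ?thesis by (simp add: euclidean_representation)
qed

lemma smooth_on_vecI:
  fixes f :: "'a::euclidean_space \<Rightarrow> real^'n"
  assumes "open S" "\<And>i. smooth_on S (\<lambda>x. f x $ i)"
  shows "smooth_on S f"
  by (rule smooth_on_euclideanI[OF assms(1)])
     (auto simp: Basis_vec_def inner_axis assms(2))

lemma smooth_on_matrixI:
  fixes A :: "'a::euclidean_space \<Rightarrow> real^'n^'m"
  assumes "open S" "\<And>i j. smooth_on S (\<lambda>x. A x $ i $ j)"
  shows "smooth_on S A"
  by (rule smooth_on_euclideanI[OF assms(1)])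
     (auto simp: Basis_vec_def inner_axis assms(2))

lemma smooth_on_det:
  fixes A :: "'a::euclidean_space \<Rightarrow> real^'n^'n"
  assumes "open S" "smooth_on S A"
  shows "smooth_on S (\<lambda>x. det (A x))"
  unfolding det_def
  by (intro smooth_on_sum smooth_on_mult smooth_on_prod smooth_on_const smooth_on_matrix_nth assms)

lemma matrix_inv_works:
  fixes A :: "real^'n^'n"
  assumes "invertible A"
  shows "A ** matrix_inv A = mat 1" "matrix_inv A ** A = mat 1"
proof -
  have "\<exists>B. A ** B = mat 1 \<and> B ** A = mat 1" using assms by (simp add: invertible_def)
  from someI_ex[OF this] show "A ** matrix_inv A = mat 1" "matrix_inv A ** A = mat 1"
    by (simp_all add: matrix_inv_def)
qed

lemma matrix_inv_eqI:
  fixes A :: "real^'n^'n"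
  assumes "B ** A = mat 1"
  shows "matrix_inv A = B"
proof -
  have "invertible A" using assms invertible_left_inverse by blast
  then have "A ** matrix_inv A = mat 1" by (rule matrix_inv_works)
  then have "B = B ** (A ** matrix_inv A)" by simp
  then show ?thesis using assms by (simp add: matrix_mul_assoc)
qed

lemma smooth_on_matrix_inv:
  fixes A :: "'a::euclidean_space \<Rightarrow> real^'n^'n"
  assumes "open S" "smooth_on S A" "\<And>x. x \<in> S \<Longrightarrow> invertible (A x)"
  shows "smooth_on S (\<lambda>x. matrix_inv (A x))"
proof (rule smooth_on_matrixI[OF assms(1)])
  fix k l
  let ?B = "\<lambda>x. (\<chi> i j. if j = k then axis l 1 $ i else A x $ i $ j) :: real^'n^'n"
  \<comment> \<open>By Cramer's rule each entry of the inverse is a quotient of determinants.\<close>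
  have "matrix_inv (A x) $ k $ l = det (?B x) / det (A x)" if "x \<in> S" for x
  proof -
    have d: "det (A x) \<noteq> 0" using assms(3)[OF that] invertible_det_nz by blast
    have "A x *v (matrix_inv (A x) *v axis l 1) = axis l 1"
      using matrix_inv_works(1)[OF assms(3)[OF that]] by (simp add: matrix_vector_mul_assoc)
    then have "matrix_inv (A x) *v axis l 1 = (\<chi> k. det(\<chi> i j. if j=k then axis l 1 $ i else A x $ i $ j) / det (A x))"
      using cramer[OF d] by blast
    moreover have "(matrix_inv (A x) *v axis l 1) $ k = matrix_inv (A x) $ k $ l"
      by (simp add: matrix_vector_mult_basis column_def)
    ultimately show ?thesis by simp
  qed
  moreover have "smooth_on S ?B"
  proof (rule smooth_on_matrixI[OF assms(1)])
    show "smooth_on S (\<lambda>x. ?B x $ i $ j)" for i j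
      by (cases "j = k") (auto intro: smooth_on_const smooth_on_matrix_nth assms)
  qed
  then have "smooth_on S (\<lambda>x. det (?B x) / det (A x))"
    using assms(3) invertible_det_nz by (intro smooth_on_divide smooth_on_det assms) blast+
  ultimately show "smooth_on S (\<lambda>x. matrix_inv (A x) $ k $ l)"
    using smooth_on_cong[OF assms(1), of "\<lambda>x. det (?B x) / det (A x)"] by auto
qed

lemma smooth_on_D:
  "smooth_on S f \<Longrightarrow> smooth_on S (\<lambda>x. D f x v)"
  unfolding smooth_on_def using Ck_on.simps(2) by blast

lemma smooth_on_differentiable:
  "smooth_on S f \<Longrightarrow> x \<in> S \<Longrightarrow> f differentiable at x"
  unfolding smooth_on_def using Ck_on.simps(2) by blast

lemma smooth_on_has_D:
  "smooth_on S f \<Longrightarrow> x \<in> S \<Longrightarrow> (f has_derivative D f x) (at x)"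
  using smooth_on_differentiable has_D by blast

lemma D_linear: "f differentiable at x \<Longrightarrow> linear (D f x)"
  using linear_frechet_derivative by blast

lemma D_bilinear:
  assumes "bounded_bilinear pr" "f differentiable at x" "g differentiable at x"
  shows "D (\<lambda>x. pr (f x) (g x)) x v = pr (f x) (D g x v) + pr (D f x v) (g x)"
  by (rule D_eq, rule bounded_bilinear.FDERIV) (use assms has_D in auto)

lemma D_bounded_linear:
  assumes "bounded_linear L" "f differentiable at x"
  shows "D (\<lambda>x. L (f x)) x v = L (D f x v)"
  by (rule D_eq, rule bounded_linear.has_derivative) (use assms has_D in auto)

lemma symmetric_second_derivative_real:
  fixes f :: "'a::euclidean_space \<Rightarrow> real"
  assumes S: "open S" and f: "Ck_on 2 S f" and x: "x \<in> S"
  shows "D (\<lambda>y. D f y a) x b = D (\<lambda>y. D f y b) x a"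
proof -
  have f1: "\<And>y. y \<in> S \<Longrightarrow> f differentiable at y"
    and f2: "\<And>y v. y \<in> S \<Longrightarrow> (\<lambda>z. D f z v) differentiable at y"
    and f3: "\<And>u v. continuous_on S (\<lambda>y. D (\<lambda>z. D f z v) y u)"
    using f by (auto simp: numeral_2_eq_2)
  obtain e where e: "e > 0" "ball x e \<subseteq> S" using S x open_contains_ball by blast
  \<comment> \<open>Parallelograms at \<open>x\<close> with sides up to \<open>d a\<close> and \<open>d b\<close> stay inside \<open>S\<close>.\<close>
  define d where "d = e / (2 * (norm a + norm b + 1))"
  have d: "d > 0" using e(1) unfolding d_def
    by (intro divide_pos_pos mult_pos_pos) (auto intro: add_nonneg_pos)
  have dS: "x + s *\<^sub>R u + t *\<^sub>R v \<in> S" if "0 \<le> s" "s \<le> d" "0 \<le> t" "t \<le> d" "{u,v} = {a,b}" for s t u v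
  proof -
    have uv: "norm u + norm v \<le> norm a + norm b"
      using that(5) by (auto simp: doubleton_eq_iff)
    have "norm (s *\<^sub>R u + t *\<^sub>R v) \<le> s * norm u + t * norm v"
      using that norm_triangle_ineq[of "s *\<^sub>R u" "t *\<^sub>R v"] by simp
    also have "\<dots> \<le> d * norm u + d * norm v"
      using that by (intro add_mono mult_right_mono) auto
    also have "\<dots> = d * (norm u + norm v)" by (simp add: algebra_simps)
    also have "\<dots> \<le> d * (norm a + norm b)" using d uv by (intro mult_left_mono) auto
    also have "\<dots> < d * (2 * (norm a + norm b + 1))" using d
    proof (intro mult_strict_left_mono)
      have "0 \<le> norm a + norm b" by simp
      then show "norm a + norm b < 2 * (norm a + norm b + 1)" by argo
    qed
    also have "\<dots> = e"
    proof -
      have "norm a + norm b + 1 > 0" by (simp add: add_nonneg_pos)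
      then show ?thesis unfolding d_def by (simp add: field_simps)
    qed
    finally show ?thesis using e(2)
      by (auto simp: dist_norm norm_minus_commute subset_iff algebra_simps
          dest!: spec[of _ "x + (s *\<^sub>R u + t *\<^sub>R v)"])
  qed
  \<comment> \<open>The second difference quotient equals a mixed derivative at an intermediate point,
    in either order of differentiation.\<close>
  have key: "\<exists>s t. 0 \<le> s \<and> s \<le> h \<and> 0 \<le> t \<and> t \<le> h \<and>
      f (x + h *\<^sub>R u + h *\<^sub>R v) - f (x + h *\<^sub>R u) - f (x + h *\<^sub>R v) + f x
        = h * h * D (\<lambda>y. D f y u) (x + s *\<^sub>R u + t *\<^sub>R v) v"
    if h: "0 < h" "h \<le> d" and uv: "{u,v} = {a,b}" for h u v
  proof -
    let ?g = "\<lambda>s. f (x + s *\<^sub>R u + h *\<^sub>R v) - f (x + s *\<^sub>R u)"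
    have g: "(?g has_real_derivative (D f (x + s *\<^sub>R u + h *\<^sub>R v) u - D f (x + s *\<^sub>R u) u)) (at s)"
      if s: "0 \<le> s" "s \<le> h" for s
    proof -
      have 1: "x + s *\<^sub>R u + h *\<^sub>R v \<in> S" "x + s *\<^sub>R u \<in> S"
        using dS[of s h u v] dS[of s 0 u v] s h uv by auto
      have A: "((\<lambda>s. f (x + s *\<^sub>R u + c)) has_derivative (\<lambda>r. D f (x + s *\<^sub>R u + c) (r *\<^sub>R u))) (at s)"
        if "x + s *\<^sub>R u + c \<in> S" for c
        by (rule has_derivative_compose[where f = "\<lambda>s. x + s *\<^sub>R u + c" and f' = "\<lambda>r. r *\<^sub>R u"
              and g = f and g' = "D f (x + s *\<^sub>R u + c)"])
           (use has_D[OF f1[OF that]] in \<open>auto intro!: derivative_eq_intros\<close>)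
      have gd: "(?g has_derivative (\<lambda>r. D f (x + s *\<^sub>R u + h *\<^sub>R v) (r *\<^sub>R u) - D f (x + s *\<^sub>R u) (r *\<^sub>R u))) (at s)"
        using has_derivative_diff[OF A[of "h *\<^sub>R v"] A[of 0]] 1 by simp
      have "D f y (r *\<^sub>R u) = D f y u * r" if "y \<in> S" for y r
        using linear_scale[OF D_linear[OF f1[OF that]], of r u] by simp
      then show ?thesis using 1 unfolding has_field_derivative_def
        by (intro has_derivative_eq_rhs[OF gd]) (simp add: fun_eq_iff left_diff_distrib)
    qed
    have "\<exists>z>0. z < h \<and> ?g h - ?g 0 = (h - 0) * (D f (x + z *\<^sub>R u + h *\<^sub>R v) u - D f (x + z *\<^sub>R u) u)"
      by (rule MVT2[OF h(1)]) (rule g)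
    then obtain s where s: "0 < s" "s < h"
      and gs: "?g h - ?g 0 = h * (D f (x + s *\<^sub>R u + h *\<^sub>R v) u - D f (x + s *\<^sub>R u) u)"
      by (metis (no_types, lifting) diff_zero)
    let ?k = "\<lambda>t. D f (x + s *\<^sub>R u + t *\<^sub>R v) u"
    have k: "(?k has_real_derivative D (\<lambda>y. D f y u) (x + s *\<^sub>R u + t *\<^sub>R v) v) (at t)"
      if t: "0 \<le> t" "t \<le> h" for t
    proof -
      have 1: "x + s *\<^sub>R u + t *\<^sub>R v \<in> S" using dS[of s t u v] s t h uv by auto
      have "(?k has_derivative (\<lambda>r. D (\<lambda>y. D f y u) (x + s *\<^sub>R u + t *\<^sub>R v) (r *\<^sub>R v))) (at t)"
        by (rule has_derivative_compose[where f = "\<lambda>t. x + s *\<^sub>R u + t *\<^sub>R v" and f' = "\<lambda>r. r *\<^sub>R v"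
              and g = "\<lambda>y. D f y u" and g' = "D (\<lambda>y. D f y u) (x + s *\<^sub>R u + t *\<^sub>R v)"])
           (use has_D[OF f2[OF 1]] in \<open>auto intro!: derivative_eq_intros\<close>)
      moreover have "D (\<lambda>y. D f y u) (x + s *\<^sub>R u + t *\<^sub>R v) (r *\<^sub>R v) =
          D (\<lambda>y. D f y u) (x + s *\<^sub>R u + t *\<^sub>R v) v * r" for r
        using linear_scale[OF D_linear[OF f2[OF 1, of u]], of r v] by simp
      ultimately show ?thesis unfolding has_field_derivative_def by simp
    qed
    have "\<exists>z>0. z < h \<and> ?k h - ?k 0 = (h - 0) * D (\<lambda>y. D f y u) (x + s *\<^sub>R u + z *\<^sub>R v) v"
      by (rule MVT2[OF h(1)]) (rule k)
    then obtain t where t: "0 < t" "t < h"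
      and kt: "?k h - ?k 0 = h * D (\<lambda>y. D f y u) (x + s *\<^sub>R u + t *\<^sub>R v) v"
      by (metis (no_types, lifting) diff_zero)
    show ?thesis using gs kt s t by (intro exI[of _ s] exI[of _ t]) (simp add: algebra_simps)
  qed
  define H where "H n = d / real (Suc n)" for n :: nat
  have H: "0 < H n" "H n \<le> d" for n using d by (auto simp: H_def field_simps)
  have H0: "H \<longlonglongrightarrow> 0"
    unfolding H_def using tendsto_mult[OF tendsto_const LIMSEQ_inverse_real_of_nat, of d]
    by (simp add: divide_inverse)
  have lim: "\<exists>X. X \<longlonglongrightarrow> D (\<lambda>y. D f y u) x v \<and> (\<forall>n. f (x + H n *\<^sub>R u + H n *\<^sub>R v) - f (x + H n *\<^sub>R u)
       - f (x + H n *\<^sub>R v) + f x = H n * H n * X n)"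
    if uv: "{u,v} = {a,b}" for u v
  proof -
    obtain s t where st: "\<And>n. 0 \<le> s n \<and> s n \<le> H n \<and> 0 \<le> t n \<and> t n \<le> H n \<and>
      f (x + H n *\<^sub>R u + H n *\<^sub>R v) - f (x + H n *\<^sub>R u) - f (x + H n *\<^sub>R v) + f x
        = H n * H n * D (\<lambda>y. D f y u) (x + s n *\<^sub>R u + t n *\<^sub>R v) v"
      using key[OF H uv] by metis
    have s0: "s \<longlonglongrightarrow> 0" and t0: "t \<longlonglongrightarrow> 0"
      using st by (auto intro!: tendsto_sandwich[OF _ _ tendsto_const H0])
    have "(\<lambda>n. x + s n *\<^sub>R u + t n *\<^sub>R v) \<longlonglongrightarrow> x + 0 *\<^sub>R u + 0 *\<^sub>R v"
      by (intro tendsto_intros s0 t0)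
    then have l: "(\<lambda>n. x + s n *\<^sub>R u + t n *\<^sub>R v) \<longlonglongrightarrow> x" by simp
    have "isCont (\<lambda>y. D (\<lambda>z. D f z u) y v) x"
      using f3 S x continuous_on_eq_continuous_at by blast
    from isCont_tendsto_compose[OF this l] st show ?thesis by blast
  qed
  obtain X where X: "X \<longlonglongrightarrow> D (\<lambda>y. D f y a) x b"
    and X': "\<And>n. f (x + H n *\<^sub>R a + H n *\<^sub>R b) - f (x + H n *\<^sub>R a) - f (x + H n *\<^sub>R b) + f x = H n * H n * X n"
    using lim[of a b] by auto
  obtain Y where Y: "Y \<longlonglongrightarrow> D (\<lambda>y. D f y b) x a"
    and Y': "\<And>n. f (x + H n *\<^sub>R b + H n *\<^sub>R a) - f (x + H n *\<^sub>R b) - f (x + H n *\<^sub>R a) + f x = H n * H n * Y n"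
    using lim[of b a] by auto
  have "H n * H n * X n = H n * H n * Y n" for n
    using X'[of n] Y'[of n] by (simp add: algebra_simps)
  then have "X = Y" using H(1) by (metis ext less_irrefl mult_cancel_left mult_eq_0_iff)
  then show ?thesis using X Y LIMSEQ_unique by blast
qed

lemma symmetric_second_derivative:
  fixes f :: "'a::euclidean_space \<Rightarrow> 'b::euclidean_space"
  assumes S: "open S" and f: "smooth_on S f" and x: "x \<in> S"
  shows "D (\<lambda>y. D f y a) x b = D (\<lambda>y. D f y b) x a"
proof (rule euclidean_eqI)
  fix i :: 'b
  have L: "bounded_linear (\<lambda>z. z \<bullet> i)" by (rule bounded_linear_inner_left)
  have 1: "D (\<lambda>y. D f y u) x v \<bullet> i = D (\<lambda>y. D (\<lambda>z. f z \<bullet> i) y u) x v" for u v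
  proof -
    have "D (\<lambda>y. D f y u) x v \<bullet> i = D (\<lambda>y. D f y u \<bullet> i) x v"
      using D_bounded_linear[OF L smooth_on_differentiable[OF smooth_on_D[OF f] x]] by simp
    also have "\<dots> = D (\<lambda>y. D (\<lambda>z. f z \<bullet> i) y u) x v"
      by (rule D_cong[OF S x]) (simp add: D_bounded_linear[OF L smooth_on_differentiable[OF f]])
    finally show ?thesis .
  qed
  have "Ck_on 2 S (\<lambda>z. f z \<bullet> i)"
    using smooth_on_linear[OF L S f] by (simp add: smooth_on_def)
  from symmetric_second_derivative_real[OF S this x]
  show "D (\<lambda>y. D f y a) x b \<bullet> i = D (\<lambda>y. D f y b) x a \<bullet> i"
    using 1 by simp
qed

section \<open>Matrix calculus\<close>

lemma bounded_bilinear_matrix_mult: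
  "bounded_bilinear ((**) :: real^'n^'m \<Rightarrow> real^'p^'n \<Rightarrow> real^'p^'m)"
proof -
  have "(A + B) ** C = A ** C + B ** C" for A B :: "real^'n^'m" and C :: "real^'p^'n"
    by (simp add: matrix_matrix_mult_def vec_eq_iff sum.distrib distrib_right)
  then show ?thesis
    unfolding bilinear_conv_bounded_bilinear[symmetric] bilinear_def linear_iff
    by (simp add: matrix_add_ldistrib matrix_scalar_ac scalar_matrix_assoc)
qed

lemma bounded_bilinear_matrix_vector_mult:
  "bounded_bilinear ((*v) :: real^'n^'m \<Rightarrow> real^'n \<Rightarrow> real^'m)"
proof -
  have "(r *\<^sub>R A) *v x = r *\<^sub>R (A *v x)" for r and A :: "real^'n^'m" and x
    by (simp add: matrix_vector_mult_def vec_eq_iff sum_distrib_left mult.assoc)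
  then show ?thesis
    unfolding bilinear_conv_bounded_bilinear[symmetric] bilinear_def linear_iff
    by (simp add: matrix_vector_right_distrib matrix_vector_mult_add_rdistrib matrix_vector_mult_scaleR)
qed

lemma bounded_linear_transpose: "bounded_linear (transpose :: real^'n^'m \<Rightarrow> real^'m^'n)"
  unfolding linear_conv_bounded_linear[symmetric] linear_iff
  by (simp add: transpose_def vec_eq_iff)

lemmas mat_distrib =
  bounded_bilinear.add_left[OF bounded_bilinear_matrix_mult]
  bounded_bilinear.add_right[OF bounded_bilinear_matrix_mult]
  bounded_bilinear.diff_left[OF bounded_bilinear_matrix_mult]
  bounded_bilinear.diff_right[OF bounded_bilinear_matrix_mult]
  bounded_bilinear.minus_left[OF bounded_bilinear_matrix_mult]
  bounded_bilinear.minus_right[OF bounded_bilinear_matrix_mult]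
  bounded_bilinear.scaleR_left[OF bounded_bilinear_matrix_mult]
  bounded_bilinear.scaleR_right[OF bounded_bilinear_matrix_mult]

lemmas matv_distrib =
  bounded_bilinear.add_left[OF bounded_bilinear_matrix_vector_mult]
  bounded_bilinear.add_right[OF bounded_bilinear_matrix_vector_mult]
  bounded_bilinear.diff_left[OF bounded_bilinear_matrix_vector_mult]
  bounded_bilinear.diff_right[OF bounded_bilinear_matrix_vector_mult]
  bounded_bilinear.minus_left[OF bounded_bilinear_matrix_vector_mult]
  bounded_bilinear.minus_right[OF bounded_bilinear_matrix_vector_mult]
  bounded_bilinear.scaleR_left[OF bounded_bilinear_matrix_vector_mult]
  bounded_bilinear.scaleR_right[OF bounded_bilinear_matrix_vector_mult]

lemma transpose_linear:
  "transpose (A + B) = transpose A + transpose B"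
  "transpose (A - B) = transpose A - transpose B"
  "transpose (- A) = - transpose A"
  "transpose (r *\<^sub>R A) = r *\<^sub>R transpose A"
  "transpose 0 = 0"
  for A B :: "real^'n^'m"
  by (simp_all add: transpose_def vec_eq_iff)

lemma inner_matrix_transpose: "u \<bullet> (A *v w) = (transpose A *v u) \<bullet> w"
  for A :: "real^'n^'m"
  by (simp add: dot_lmul_matrix transpose_matrix_vector)

lemma matrix_eq_by_inner:
  fixes A B :: "real^'n^'m"
  assumes "\<And>u w. u \<bullet> (A *v w) = u \<bullet> (B *v w)"
  shows "A = B"
proof -
  have "A *v w = B *v w" for w
    using assms vector_eq_ldot by blast
  then show ?thesis by (simp add: matrix_eq)
qed

lemma entry_eq_inner: "A $ i $ j = axis i 1 \<bullet> (A *v axis j 1)"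
  for A :: "real^'n^'m"
  by (simp add: inner_axis' matrix_vector_mult_basis column_def)

lemma matrix_field_derivatives:
  fixes A B :: "'a::euclidean_space \<Rightarrow> real^'n^'n" and p :: "'a \<Rightarrow> real^'n"
  assumes A: "A differentiable at x"
  shows D_matrix_mult: "B differentiable at x \<Longrightarrow>
      D (\<lambda>y. A y ** B y) x v = A x ** D B x v + D A x v ** B x"
    and D_matrix_vector_mult: "p differentiable at x \<Longrightarrow>
      D (\<lambda>y. A y *v p y) x v = A x *v D p x v + D A x v *v p x"
    and D_matrix_const: "D (\<lambda>y. A y *v c) x v = D A x v *v c"
    and D_transpose: "D (\<lambda>y. transpose (A y)) x v = transpose (D A x v)"
  using D_bilinear[OF bounded_bilinear_matrix_mult A, of B]
    D_bilinear[OF bounded_bilinear_matrix_vector_mult A, of p]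
    D_bilinear[OF bounded_bilinear_matrix_vector_mult A differentiable_const, of c v]
    D_bounded_linear[OF bounded_linear_transpose A]
  by (simp_all add: frechet_derivative_const)

lemmas smooth_on_matrix_mult = smooth_on_bilinear[OF bounded_bilinear_matrix_mult]
lemmas smooth_on_matrix_vector_mult = smooth_on_bilinear[OF bounded_bilinear_matrix_vector_mult]
lemmas smooth_on_transpose = smooth_on_linear[OF bounded_linear_transpose]

lemma vec_eq_sum_axis: "v = (\<Sum>i\<in>UNIV. v $ i *\<^sub>R axis i 1)" for v :: "real^'n"
  using basis_expansion[of v] by (simp add: scalar_mult_eq_scaleR)

lemma linear_eq_sum_axis:
  fixes v :: "real^'n"
  assumes "linear f" shows "f v = (\<Sum>i\<in>UNIV. v $ i *\<^sub>R f (axis i 1))"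
proof -
  have "f v = f (\<Sum>i\<in>UNIV. v $ i *\<^sub>R axis i 1)" by (rule arg_cong[OF vec_eq_sum_axis])
  also have "\<dots> = (\<Sum>i\<in>UNIV. v $ i *\<^sub>R f (axis i 1))"
    by (simp only: linear_sum[OF assms] linear_scale[OF assms])
  finally show ?thesis .
qed

lemma linear_eq_on_axis:
  fixes v :: "real^'n"
  assumes "linear f" "linear h" "\<And>i. f (axis i 1) = h (axis i 1)"
  shows "f v = h v"
  unfolding linear_eq_sum_axis[OF assms(1), of v] linear_eq_sum_axis[OF assms(2), of v] assms(3) ..

lemma linear_in_subspace_axis:
  assumes "linear f" "subspace W" "\<And>i. f (axis i 1) \<in> W" shows "f (u :: real^4) \<in> W"
  unfolding linear_eq_sum_axis[OF assms(1), of u]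
  by (intro subspace_sum[OF assms(2)] subspace_scale[OF assms(2)] assms(3))

lemma linear_bilinear_form:
  fixes \<psi> :: "real^4^4"
  shows "linear (\<lambda>u. u \<bullet> (\<psi> *v w))" "linear (\<lambda>w. u \<bullet> (\<psi> *v w))"
  by (simp_all add: linear_iff inner_add_left inner_add_right matv_distrib)

lemma D_matrix_inv:
  fixes A :: "real^'m \<Rightarrow> real^'n^'n"
  assumes S: "open S" and A: "smooth_on S A" and inv: "\<And>y. y \<in> S \<Longrightarrow> invertible (A y)" and x: "x \<in> S"
  shows "D (\<lambda>y. matrix_inv (A y)) x v = - (matrix_inv (A x) ** D A x v ** matrix_inv (A x))"
proof -
  let ?I = "\<lambda>y. matrix_inv (A y)"
  have dA: "A differentiable at x" and dI: "?I differentiable at x"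
    using smooth_on_differentiable[OF A x]
      smooth_on_differentiable[OF smooth_on_matrix_inv[OF S A inv] x] by auto
  have "?I x ** D A x v + D ?I x v ** A x = D (\<lambda>y. ?I y ** A y) x v"
    using D_matrix_mult[OF dI dA] by simp
  also have "\<dots> = D (\<lambda>y. mat 1) x v"
    by (rule D_cong[OF S x]) (simp add: matrix_inv_works inv)
  finally have "D ?I x v ** A x = - (?I x ** D A x v)"
    by (simp add: frechet_derivative_const eq_neg_iff_add_eq_0 add.commute)
  then have "D ?I x v ** (A x ** ?I x) = - (?I x ** D A x v ** ?I x)"
    by (simp add: matrix_mul_assoc mat_distrib)
  then show ?thesis by (simp add: matrix_inv_works inv x)
qed

section \<open>The Levi-Civita connection of a chart\<close>

text \<open>\<open>connection_matrix g x v\<close> is the endomorphism \<open>w \<mapsto> \<Gamma>(v, w)\<close>; the covariant derivative of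
  a field is its directional derivative corrected by the action of this matrix.\<close>

definition connection_matrix :: "(real^4 \<Rightarrow> real^4^4) \<Rightarrow> real^4 \<Rightarrow> real^4 \<Rightarrow> real^4^4" where
  "connection_matrix g x v = (\<chi> k j. \<Sum>i\<in>UNIV. v $ i * christoffel g x k i j)"

definition covariant_derivative ::
    "(real^4 \<Rightarrow> real^4^4) \<Rightarrow> (real^4 \<Rightarrow> real^4^4) \<Rightarrow> real^4 \<Rightarrow> real^4 \<Rightarrow> real^4^4" where
  "covariant_derivative g T x v =
     D T x v - transpose (connection_matrix g x v) ** T x - T x ** connection_matrix g x v"

definition curvature ::
    "(real^4 \<Rightarrow> real^4^4) \<Rightarrow> real^4 \<Rightarrow> real^4 \<Rightarrow> real^4 \<Rightarrow> real^4^4" where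
  "curvature g x a b =
     D (\<lambda>y. connection_matrix g y b) x a - D (\<lambda>y. connection_matrix g y a) x b
     + connection_matrix g x a ** connection_matrix g x b
     - connection_matrix g x b ** connection_matrix g x a"

lemma linear_connection_matrix: "linear (connection_matrix g x)"
  by (simp add: linear_iff connection_matrix_def vec_eq_iff sum.distrib distrib_right sum_distrib_left mult.assoc)

lemma connection_matrix_axis: "connection_matrix g x (axis i 1) $ k $ j = christoffel g x k i j"
  by (simp add: connection_matrix_def axis_def if_distrib[where f="\<lambda>z. z * _"] cong: if_cong)

lemma linear_covariant_derivative:
  assumes "T differentiable at x"
  shows "linear (covariant_derivative g T x)"
proof -
  note l = linear_connection_matrix[of g x] D_linear[OF assms]
  show ?thesis
    unfolding linear_iff covariant_derivative_def
    by (simp add: linear_add[OF l(1)] linear_add[OF l(2)] linear_scale[OF l(1)] linear_scale[OF l(2)]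
      transpose_linear mat_distrib scaleR_diff_right)
qed

lemma nabla_form_eq:
  "nabla_form g T x $ i = covariant_derivative g T x (axis i 1)"
  by (simp add: nabla_form_def covariant_derivative_def partial_deriv_def vec_eq_iff
    transpose_def matrix_matrix_mult_def connection_matrix_axis mult.commute)

lemma nabla_endo_eq:
  "nabla_endo g J x $ i = D J x (axis i 1) + connection_matrix g x (axis i 1) ** J x
     - J x ** connection_matrix g x (axis i 1)"
  by (simp add: nabla_endo_def partial_deriv_def vec_eq_iff
    matrix_matrix_mult_def connection_matrix_axis mult.commute)

locale metric_chart =
  fixes U :: "(real^4) set" and g :: "real^4 \<Rightarrow> real^4^4"
  assumes open_U: "open U" and smooth_g: "smooth_on U g"
    and metric_symmetric: "x \<in> U \<Longrightarrow> transpose (g x) = g x"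
    and metric_positive: "x \<in> U \<Longrightarrow> v \<noteq> 0 \<Longrightarrow> 0 < v \<bullet> (g x *v v)"
begin

abbreviation \<Gamma> where "\<Gamma> \<equiv> connection_matrix g"
abbreviation nabla (\<open>\<nabla>\<close>) where "\<nabla> \<equiv> covariant_derivative g"
abbreviation g_inv where "g_inv x \<equiv> matrix_inv (g x)"

lemma metric_invertible: "x \<in> U \<Longrightarrow> invertible (g x)"
proof -
  assume x: "x \<in> U"
  have "v = 0" if "g x *v v = 0" for v
    using metric_positive[OF x, of v] that by force
  then show ?thesis by (metis invertible_left_inverse matrix_left_invertible_ker)
qed

lemma metric_inverse: "x \<in> U \<Longrightarrow> g x ** g_inv x = mat 1" "x \<in> U \<Longrightarrow> g_inv x ** g x = mat 1"
  using matrix_inv_works metric_invertible by auto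

lemma transpose_g_inv: "x \<in> U \<Longrightarrow> transpose (g_inv x) = g_inv x"
proof -
  assume x: "x \<in> U"
  have "transpose (g_inv x) ** g x = transpose (g x ** g_inv x)"
    by (simp add: matrix_transpose_mul metric_symmetric x)
  then have "transpose (g_inv x) ** g x = mat 1" by (simp add: metric_inverse x)
  then show ?thesis using matrix_inv_eqI by metis
qed

lemma smooth_g_inv: "smooth_on U g_inv"
  using smooth_on_matrix_inv[OF open_U smooth_g metric_invertible] .

lemma smooth_connection: "smooth_on U (\<lambda>x. \<Gamma> x v)"
proof (rule smooth_on_matrixI[OF open_U])
  fix k j
  have "smooth_on U (partial_deriv i g)" for i
    using smooth_on_D[OF smooth_g, of "axis i 1"] by (simp add: partial_deriv_def[abs_def])
  then show "smooth_on U (\<lambda>x. \<Gamma> x v $ k $ j)"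
    unfolding connection_matrix_def christoffel_def
    by (simp, intro smooth_on_sum smooth_on_mult smooth_on_divide smooth_on_add smooth_on_diff
       smooth_on_const smooth_on_nth smooth_g_inv open_U) auto
qed

lemma partial_g_symmetric:
  assumes "x \<in> U" shows "partial_deriv i g x $ j $ l = partial_deriv i g x $ l $ j"
proof -
  have "D (\<lambda>y. transpose (g y)) x v = D g x v" for v
    by (rule D_cong[OF open_U assms]) (simp add: metric_symmetric)
  then have "transpose (D g x v) = D g x v" for v
    using D_transpose[OF smooth_on_differentiable[OF smooth_g assms]] by simp
  from this[of "axis i 1"] have "transpose (partial_deriv i g x) $ l $ j = partial_deriv i g x $ l $ j"
    by (simp add: partial_deriv_def)
  then show ?thesis by (simp add: transpose_def)
qed

lemma christoffel_symmetric: "x \<in> U \<Longrightarrow> christoffel g x k i j = christoffel g x k j i"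
  unfolding christoffel_def by (simp add: partial_g_symmetric[of x _ i j] add.commute)

text \<open>This is the vanishing of the torsion. It makes correction terms in the direction of
  differentiation cancel in every antisymmetrised or cyclic sum.\<close>

lemma connection_symmetric: "x \<in> U \<Longrightarrow> \<Gamma> x u *v w = \<Gamma> x w *v u"
proof -
  assume x: "x \<in> U"
  have 1: "(\<Gamma> x u *v w) $ k = (\<Sum>j\<in>UNIV. \<Sum>i\<in>UNIV. u $ i * w $ j * christoffel g x k i j)" for k u w
    by (simp add: matrix_vector_mult_def connection_matrix_def sum_distrib_right sum_distrib_left mult_ac)
  have "(\<Gamma> x u *v w) $ k = (\<Gamma> x w *v u) $ k" for k
    unfolding 1 by (subst sum.swap) (simp add: christoffel_symmetric[OF x, of k] mult_ac)
  then show ?thesis by (simp add: vec_eq_iff)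
qed

lemma christoffel_lowered:
  assumes "x \<in> U"
  shows "(\<Sum>m\<in>UNIV. g x $ k $ m * christoffel g x m i j) =
    (1/2) * (partial_deriv i g x $ j $ k + partial_deriv j g x $ i $ k - partial_deriv k g x $ i $ j)"
proof -
  define c :: "real^4" where
    "c = (\<chi> l. partial_deriv i g x $ j $ l + partial_deriv j g x $ i $ l - partial_deriv l g x $ i $ j)"
  have "(\<Sum>m\<in>UNIV. g x $ k $ m * christoffel g x m i j) = (1/2) * (g x *v (g_inv x *v c)) $ k"
    by (simp add: christoffel_def matrix_vector_mult_def c_def sum_distrib_left mult_ac)
  also have "\<dots> = (1/2) * c $ k"
    by (simp add: matrix_vector_mul_assoc metric_inverse[OF assms])
  finally show ?thesis by (simp add: c_def)
qed

lemma metric_parallel: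
  assumes "x \<in> U" shows "\<nabla> g x v = 0"
proof -
  have l: "linear (\<nabla> g x)"
    by (rule linear_covariant_derivative[OF smooth_on_differentiable[OF smooth_g assms]])
  have "\<nabla> g x (axis i 1) $ j $ k = 0" for i j k
  proof -
    have s: "g x $ m $ n = g x $ n $ m" for m n
      using arg_cong[OF metric_symmetric[OF assms], of "\<lambda>A. A $ n $ m"] by (simp add: transpose_def)
    have t: "(\<Sum>m\<in>UNIV. christoffel g x m i j * g x $ m $ k) = (\<Sum>m\<in>UNIV. g x $ k $ m * christoffel g x m i j)"
      by (rule sum.cong[OF refl], subst s) (rule mult.commute)
    have "\<nabla> g x (axis i 1) $ j $ k = partial_deriv i g x $ j $ k
        - (\<Sum>m\<in>UNIV. g x $ k $ m * christoffel g x m i j)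
        - (\<Sum>m\<in>UNIV. g x $ j $ m * christoffel g x m i k)"
      by (simp add: covariant_derivative_def partial_deriv_def transpose_def matrix_matrix_mult_def
          connection_matrix_axis t)
    then show ?thesis
      unfolding christoffel_lowered[OF assms] distrib_left right_diff_distrib
      using partial_g_symmetric[OF assms, of i j k] partial_g_symmetric[OF assms, of j i k]
        partial_g_symmetric[OF assms, of k i j]
      by linarith
  qed
  then have "\<nabla> g x (axis i 1) = 0" for i by (simp add: vec_eq_iff)
  then show ?thesis
    using linear_eq_on_axis[OF l, of "\<lambda>_. 0" v] by (simp add: linear_iff)
qed

lemma D_metric:
  "x \<in> U \<Longrightarrow> D g x v = transpose (\<Gamma> x v) ** g x + g x ** \<Gamma> x v"
  using metric_parallel[of x v] by (simp add: covariant_derivative_def algebra_simps)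

lemma D_g_inv:
  assumes "x \<in> U"
  shows "D g_inv x v = - (g_inv x ** transpose (\<Gamma> x v)) - \<Gamma> x v ** g_inv x"
proof -
  have 1: "g_inv x ** (g x ** A) = A" for A :: "real^4^4"
    by (simp add: matrix_mul_assoc metric_inverse[OF assms])
  have 2: "A ** g x ** g_inv x = A" for A :: "real^4^4"
    by (simp add: matrix_mul_assoc[symmetric] metric_inverse[OF assms])
  show ?thesis
    using D_matrix_inv[OF open_U smooth_g metric_invertible assms]
    by (simp add: D_metric assms mat_distrib matrix_mul_assoc 2 metric_inverse)
qed

text \<open>The Ricci identity: antisymmetrised second covariant derivatives are curvature. The slot
  of the first differentiation needs no correction term, because the connection is symmetric.\<close>

lemma ricci_identity:
  assumes x: "x \<in> U" and T: "smooth_on U T"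
  shows "D (\<lambda>y. \<nabla> T y b) x a - transpose (\<Gamma> x a) ** \<nabla> T x b - \<nabla> T x b ** \<Gamma> x a
       - (D (\<lambda>y. \<nabla> T y a) x b - transpose (\<Gamma> x b) ** \<nabla> T x a - \<nabla> T x a ** \<Gamma> x b)
     = - (transpose (curvature g x a b) ** T x + T x ** curvature g x a b)"
proof -
  have dT: "T differentiable at x" using smooth_on_differentiable[OF T x] .
  have dG: "(\<lambda>y. \<Gamma> y v) differentiable at x" for v using smooth_on_differentiable[OF smooth_connection x] .
  have dGt: "(\<lambda>y. transpose (\<Gamma> y v)) differentiable at x" for v
    using smooth_on_differentiable[OF smooth_on_transpose[OF open_U smooth_connection] x] .
  have 1: "D (\<lambda>y. \<nabla> T y b) x a = D (\<lambda>y. D T y b) x a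
      - (transpose (\<Gamma> x b) ** D T x a + transpose (D (\<lambda>y. \<Gamma> y b) x a) ** T x)
      - (T x ** D (\<lambda>y. \<Gamma> y b) x a + D T x a ** \<Gamma> x b)" for a b
  proof -
    have 2: "((\<lambda>y. transpose (\<Gamma> y b) ** T y) has_derivative D (\<lambda>y. transpose (\<Gamma> y b) ** T y) x) (at x)"
        "((\<lambda>y. T y ** \<Gamma> y b) has_derivative D (\<lambda>y. T y ** \<Gamma> y b) x) (at x)"
        "((\<lambda>y. D T y b) has_derivative D (\<lambda>y. D T y b) x) (at x)"
      by (intro smooth_on_has_D[OF _ x] smooth_on_matrix_mult smooth_on_transpose smooth_connection
          T open_U smooth_on_D)+
    have "D (\<lambda>y. \<nabla> T y b) x a = D (\<lambda>y. D T y b) x a - D (\<lambda>y. transpose (\<Gamma> y b) ** T y) x a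
        - D (\<lambda>y. T y ** \<Gamma> y b) x a"
      unfolding covariant_derivative_def
      by (rule D_eq[OF has_derivative_diff[OF has_derivative_diff[OF 2(3) 2(1)] 2(2)]])
    then show ?thesis
      by (simp add: D_matrix_mult[OF dGt dT] D_matrix_mult[OF dT dG] D_transpose[OF dG])
  qed
  show ?thesis
    unfolding 1 symmetric_second_derivative[OF open_U T x, of a b]
    by (simp add: covariant_derivative_def curvature_def transpose_linear mat_distrib
        matrix_transpose_mul matrix_mul_assoc)
qed

lemma curvature_antisymmetric: "curvature g x a b = - curvature g x b a"
  by (simp add: curvature_def)

lemma curvature_bianchi:
  assumes x: "x \<in> U"
  shows "curvature g x a b *v c + curvature g x b c *v a + curvature g x c a *v b = 0"
proof -
  have 1: "D (\<lambda>y. \<Gamma> y v) x u *v w = D (\<lambda>y. \<Gamma> y w) x u *v v" for u v w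
  proof -
    note d = smooth_on_differentiable[OF smooth_connection x]
    have "D (\<lambda>y. \<Gamma> y v *v w) x u = D (\<lambda>y. \<Gamma> y w *v v) x u"
      by (rule D_cong[OF open_U x]) (rule connection_symmetric)
    then show ?thesis by (simp add: D_matrix_const[OF d])
  qed
  show ?thesis
    unfolding curvature_def matv_distrib matrix_vector_mul_assoc[symmetric]
    using 1[of a b c] 1[of b c a] 1[of c a b]
      connection_symmetric[OF x, of a b] connection_symmetric[OF x, of b c] connection_symmetric[OF x, of c a]
    by simp
qed

lemma curvature_metric:
  assumes x: "x \<in> U"
  shows "transpose (curvature g x a b) ** g x = - (g x ** curvature g x a b)"
proof -
  have "D (\<lambda>y. \<nabla> g y v) x u = D (\<lambda>y. 0) x u" for u v
    by (rule D_cong[OF open_U x]) (simp add: metric_parallel)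
  then have "- (transpose (curvature g x a b) ** g x) = g x ** curvature g x a b"
    using ricci_identity[OF x smooth_g, of b a]
    by (simp add: metric_parallel x frechet_derivative_const)
  then show ?thesis by (metis minus_minus)
qed

end

text \<open>Adding and subtracting the four cyclic identities for the four letters, only the terms
  \<open>R a b c d\<close> and \<open>R c d a b\<close> survive.\<close>

lemma pair_symmetry:
  fixes R :: "'a \<Rightarrow> 'a \<Rightarrow> 'a \<Rightarrow> 'a \<Rightarrow> real"
  assumes "\<And>a b c d. R a b c d = - R b a c d" "\<And>a b c d. R a b c d = - R a b d c"
    and "\<And>a b c d. R a b c d + R b c a d + R c a b d = 0"
  shows "R a b c d = R c d a b"
proof -
  have "R c a b d = - R a c b d" "R b c d a = - R b c a d" "R c d b a = - R c d a b"
    "R d b c a = R b d a c" "R d a c b = R a d b c" "R a c d b = - R a c b d"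
    "R d a b c = - R a d b c" "R a b d c = - R a b c d"
    using assms(1,2) by (metis minus_minus)+
  then show ?thesis
    using assms(3)[of a b c d] assms(3)[of b c d a] assms(3)[of c d a b] assms(3)[of d a b c]
    by linarith
qed

section \<open>The curvature of a Kaehler chart\<close>

locale kaehler_chart = metric_chart +
  fixes J :: "real^4 \<Rightarrow> real^4^4"
  assumes smooth_J: "smooth_on U J"
    and J_square: "x \<in> U \<Longrightarrow> J x ** J x = - mat 1"
    and J_orthogonal: "x \<in> U \<Longrightarrow> transpose (J x) ** g x ** J x = g x"
    and J_oriented: "x \<in> U \<Longrightarrow> det (vector [X, J x *v X, Y, J x *v Y] :: real^4^4) \<noteq> 0 \<Longrightarrow>
       0 < det (vector [X, J x *v X, Y, J x *v Y] :: real^4^4)"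
    and J_parallel: "x \<in> U \<Longrightarrow> nabla_endo g J x = 0"
begin

abbreviation \<omega> where "\<omega> x \<equiv> transpose (J x) ** g x"

lemma J_J: "x \<in> U \<Longrightarrow> J x *v (J x *v v) = - v"
  by (simp add: matrix_vector_mul_assoc J_square matv_distrib)

lemma smooth_\<omega>: "smooth_on U \<omega>"
  by (intro smooth_on_matrix_mult smooth_on_transpose smooth_J smooth_g open_U)

lemma transpose_J_metric:
  assumes "x \<in> U" shows "transpose (J x) ** g x = - (g x ** J x)"
proof -
  have "transpose (J x) ** g x ** (J x ** J x) = g x ** J x"
    using J_orthogonal[OF assms] by (simp add: matrix_mul_assoc)
  then have "- (transpose (J x) ** g x) = g x ** J x" by (simp add: J_square assms mat_distrib)
  then show ?thesis by (metis minus_minus)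
qed

lemma g_inv_transpose_J:
  assumes "x \<in> U" shows "g_inv x ** transpose (J x) = - (J x ** g_inv x)"
proof -
  have "g_inv x ** transpose (J x) = g_inv x ** (transpose (J x) ** g x) ** g_inv x"
    by (simp add: matrix_mul_assoc[symmetric] metric_inverse assms)
  also have "\<dots> = - (J x ** g_inv x)"
    by (simp add: transpose_J_metric assms mat_distrib matrix_mul_assoc metric_inverse)
  finally show ?thesis .
qed

lemma transpose_\<omega>: "x \<in> U \<Longrightarrow> transpose (\<omega> x) = - \<omega> x"
  by (simp add: matrix_transpose_mul metric_symmetric transpose_J_metric transpose_linear)

lemma D_J:
  assumes x: "x \<in> U" shows "D J x v = J x ** \<Gamma> x v - \<Gamma> x v ** J x"
proof -
  have l: "linear (D J x)" by (rule D_linear[OF smooth_on_differentiable[OF smooth_J x]])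
  have l': "linear (\<lambda>v. J x ** \<Gamma> x v - \<Gamma> x v ** J x)"
    unfolding linear_iff by (simp add: linear_add[OF linear_connection_matrix]
      linear_scale[OF linear_connection_matrix] mat_distrib scaleR_diff_right)
  show ?thesis
  proof (rule linear_eq_on_axis[OF l l'])
    fix i
    have "nabla_endo g J x $ i = 0" by (simp add: J_parallel x)
    then show "D J x (axis i 1) = J x ** \<Gamma> x (axis i 1) - \<Gamma> x (axis i 1) ** J x"
      unfolding nabla_endo_eq by (simp add: algebra_simps eq_neg_iff_add_eq_0)
  qed
qed

lemma \<omega>_parallel:
  assumes x: "x \<in> U" shows "\<nabla> \<omega> x v = 0"
proof -
  note dJ = smooth_on_differentiable[OF smooth_J x]
  have "D \<omega> x v = transpose (J x) ** D g x v + transpose (D J x v) ** g x"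
    using D_matrix_mult[OF _ smooth_on_differentiable[OF smooth_g x], of "\<lambda>y. transpose (J y)" v]
      smooth_on_differentiable[OF smooth_on_transpose[OF open_U smooth_J] x] D_transpose[OF dJ]
    by simp
  then show ?thesis
    by (simp add: covariant_derivative_def D_metric D_J x transpose_linear mat_distrib
        matrix_transpose_mul matrix_mul_assoc)
qed

lemma D_\<omega>: "x \<in> U \<Longrightarrow> D \<omega> x v = transpose (\<Gamma> x v) ** \<omega> x + \<omega> x ** \<Gamma> x v"
  using \<omega>_parallel[of x v] by (simp add: covariant_derivative_def algebra_simps)

lemma curvature_commutes_J:
  assumes x: "x \<in> U"
  shows "curvature g x a b ** J x = J x ** curvature g x a b"
proof -
  let ?F = "curvature g x a b"
  have "D (\<lambda>y. \<nabla> \<omega> y v) x u = D (\<lambda>y. 0) x u" for u v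
    by (rule D_cong[OF open_U x]) (simp add: \<omega>_parallel)
  then have "- (transpose ?F ** \<omega> x) = \<omega> x ** ?F"
    using ricci_identity[OF x smooth_\<omega>, of b a] by (simp add: \<omega>_parallel x frechet_derivative_const)
  then have "(transpose ?F ** g x) ** J x = - (g x ** (J x ** ?F))"
    unfolding transpose_J_metric[OF x] by (simp add: mat_distrib matrix_mul_assoc)
  then have "g x ** (?F ** J x) = g x ** (J x ** ?F)"
    unfolding curvature_metric[OF x] by (simp add: mat_distrib matrix_mul_assoc)
  then have "(g_inv x ** g x) ** (?F ** J x) = (g_inv x ** g x) ** (J x ** ?F)"
    by (metis matrix_mul_assoc)
  then show ?thesis by (simp add: metric_inverse x)
qed

text \<open>By pair symmetry the curvature operator inherits in its two-form arguments the
  \<open>J\<close>-invariance which it has as an endomorphism.\<close>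

lemma curvature_J_invariant:
  assumes x: "x \<in> U"
  shows "curvature g x (J x *v a) (J x *v b) = curvature g x a b"
proof -
  define R where "R a b c d = d \<bullet> (g x *v (curvature g x a b *v c))" for a b c d
  have 1: "R a b c d = - R b a c d" for a b c d
    unfolding R_def by (subst curvature_antisymmetric) (simp add: matv_distrib)
  have 2: "R a b c d = - R a b d c" for a b c d
  proof -
    have "R a b c d = d \<bullet> ((g x ** curvature g x a b) *v c)"
      by (simp add: R_def matrix_vector_mul_assoc)
    also have "\<dots> = - (d \<bullet> ((transpose (curvature g x a b) ** g x) *v c))"
      by (simp add: curvature_metric x matv_distrib)
    also have "\<dots> = - R a b d c"
      by (simp add: R_def matrix_vector_mul_assoc[symmetric])
        (metis inner_commute inner_matrix_transpose metric_symmetric transpose_transpose x)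
    finally show ?thesis .
  qed
  have 3: "R a b c d + R b c a d + R c a b d = 0" for a b c d
    unfolding R_def
    by (simp add: inner_add_right[symmetric] matrix_vector_right_distrib[symmetric] curvature_bianchi x)
  note ps = pair_symmetry[of R, OF 1 2 3]
  have J: "R a b (J x *v c) (J x *v d) = R a b c d" for a b c d
  proof -
    have "R a b (J x *v c) (J x *v d) = (J x *v d) \<bullet> (g x *v ((curvature g x a b ** J x) *v c))"
      by (simp add: R_def matrix_vector_mul_assoc)
    also have "\<dots> = d \<bullet> ((transpose (J x) ** g x ** J x) *v (curvature g x a b *v c))"
      by (simp add: curvature_commutes_J x matrix_vector_mul_assoc[symmetric])
        (metis inner_commute inner_matrix_transpose transpose_transpose)
    finally show ?thesis by (simp add: J_orthogonal x R_def)
  qed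
  have "R (J x *v a) (J x *v b) c d = R a b c d" for c d
    using ps J by metis
  then have "g x ** curvature g x (J x *v a) (J x *v b) = g x ** curvature g x a b"
    by (intro matrix_eq_by_inner) (simp add: R_def matrix_vector_mul_assoc[symmetric])
  then have "g_inv x ** g x ** curvature g x (J x *v a) (J x *v b) = g_inv x ** g x ** curvature g x a b"
    by (metis matrix_mul_assoc)
  then show ?thesis by (simp add: metric_inverse x)
qed

end

section \<open>Determinants and four-forms in dimension four\<close>

lemma vector_4_nth:
  fixes a b c d :: "'a::zero"
  shows "(vector [a, b, c, d] :: 'a^4) $ 1 = a" "(vector [a, b, c, d] :: 'a^4) $ 2 = b"
    "(vector [a, b, c, d] :: 'a^4) $ 3 = c" "(vector [a, b, c, d] :: 'a^4) $ 4 = d"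
  unfolding vector_def by simp_all

lemma det_4:
  fixes A :: "real^4^4"
  shows "det A =
      A$1$1 * A$2$2 * A$3$3 * A$4$4 - A$1$1 * A$2$2 * A$3$4 * A$4$3
    - A$1$1 * A$2$3 * A$3$2 * A$4$4 + A$1$1 * A$2$3 * A$3$4 * A$4$2
    + A$1$1 * A$2$4 * A$3$2 * A$4$3 - A$1$1 * A$2$4 * A$3$3 * A$4$2
    - A$1$2 * A$2$1 * A$3$3 * A$4$4 + A$1$2 * A$2$1 * A$3$4 * A$4$3
    + A$1$2 * A$2$3 * A$3$1 * A$4$4 - A$1$2 * A$2$3 * A$3$4 * A$4$1
    - A$1$2 * A$2$4 * A$3$1 * A$4$3 + A$1$2 * A$2$4 * A$3$3 * A$4$1
    + A$1$3 * A$2$1 * A$3$2 * A$4$4 - A$1$3 * A$2$1 * A$3$4 * A$4$2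
    - A$1$3 * A$2$2 * A$3$1 * A$4$4 + A$1$3 * A$2$2 * A$3$4 * A$4$1
    + A$1$3 * A$2$4 * A$3$1 * A$4$2 - A$1$3 * A$2$4 * A$3$2 * A$4$1
    - A$1$4 * A$2$1 * A$3$2 * A$4$3 + A$1$4 * A$2$1 * A$3$3 * A$4$2
    + A$1$4 * A$2$2 * A$3$1 * A$4$3 - A$1$4 * A$2$2 * A$3$3 * A$4$1
    - A$1$4 * A$2$3 * A$3$1 * A$4$2 + A$1$4 * A$2$3 * A$3$2 * A$4$1"
proof -
  have f1: "finite {2::4, 3, 4}" "1 \<notin> {2::4, 3, 4}" by auto
  have f2: "finite {3::4, 4}" "2 \<notin> {3::4, 4}" by auto
  have f3: "finite {4::4}" "3 \<notin> {4::4}" by auto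
  show ?thesis
    unfolding det_def UNIV_4
    unfolding sum_over_permutations_insert[OF f1]
    unfolding sum_over_permutations_insert[OF f2]
    unfolding sum_over_permutations_insert[OF f3]
    unfolding permutes_sing
    by (simp add: sign_swap_id permutation_swap_id permutation_compose sign_compose sign_id swap_id_eq)
qed

definition multilinear4 :: "(real^4 \<Rightarrow> real^4 \<Rightarrow> real^4 \<Rightarrow> real^4 \<Rightarrow> real) \<Rightarrow> bool" where
  "multilinear4 F \<longleftrightarrow> (\<forall>Y Z W. linear (\<lambda>X. F X Y Z W)) \<and> (\<forall>X Z W. linear (\<lambda>Y. F X Y Z W)) \<and>
     (\<forall>X Y W. linear (\<lambda>Z. F X Y Z W)) \<and> (\<forall>X Y Z. linear (\<lambda>W. F X Y Z W))"

lemma multilinear4_eqI: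
  assumes F: "multilinear4 F" and H: "multilinear4 H"
    and eq: "\<And>i j k l. F (axis i 1) (axis j 1) (axis k 1) (axis l 1) =
      H (axis i 1) (axis j 1) (axis k 1) (axis l 1)"
  shows "F X Y Z W = H X Y Z W"
proof -
  have 1: "F X (axis j 1) (axis k 1) (axis l 1) = H X (axis j 1) (axis k 1) (axis l 1)" for X j k l
    using F H eq by (intro linear_eq_on_axis[of "\<lambda>X. F X (axis j 1) (axis k 1) (axis l 1)"
          "\<lambda>X. H X (axis j 1) (axis k 1) (axis l 1)" X]) (auto simp: multilinear4_def)
  have 2: "F X Y (axis k 1) (axis l 1) = H X Y (axis k 1) (axis l 1)" for X Y k l
    using F H 1 by (intro linear_eq_on_axis[of "\<lambda>Y. F X Y (axis k 1) (axis l 1)"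
          "\<lambda>Y. H X Y (axis k 1) (axis l 1)" Y]) (auto simp: multilinear4_def)
  have 3: "F X Y Z (axis l 1) = H X Y Z (axis l 1)" for X Y Z l
    using F H 2 by (intro linear_eq_on_axis[of "\<lambda>Z. F X Y Z (axis l 1)"
          "\<lambda>Z. H X Y Z (axis l 1)" Z]) (auto simp: multilinear4_def)
  show ?thesis
    using F H 3 by (intro linear_eq_on_axis[of "\<lambda>W. F X Y Z W" "\<lambda>W. H X Y Z W" W])
      (auto simp: multilinear4_def)
qed

definition det_vectors :: "real^4 \<Rightarrow> real^4 \<Rightarrow> real^4 \<Rightarrow> real^4 \<Rightarrow> real" where
  "det_vectors X Y Z W = det (vector [X, Y, Z, W] :: real^4^4)"

lemma det_vectors_eq:
  "det_vectors X Y Z W =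
      X$1 * Y$2 * Z$3 * W$4 - X$1 * Y$2 * Z$4 * W$3 - X$1 * Y$3 * Z$2 * W$4 + X$1 * Y$3 * Z$4 * W$2
    + X$1 * Y$4 * Z$2 * W$3 - X$1 * Y$4 * Z$3 * W$2 - X$2 * Y$1 * Z$3 * W$4 + X$2 * Y$1 * Z$4 * W$3
    + X$2 * Y$3 * Z$1 * W$4 - X$2 * Y$3 * Z$4 * W$1 - X$2 * Y$4 * Z$1 * W$3 + X$2 * Y$4 * Z$3 * W$1
    + X$3 * Y$1 * Z$2 * W$4 - X$3 * Y$1 * Z$4 * W$2 - X$3 * Y$2 * Z$1 * W$4 + X$3 * Y$2 * Z$4 * W$1
    + X$3 * Y$4 * Z$1 * W$2 - X$3 * Y$4 * Z$2 * W$1 - X$4 * Y$1 * Z$2 * W$3 + X$4 * Y$1 * Z$3 * W$2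
    + X$4 * Y$2 * Z$1 * W$3 - X$4 * Y$2 * Z$3 * W$1 - X$4 * Y$3 * Z$1 * W$2 + X$4 * Y$3 * Z$2 * W$1"
  unfolding det_vectors_def det_4 vector_4_nth ..

lemma multilinear4_det_vectors: "multilinear4 det_vectors"
  unfolding multilinear4_def linear_iff det_vectors_eq by (simp add: algebra_simps)

lemma det_vectors_matrix_mult:
  "det_vectors (E *v X) (E *v Y) (E *v Z) (E *v W) = det E * det_vectors X Y Z W"
proof -
  have "(vector [E *v X, E *v Y, E *v Z, E *v W] :: real^4^4) = vector [X, Y, Z, W] ** transpose E"
    by (simp add: vec_eq_iff forall_4 vector_4_nth matrix_matrix_mult_def matrix_vector_mult_def
        transpose_def mult.commute)
  then show ?thesis by (simp add: det_vectors_def det_mul mult.commute)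
qed

text \<open>The value of \<open>\<alpha> \<and> \<alpha>\<close> on four vectors; the factor 2 appears because the six terms of the wedge
  product agree in pairs.\<close>

definition wedge_vectors :: "real^4^4 \<Rightarrow> real^4 \<Rightarrow> real^4 \<Rightarrow> real^4 \<Rightarrow> real^4 \<Rightarrow> real" where
  "wedge_vectors \<alpha> X Y Z W =
     2 * ((X \<bullet> (\<alpha> *v Y)) * (Z \<bullet> (\<alpha> *v W)) - (X \<bullet> (\<alpha> *v Z)) * (Y \<bullet> (\<alpha> *v W))
       + (X \<bullet> (\<alpha> *v W)) * (Y \<bullet> (\<alpha> *v Z)))"

lemma multilinear4_wedge_vectors: "multilinear4 (wedge_vectors \<alpha>)"
  unfolding multilinear4_def linear_iff wedge_vectors_def
  by (simp add: matv_distrib inner_add_left inner_add_right algebra_simps)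

lemma wedge_vectors_axis:
  "wedge_vectors \<alpha> (axis i 1) (axis j 1) (axis k 1) (axis l 1) = wedge_2forms \<alpha> \<alpha> i j k l"
  by (simp add: wedge_vectors_def wedge_2forms_def entry_eq_inner[symmetric] algebra_simps)

lemma antisymmetric_entries:
  fixes \<alpha> :: "real^4^4"
  assumes "transpose \<alpha> = - \<alpha>"
  shows "\<alpha> $ j $ i = - \<alpha> $ i $ j"
  using arg_cong[OF assms, of "\<lambda>A. A $ i $ j"] by (simp add: transpose_def)

text \<open>Both sides are linear in each vector, so it suffices to compare them on coordinate vectors.
  This reduces the definition of the pfaffian to one component and gives the behaviour of that
  component under pullback.\<close>

lemma wedge_vectors_det:
  assumes a: "transpose \<alpha> = - \<alpha>"
  shows "wedge_vectors \<alpha> X Y Z W = det_vectors X Y Z W * wedge_2forms \<alpha> \<alpha> 1 2 3 4"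
proof (rule multilinear4_eqI[where F = "wedge_vectors \<alpha>" and
      H = "\<lambda>X Y Z W. det_vectors X Y Z W * wedge_2forms \<alpha> \<alpha> 1 2 3 4"])
  show "multilinear4 (wedge_vectors \<alpha>)" by (rule multilinear4_wedge_vectors)
  show "multilinear4 (\<lambda>X Y Z W. det_vectors X Y Z W * wedge_2forms \<alpha> \<alpha> 1 2 3 4)"
  proof -
    have "linear (\<lambda>X. f X * c)" if "linear f" for f :: "real^4 \<Rightarrow> real" and c
      using that by (simp add: linear_iff distrib_right)
    then show ?thesis using multilinear4_det_vectors unfolding multilinear4_def by blast
  qed
next
  fix i j k l
  have z: "\<alpha> $ i $ i = 0" for i using antisymmetric_entries[OF a, of i i] by simp
  note s = antisymmetric_entries[OF a, of 2 1] antisymmetric_entries[OF a, of 3 1]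
    antisymmetric_entries[OF a, of 4 1] antisymmetric_entries[OF a, of 3 2]
    antisymmetric_entries[OF a, of 4 2] antisymmetric_entries[OF a, of 4 3]
  have "\<forall>i j k l. wedge_2forms \<alpha> \<alpha> i j k l =
      det_vectors (axis i 1) (axis j 1) (axis k 1) (axis l 1) * wedge_2forms \<alpha> \<alpha> 1 2 3 4"
    unfolding forall_4
    by (intro conjI; simp add: z s det_vectors_eq wedge_2forms_def axis_def)
  then show "wedge_vectors \<alpha> (axis i 1) (axis j 1) (axis k 1) (axis l 1) =
      det_vectors (axis i 1) (axis j 1) (axis k 1) (axis l 1) * wedge_2forms \<alpha> \<alpha> 1 2 3 4"
    unfolding wedge_vectors_axis by blast
qed

lemma wedge_2forms_det:
  assumes "transpose \<alpha> = - \<alpha>"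
  shows "wedge_2forms \<alpha> \<alpha> i j k l =
    det_vectors (axis i 1) (axis j 1) (axis k 1) (axis l 1) * wedge_2forms \<alpha> \<alpha> 1 2 3 4"
  using wedge_vectors_det[OF assms, of "axis i 1" "axis j 1" "axis k 1" "axis l 1"]
  unfolding wedge_vectors_axis .

lemma wedge_2forms_pullback:
  assumes a: "transpose \<alpha> = - \<alpha>"
  shows "wedge_2forms (transpose E ** \<alpha> ** E) (transpose E ** \<alpha> ** E) 1 2 3 4 =
    det E * wedge_2forms \<alpha> \<alpha> 1 2 3 4"
proof -
  have "wedge_2forms (transpose E ** \<alpha> ** E) (transpose E ** \<alpha> ** E) 1 2 3 4 =
      wedge_vectors \<alpha> (E *v axis 1 1) (E *v axis 2 1) (E *v axis 3 1) (E *v axis 4 1)"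
    unfolding wedge_vectors_axis[symmetric] wedge_vectors_def
    by (simp add: inner_matrix_transpose[of _ "transpose E"] matrix_vector_mul_assoc[symmetric])
  also have "\<dots> = det E * (det_vectors (axis 1 1) (axis 2 1) (axis 3 1) (axis 4 1) *
      wedge_2forms \<alpha> \<alpha> 1 2 3 4)"
    by (simp add: wedge_vectors_det[OF a] det_vectors_matrix_mult)
  also have "det_vectors (axis 1 1) (axis 2 1) (axis 3 1) (axis 4 1) = 1"
    by (simp add: det_vectors_eq axis_def)
  finally show ?thesis by simp
qed

section \<open>Hermitian frames\<close>

definition standard_J :: "real^4^4" where
  "standard_J = vector [vector [0, - 1, 0, 0], vector [1, 0, 0, 0],
     vector [0, 0, 0, - 1], vector [0, 0, 1, 0]]"

lemma standard_J_axis: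
  "standard_J *v axis 1 1 = axis 2 1" "standard_J *v axis 2 1 = - axis 1 1"
  "standard_J *v axis 3 1 = axis 4 1" "standard_J *v axis 4 1 = - axis 3 1"
  by (simp_all add: matrix_vector_mult_def standard_J_def vec_eq_iff forall_4 sum_4 vector_4_nth axis_def)

text \<open>The columns of \<open>E\<close> form an oriented orthonormal basis \<open>b\<^sub>1, Jb\<^sub>1, b\<^sub>3, Jb\<^sub>3\<close> of the tangent
  space. In it \<open>G\<close>, \<open>J\<close> and the volume form have their standard components.\<close>

locale hermitian_frame =
  fixes G J E :: "real^4^4"
  assumes G_symmetric: "transpose G = G"
    and frame_orthonormal: "transpose E ** G ** E = mat 1"
    and frame_J: "J ** E = E ** standard_J"
    and frame_oriented: "0 < det E"

text \<open>Take a unit vector \<open>b\<close> and a unit vector \<open>d\<close> orthogonal to \<open>b\<close> and \<open>Jb\<close>, which exists for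
  reasons of dimension. That \<open>Jd\<close> is orthogonal to the other three follows from \<open>J\<close> being orthogonal
  with square \<open>-1\<close>.\<close>

lemma hermitian_frame_exists:
  fixes G J :: "real^4^4"
  assumes sym: "transpose G = G" and pos: "\<And>v. v \<noteq> 0 \<Longrightarrow> 0 < v \<bullet> (G *v v)"
    and JJ: "J ** J = - mat 1" and orth: "transpose J ** G ** J = G"
    and orient: "\<And>X Y. det (vector [X, J *v X, Y, J *v Y] :: real^4^4) \<noteq> 0 \<Longrightarrow>
       0 < det (vector [X, J *v X, Y, J *v Y] :: real^4^4)"
  shows "\<exists>E. hermitian_frame G J E"
proof -
  define ip where "ip u v = u \<bullet> (G *v v)" for u v
  have JJv: "J *v (J *v v) = - v" for v by (simp add: matrix_vector_mul_assoc JJ matv_distrib)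
  have ip_sym: "ip u v = ip v u" for u v
    unfolding ip_def by (subst inner_matrix_transpose) (simp add: sym inner_commute)
  have ip_J: "ip (J *v u) (J *v v) = ip u v" for u v
  proof -
    have "ip u v = u \<bullet> (transpose J *v (G *v (J *v v)))"
      unfolding ip_def by (subst orth[symmetric]) (simp add: matrix_vector_mul_assoc matrix_mul_assoc)
    then show ?thesis by (simp add: ip_def inner_matrix_transpose[of _ "transpose J"])
  qed
  have ip_minus: "ip u (- v) = - ip u v" "ip (- u) v = - ip u v" for u v
    by (simp_all add: ip_def matv_distrib)
  have ip_scale: "ip (r *\<^sub>R u) (s *\<^sub>R v) = r * s * ip u v" for r s u v
    by (simp add: ip_def matv_distrib)
  have ip_J2: "ip (J *v u) v = - ip u (J *v v)" for u v
    using ip_J[of u "J *v v"] by (simp add: JJv ip_minus)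
  have ip_self: "ip u (J *v u) = 0" for u
    using ip_J2[of u u] ip_sym[of u "J *v u"] by simp
  have norml: "\<exists>r. ip (r *\<^sub>R v) (r *\<^sub>R v) = 1" if "v \<noteq> 0" for v
  proof (intro exI)
    show "ip ((1 / sqrt (ip v v)) *\<^sub>R v) ((1 / sqrt (ip v v)) *\<^sub>R v) = 1"
      using pos[OF that] unfolding ip_scale ip_def[symmetric] by simp
  qed
  have "(axis 1 1 :: real^4) \<noteq> 0" by (simp add: axis_eq_0_iff)
  then obtain b where b: "ip b b = 1" using norml by blast
  have "dim {G *v b, G *v (J *v b)} \<le> card {G *v b, G *v (J *v b)}" by (rule dim_le_card') simp
  also have "\<dots> < DIM(real^4)" by (simp add: card_insert_if)
  finally obtain y where y: "y \<noteq> 0" "\<And>z. z \<in> span {G *v b, G *v (J *v b)} \<Longrightarrow> orthogonal y z"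
    using orthogonal_to_subspace_exists by blast
  have "ip y b = 0" "ip y (J *v b) = 0"
    using y(2) unfolding orthogonal_def ip_def by (meson insertI1 insertI2 span_base)+
  then have y': "ip (r *\<^sub>R y) b = 0" "ip (r *\<^sub>R y) (J *v b) = 0" for r
    using ip_scale[of r y 1 b] ip_scale[of r y 1 "J *v b"] by simp_all
  obtain r where r: "ip (r *\<^sub>R y) (r *\<^sub>R y) = 1" using norml y(1) by blast
  define d where "d = r *\<^sub>R y"
  have d: "ip d b = 0" "ip d (J *v b) = 0" "ip d d = 1"
    using y' r by (simp_all add: d_def)
  have e: "ip b d = 0" "ip (J *v b) d = 0" "ip b (J *v d) = 0" "ip (J *v d) b = 0"
    using d ip_sym ip_J2 by (metis minus_zero)+
  define B :: "real^4^4" where "B = vector [b, J *v b, d, J *v d]"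
  define E where "E = transpose B"
  have E: "E *v axis 1 1 = b" "E *v axis 2 1 = J *v b" "E *v axis 3 1 = d" "E *v axis 4 1 = J *v d"
    by (simp_all add: E_def B_def matrix_vector_mult_basis row_def vector_4_nth)
  have entry: "(transpose E ** G ** E) $ i $ j = ip (E *v axis i 1) (E *v axis j 1)" for i j
    by (simp add: entry_eq_inner ip_def inner_matrix_transpose[of _ "transpose E"]
        matrix_vector_mul_assoc[symmetric])
  have "\<forall>i j. (transpose E ** G ** E) $ i $ j = mat 1 $ i $ j"
    unfolding entry forall_4 E by (simp add: mat_def b d e ip_self ip_J ip_J2 JJv ip_minus)
  then have 1: "transpose E ** G ** E = mat 1" by (simp add: vec_eq_iff)
  have "\<forall>i. (J ** E) *v axis i 1 = (E ** standard_J) *v axis i 1"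
    unfolding forall_4 matrix_vector_mul_assoc[symmetric]
    by (simp add: E JJv matv_distrib standard_J_axis)
  then have 2: "J ** E = E ** standard_J"
    by (simp add: vec_eq_iff matrix_vector_mult_basis column_def)
  have "det E \<noteq> 0"
    using arg_cong[OF 1, of det] by (auto simp: det_mul)
  then have 3: "0 < det E"
    using orient[of b d] by (simp add: E_def B_def)
  show ?thesis using sym 1 2 3 unfolding hermitian_frame_def by blast
qed

context hermitian_frame
begin

definition b :: "4 \<Rightarrow> real^4" where "b m = E *v axis m 1"

lemma G_inverse: "matrix_inv G = E ** transpose E"
proof -
  have "E ** (transpose E ** G) = mat 1"
    using frame_orthonormal matrix_left_right_inverse by blast
  then show ?thesis by (intro matrix_inv_eqI) (simp add: matrix_mul_assoc)
qed

lemma frame_inner: "b i \<bullet> (G *v b j) = (if i = j then 1 else 0)"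
proof -
  have "b i \<bullet> (G *v b j) = (transpose E ** G ** E) $ i $ j"
    by (simp add: b_def entry_eq_inner inner_matrix_transpose[of _ "transpose E"]
        matrix_vector_mul_assoc[symmetric])
  then show ?thesis by (simp add: frame_orthonormal mat_def)
qed

lemma frame_J_b: "J *v b 1 = b 2" "J *v b 2 = - b 1" "J *v b 3 = b 4" "J *v b 4 = - b 3"
proof -
  have "J *v b i = E *v (standard_J *v axis i 1)" for i
    by (simp add: b_def matrix_vector_mul_assoc frame_J)
  then show "J *v b 1 = b 2" "J *v b 2 = - b 1" "J *v b 3 = b 4" "J *v b 4 = - b 3"
    by (simp_all add: standard_J_axis) (simp_all add: b_def matv_distrib)
qed

abbreviation \<omega> where "\<omega> \<equiv> transpose J ** G"

lemma frame_\<omega>: "u \<bullet> (\<omega> *v v) = (J *v u) \<bullet> (G *v v)"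
  by (simp add: matrix_vector_mul_assoc[symmetric] inner_matrix_transpose[of _ "transpose J"])

lemma frame_expansion: "v = (\<Sum>m\<in>UNIV. (b m \<bullet> (G *v v)) *\<^sub>R b m)"
proof -
  have nth: "(transpose E *v w) $ m = b m \<bullet> w" for w m
    using inner_matrix_transpose[of "axis m 1" "transpose E" w] by (simp add: b_def inner_axis')
  have "v = E *v (transpose E *v (G *v v))"
    using frame_orthonormal matrix_left_right_inverse[of "transpose E ** G" E]
    by (simp add: matrix_vector_mul_assoc matrix_mul_assoc[symmetric])
  also have "\<dots> = (\<Sum>m\<in>UNIV. (transpose E *v (G *v v)) $ m *\<^sub>R b m)"
    unfolding b_def by (rule linear_eq_sum_axis) simp
  also have "\<dots> = (\<Sum>m\<in>UNIV. (b m \<bullet> (G *v v)) *\<^sub>R b m)"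
    by (simp only: nth)
  finally show ?thesis .
qed

lemma linear_eq_on_frame:
  assumes "linear f" "linear h" "\<And>m. f (b m) = h (b m)"
  shows "f v = h v"
proof -
  have "k v = (\<Sum>m\<in>UNIV. (b m \<bullet> (G *v v)) *\<^sub>R k (b m))" if "linear k" for k :: "real^4 \<Rightarrow> 'x::real_vector"
    using arg_cong[OF frame_expansion[of v], of k] by (simp only: linear_sum[OF that] linear_scale[OF that])
  from this[OF assms(1)] this[OF assms(2)] show ?thesis using assms(3) by simp
qed

lemma matrix_eq_on_frame:
  fixes A B :: "real^4^4"
  assumes "\<And>m n. b m \<bullet> (A *v b n) = b m \<bullet> (B *v b n)"
  shows "A = B"
proof (rule matrix_eq_by_inner)
  fix u w
  have l: "linear (\<lambda>u. u \<bullet> (C *v w))" "linear (\<lambda>w. u \<bullet> (C *v w))" for C :: "real^4^4" and u w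
    by (simp_all add: linear_iff inner_add_left inner_add_right matv_distrib)
  have 1: "b m \<bullet> (A *v w) = b m \<bullet> (B *v w)" for m w
    by (rule linear_eq_on_frame[OF l(2) l(2)]) (rule assms)
  show "u \<bullet> (A *v w) = u \<bullet> (B *v w)"
    by (rule linear_eq_on_frame[OF l(1) l(1)]) (rule 1)
qed

text \<open>Contraction with the inverse metric is summation over an orthonormal frame.\<close>

lemma frame_trace:
  assumes "bilinear h"
  shows "(\<Sum>i\<in>UNIV. \<Sum>j\<in>UNIV. matrix_inv G $ i $ j * h (axis i 1) (axis j 1)) = (\<Sum>m\<in>UNIV. h (b m) (b m))"
proof -
  have l: "linear (\<lambda>x. h x y)" "linear (h y)" for y using assms by (auto simp: bilinear_def)
  have nth: "b m $ i = E $ i $ m" for m i by (simp add: b_def matrix_vector_mult_basis column_def)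
  have "h (b m) (b m) = (\<Sum>i\<in>UNIV. \<Sum>j\<in>UNIV. E $ i $ m * E $ j $ m * h (axis i 1) (axis j 1))" for m
  proof -
    have "h (b m) (b m) = (\<Sum>i\<in>UNIV. b m $ i *\<^sub>R h (axis i 1) (b m))"
      by (rule linear_eq_sum_axis[OF l(1)])
    also have "\<dots> = (\<Sum>i\<in>UNIV. b m $ i *\<^sub>R (\<Sum>j\<in>UNIV. b m $ j *\<^sub>R h (axis i 1) (axis j 1)))"
      by (intro sum.cong refl arg_cong[where f = "(*\<^sub>R) _"] linear_eq_sum_axis[OF l(2)])
    finally show ?thesis by (simp add: nth sum_distrib_left mult.assoc)
  qed
  then have "(\<Sum>m\<in>UNIV. h (b m) (b m)) =
      (\<Sum>m\<in>UNIV. \<Sum>i\<in>UNIV. \<Sum>j\<in>UNIV. E $ i $ m * E $ j $ m * h (axis i 1) (axis j 1))"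
    by simp
  also have "\<dots> = (\<Sum>i\<in>UNIV. \<Sum>m\<in>UNIV. \<Sum>j\<in>UNIV. E $ i $ m * E $ j $ m * h (axis i 1) (axis j 1))"
    by (rule sum.swap)
  also have "\<dots> = (\<Sum>i\<in>UNIV. \<Sum>j\<in>UNIV. \<Sum>m\<in>UNIV. E $ i $ m * E $ j $ m * h (axis i 1) (axis j 1))"
    by (intro sum.cong refl sum.swap)
  also have "\<dots> = (\<Sum>i\<in>UNIV. \<Sum>j\<in>UNIV. matrix_inv G $ i $ j * h (axis i 1) (axis j 1))"
    by (simp add: G_inverse matrix_matrix_mult_def transpose_def sum_distrib_right)
  finally show ?thesis ..
qed

lemma volume_form_frame:
  "volume_form G (b m) (b n) (b p) (b q) = det_vectors (axis m 1) (axis n 1) (axis p 1) (axis q 1)"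
proof -
  have "det E * det G * det E = 1"
    using arg_cong[OF frame_orthonormal, of det] by (simp add: det_mul)
  then have "det G = (1 / det E)\<^sup>2"
    using frame_oriented by (simp add: field_simps power2_eq_square)
  then have "sqrt (det G) * det E = 1"
    using frame_oriented by (simp add: real_sqrt_divide)
  then have "sqrt (det G) * (det E * x) = x" for x by (metis mult.assoc mult_1)
  then show ?thesis
    unfolding volume_form_def det_vectors_def[symmetric] b_def det_vectors_matrix_mult .
qed

lemma hodge_star_frame:
  "u \<bullet> (hodge_star G \<psi> *v w) =
    (1/2) * (\<Sum>m\<in>UNIV. \<Sum>n\<in>UNIV. (b m \<bullet> (\<psi> *v b n)) * volume_form G (b m) (b n) u w)"
proof -
  have ml: "multilinear4 (volume_form G)"
    using multilinear4_det_vectors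
    unfolding multilinear4_def linear_iff volume_form_def det_vectors_def[symmetric]
    by (simp add: algebra_simps)
  have l3: "linear (\<lambda>u. volume_form G X Y u w)" and l4: "linear (\<lambda>w. volume_form G X Y u w)"
    and l1: "linear (\<lambda>X. volume_form G X Y u w)" and l2: "linear (\<lambda>Y. volume_form G X Y u w)" for X Y u w
    using ml unfolding multilinear4_def by blast+
  let ?r = "\<lambda>u w. (1/2) * (\<Sum>m\<in>UNIV. \<Sum>n\<in>UNIV. (b m \<bullet> (\<psi> *v b n)) * volume_form G (b m) (b n) u w)"
  have lin: "linear (\<lambda>u. ?r u w)" "linear (\<lambda>w. ?r u w)" for u w
    using l3 l4 by (auto simp: linear_iff sum.distrib distrib_left sum_distrib_left mult.left_commute add_divide_distrib)
  have "hodge_star G \<psi> $ k $ l = ?r (axis k 1) (axis l 1)" for k l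
  proof -
    let ?V = "\<lambda>X Y. volume_form G X Y (axis k 1) (axis l 1)"
    have bl1: "bilinear (\<lambda>X Y. (axis a 1 \<bullet> (\<psi> *v Y)) * ?V (axis i 1) X)" for a i
      using l2 unfolding bilinear_def linear_iff
      by (simp add: inner_add_right matv_distrib algebra_simps)
    have bl2: "bilinear (\<lambda>X Y. \<Sum>n\<in>UNIV. (Y \<bullet> (\<psi> *v b n)) * ?V X (b n))"
      using l1 unfolding bilinear_def linear_iff
      by (simp add: inner_add_left sum.distrib distrib_left distrib_right sum_distrib_left mult.left_commute mult.assoc)
    have "hodge_star G \<psi> $ k $ l = (1/2) * (\<Sum>i\<in>UNIV. \<Sum>j\<in>UNIV. \<Sum>a\<in>UNIV. \<Sum>c\<in>UNIV.
        matrix_inv G $ i $ a * (matrix_inv G $ j $ c * ((axis a 1 \<bullet> (\<psi> *v axis c 1)) * ?V (axis i 1) (axis j 1))))"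
      by (simp add: hodge_star_def entry_eq_inner[symmetric] mult.assoc)
    also have "\<dots> = (1/2) * (\<Sum>i\<in>UNIV. \<Sum>a\<in>UNIV. \<Sum>j\<in>UNIV. \<Sum>c\<in>UNIV.
        matrix_inv G $ i $ a * (matrix_inv G $ j $ c * ((axis a 1 \<bullet> (\<psi> *v axis c 1)) * ?V (axis i 1) (axis j 1))))"
      by (intro arg_cong[where f = "(*) (1/2)"] sum.cong refl sum.swap)
    also have "\<dots> = (1/2) * (\<Sum>i\<in>UNIV. \<Sum>a\<in>UNIV. matrix_inv G $ i $ a *
        (\<Sum>n\<in>UNIV. (axis a 1 \<bullet> (\<psi> *v b n)) * ?V (axis i 1) (b n)))"
      unfolding sum_distrib_left[symmetric] frame_trace[OF bl1] ..
    also have "\<dots> = ?r (axis k 1) (axis l 1)"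
      unfolding frame_trace[OF bl2] ..
    finally show ?thesis .
  qed
  then have 1: "axis k 1 \<bullet> (hodge_star G \<psi> *v axis l 1) = ?r (axis k 1) (axis l 1)" for k l
    by (simp only: entry_eq_inner)
  have 2: "axis k 1 \<bullet> (hodge_star G \<psi> *v w) = ?r (axis k 1) w" for k w
    by (rule linear_eq_on_axis[OF linear_bilinear_form(2) lin(2)]) (rule 1)
  show ?thesis
    by (rule linear_eq_on_axis[OF linear_bilinear_form(1) lin(1)]) (rule 2)
qed

lemma inner_2forms_frame:
  "inner_2forms G \<alpha> \<beta> = (\<Sum>m\<in>UNIV. \<Sum>n\<in>UNIV. (b m \<bullet> (\<alpha> *v b n)) * (b m \<bullet> (\<beta> *v b n)))"
proof -
  have bl1: "bilinear (\<lambda>X Y. (axis i 1 \<bullet> (\<alpha> *v X)) * (axis k 1 \<bullet> (\<beta> *v Y)))" for i k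
    unfolding bilinear_def linear_iff by (simp add: inner_add_right matv_distrib algebra_simps)
  have bl2: "bilinear (\<lambda>X Y. \<Sum>n\<in>UNIV. (X \<bullet> (\<alpha> *v b n)) * (Y \<bullet> (\<beta> *v b n)))"
    unfolding bilinear_def linear_iff
    by (simp add: inner_add_left sum.distrib distrib_left distrib_right sum_distrib_left mult.left_commute mult.assoc)
  have "inner_2forms G \<alpha> \<beta> = (\<Sum>i\<in>UNIV. \<Sum>j\<in>UNIV. \<Sum>k\<in>UNIV. \<Sum>l\<in>UNIV.
      matrix_inv G $ i $ k * (matrix_inv G $ j $ l *
        ((axis i 1 \<bullet> (\<alpha> *v axis j 1)) * (axis k 1 \<bullet> (\<beta> *v axis l 1)))))"
    by (simp add: inner_2forms_def entry_eq_inner[symmetric] mult.assoc)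
  also have "\<dots> = (\<Sum>i\<in>UNIV. \<Sum>k\<in>UNIV. \<Sum>j\<in>UNIV. \<Sum>l\<in>UNIV.
      matrix_inv G $ i $ k * (matrix_inv G $ j $ l *
        ((axis i 1 \<bullet> (\<alpha> *v axis j 1)) * (axis k 1 \<bullet> (\<beta> *v axis l 1)))))"
    by (intro sum.cong refl sum.swap)
  also have "\<dots> = (\<Sum>i\<in>UNIV. \<Sum>k\<in>UNIV. matrix_inv G $ i $ k *
      (\<Sum>n\<in>UNIV. (axis i 1 \<bullet> (\<alpha> *v b n)) * (axis k 1 \<bullet> (\<beta> *v b n))))"
    unfolding sum_distrib_left[symmetric] frame_trace[OF bl1] ..
  also have "\<dots> = (\<Sum>m\<in>UNIV. \<Sum>n\<in>UNIV. (b m \<bullet> (\<alpha> *v b n)) * (b m \<bullet> (\<beta> *v b n)))"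
    unfolding frame_trace[OF bl2] ..
  finally show ?thesis .
qed

lemma inner_3tensors_frame:
  assumes "linear T" "linear S"
  shows "inner_3tensors G (\<chi> i. T (axis i 1)) (\<chi> i. S (axis i 1)) =
    (\<Sum>m\<in>UNIV. inner_2forms G (T (b m)) (S (b m)))"
proof -
  have "bilinear (\<lambda>X Y. inner_2forms G (T X) (S Y))"
    unfolding bilinear_def linear_iff inner_2forms_frame
    by (simp add: linear_add[OF assms(1)] linear_add[OF assms(2)] linear_scale[OF assms(1)]
        linear_scale[OF assms(2)] inner_add_right matv_distrib sum.distrib distrib_left distrib_right
        sum_distrib_left mult.left_commute mult.assoc)
  from frame_trace[OF this] show ?thesis by (simp add: inner_3tensors_def)
qed

lemma contraction_frame:
  assumes "linear T"
  shows "contraction G (\<chi> i. T (axis i 1)) $ k = (\<Sum>m\<in>UNIV. b m \<bullet> (T (b m) *v axis k 1))"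
proof -
  have "bilinear (\<lambda>X Y. Y \<bullet> (T X *v axis k 1))"
    unfolding bilinear_def linear_iff
    by (simp add: linear_add[OF assms] linear_scale[OF assms] inner_add_right inner_add_left matv_distrib)
  from frame_trace[OF this] show ?thesis by (simp add: contraction_def entry_eq_inner)
qed

text \<open>The familiar description of the \<open>-1\<close> eigenspace of the Hodge star in an oriented orthonormal
  basis. Here the orientation enters: the Kaehler form \<open>b\<^sup>1 \<and> b\<^sup>2 + b\<^sup>3 \<and> b\<^sup>4\<close> is selfdual.\<close>

lemma asd_forms_frame:
  "\<psi> \<in> asd_forms G \<longleftrightarrow> transpose \<psi> = - \<psi> \<and> b 1 \<bullet> (\<psi> *v b 2) = - (b 3 \<bullet> (\<psi> *v b 4)) \<and>
     b 1 \<bullet> (\<psi> *v b 3) = b 2 \<bullet> (\<psi> *v b 4) \<and> b 1 \<bullet> (\<psi> *v b 4) = - (b 2 \<bullet> (\<psi> *v b 3))"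
proof (cases "transpose \<psi> = - \<psi>")
  case True
  define f where "f m n = b m \<bullet> (\<psi> *v b n)" for m n
  have anti: "f n m = - f m n" for m n
    unfolding f_def by (subst inner_matrix_transpose) (simp add: True matv_distrib inner_commute)
  have f0: "f m m = 0" for m using anti[of m m] by simp
  note s = anti[of 1 2] anti[of 1 3] anti[of 1 4] anti[of 2 3] anti[of 2 4] anti[of 3 4]
  have "hodge_star G \<psi> = - \<psi> \<longleftrightarrow> (\<forall>p q. b p \<bullet> (hodge_star G \<psi> *v b q) = - f p q)"
    by (auto simp: f_def matv_distrib intro!: matrix_eq_on_frame)
  also have "\<dots> \<longleftrightarrow> (\<forall>p q. (1/2) * (\<Sum>m\<in>UNIV. \<Sum>n\<in>UNIV. f m n *
      det_vectors (axis m 1) (axis n 1) (axis p 1) (axis q 1)) = - f p q)"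
    unfolding hodge_star_frame volume_form_frame f_def ..
  also have "\<dots> \<longleftrightarrow> f 1 2 = - f 3 4 \<and> f 1 3 = f 2 4 \<and> f 1 4 = - f 2 3"
    unfolding forall_4 sum_4 det_vectors_eq axis_def by (auto simp: f0 s)
  finally show ?thesis using True by (simp add: asd_forms_def f_def)
qed (simp add: asd_forms_def)

end

section \<open>The algebra of hamiltonian two-forms in one tangent space\<close>

definition wedge_1forms :: "real^4 \<Rightarrow> real^4 \<Rightarrow> real^4^4" where
  "wedge_1forms p q = (\<chi> i j. p $ i * q $ j - q $ i * p $ j)"

lemma wedge_1forms_apply:
  "u \<bullet> (wedge_1forms p q *v w) = (p \<bullet> u) * (q \<bullet> w) - (q \<bullet> u) * (p \<bullet> w)"
proof -
  have "wedge_1forms p q *v w = (q \<bullet> w) *\<^sub>R p - (p \<bullet> w) *\<^sub>R q"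
    by (simp add: wedge_1forms_def matrix_vector_mult_def vec_eq_iff inner_vec_def left_diff_distrib
        right_diff_distrib sum_subtractf sum_distrib_left mult_ac)
  then show ?thesis by (simp add: inner_diff_right inner_commute mult.commute)
qed

lemma trace_wedge_1forms:
  fixes A :: "real^4^4"
  assumes "transpose A = - A"
  shows "trace (A ** wedge_1forms a c) = 2 * (c \<bullet> (A *v a))"
proof -
  have "trace (A ** wedge_1forms a c) = c \<bullet> (A *v a) - a \<bullet> (A *v c)"
    by (simp add: trace_def matrix_matrix_mult_def wedge_1forms_def inner_vec_def matrix_vector_mult_def
        sum_distrib_left right_diff_distrib sum_subtractf mult_ac)
  moreover have "a \<bullet> (A *v c) = - (c \<bullet> (A *v a))"
    by (subst inner_matrix_transpose) (simp add: assms matv_distrib inner_commute)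
  ultimately show ?thesis by simp
qed

text \<open>The covariant derivative of \<open>\<psi>\<close> in direction \<open>u\<close>, as a function of \<open>p = d\<sigma>\<close>. As covectors,
  \<open>- (transpose J *v p)\<close> is \<open>\<omega>(\<Lambda>,\<cdot>)\<close> for the gradient \<open>\<Lambda>\<close> belonging to \<open>p\<close>, and
  \<open>- ((transpose J ** G) *v u)\<close> is \<open>\<omega>(u,\<cdot>)\<close>.\<close>

definition hamiltonian_derivative :: "real^4^4 \<Rightarrow> real^4^4 \<Rightarrow> real^4 \<Rightarrow> real^4 \<Rightarrow> real^4^4" where
  "hamiltonian_derivative G J p u = (1/2) *\<^sub>R (wedge_1forms (G *v u) (- (transpose J *v p)) +
     wedge_1forms p (- ((transpose J ** G) *v u)))"

lemma hamiltonian_derivative_apply: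
  "v \<bullet> (hamiltonian_derivative G J p u *v w) = (1/2) *
    ((p \<bullet> (J *v v)) * (w \<bullet> (G *v u)) - (p \<bullet> (J *v w)) * (v \<bullet> (G *v u))
     + ((J *v v) \<bullet> (G *v u)) * (p \<bullet> w) - ((J *v w) \<bullet> (G *v u)) * (p \<bullet> v))"
proof -
  have 1: "(transpose J *v x) \<bullet> y = x \<bullet> (J *v y)" for x y
    by (simp add: inner_matrix_transpose)
  show ?thesis
    by (simp add: hamiltonian_derivative_def matv_distrib inner_add_right wedge_1forms_apply
        matrix_vector_mul_assoc[symmetric] 1 inner_commute[of "G *v u"] algebra_simps)
qed

lemma transpose_hamiltonian_derivative:
  "transpose (hamiltonian_derivative G J p u) = - hamiltonian_derivative G J p u"
proof -
  have "transpose (wedge_1forms p q) = - wedge_1forms p q" for p q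
    by (simp add: wedge_1forms_def transpose_def vec_eq_iff)
  then show ?thesis by (simp add: hamiltonian_derivative_def transpose_linear scaleR_right_distrib scaleR_diff_right)
qed

lemma linear_hamiltonian_derivative: "linear (hamiltonian_derivative G J p)"
  unfolding linear_iff
  by (auto intro!: matrix_eq_by_inner simp: hamiltonian_derivative_apply matv_distrib inner_add_right
      algebra_simps)

context hermitian_frame
begin

lemma frame_\<omega>_values:
  "b 1 \<bullet> (\<omega> *v b 2) = 1" "b 2 \<bullet> (\<omega> *v b 1) = - 1" "b 3 \<bullet> (\<omega> *v b 4) = 1" "b 4 \<bullet> (\<omega> *v b 3) = - 1"
  "b 1 \<bullet> (\<omega> *v b 1) = 0" "b 2 \<bullet> (\<omega> *v b 2) = 0" "b 3 \<bullet> (\<omega> *v b 3) = 0" "b 4 \<bullet> (\<omega> *v b 4) = 0"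
  "b 1 \<bullet> (\<omega> *v b 3) = 0" "b 1 \<bullet> (\<omega> *v b 4) = 0" "b 2 \<bullet> (\<omega> *v b 3) = 0" "b 2 \<bullet> (\<omega> *v b 4) = 0"
  "b 3 \<bullet> (\<omega> *v b 1) = 0" "b 3 \<bullet> (\<omega> *v b 2) = 0" "b 4 \<bullet> (\<omega> *v b 1) = 0" "b 4 \<bullet> (\<omega> *v b 2) = 0"
  by (simp_all add: frame_\<omega> frame_J_b frame_inner)

lemma transpose_\<omega>: "transpose \<omega> = - \<omega>"
proof (rule matrix_eq_on_frame)
  fix m n
  have "\<forall>m n. b m \<bullet> (transpose \<omega> *v b n) = b m \<bullet> (- \<omega> *v b n)"
    unfolding forall_4 inner_matrix_transpose[of _ "transpose \<omega>"] transpose_transpose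
    by (simp add: inner_commute[of "_ *v _"] matv_distrib frame_\<omega>_values)
  then show "b m \<bullet> (transpose \<omega> *v b n) = b m \<bullet> (- \<omega> *v b n)" by blast
qed

lemma inner_2forms_\<omega>: "inner_2forms G \<omega> \<omega> = 4"
  unfolding inner_2forms_frame sum_4 frame_\<omega>_values by simp

lemma subspace_asd_forms: "subspace (asd_forms G)"
  by (rule subspaceI) (auto simp: asd_forms_frame transpose_linear matv_distrib inner_add_right)

lemma linear_in_subspace_frame:
  assumes "linear f" "subspace W" "\<And>m. f (b m) \<in> W" shows "f u \<in> W"
proof -
  have "f u = (\<Sum>m\<in>UNIV. (b m \<bullet> (G *v u)) *\<^sub>R f (b m))"
    using arg_cong[OF frame_expansion[of u], of f]
    by (simp only: linear_sum[OF assms(1)] linear_scale[OF assms(1)])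
  then show ?thesis
    by (simp only:) (intro subspace_sum[OF assms(2)] subspace_scale[OF assms(2)] assms(3))
qed

text \<open>Let \<open>P\<close> be the candidate on the right-hand side and \<open>S = T - P\<close>. Both \<open>T\<close> and \<open>P\<close> satisfy the
  closedness equation and take anti-selfdual values, so \<open>S\<close> has anti-selfdual values and vanishing
  cyclic sums. Therefore \<open>S\<close> has no divergence and lies in \<open>V1 G\<close>. It is orthogonal to \<open>T\<close> because
  \<open>T\<close> lies in \<open>V0 G\<close>, and to \<open>P\<close> by the same divergence equations; hence \<open>S\<close> has norm zero.\<close>

lemma twistor_derivative:
  assumes T: "linear T" and V0: "(\<chi> i. T (axis i 1)) \<in> V0 G"
    and closed: "\<And>u v w. v \<bullet> (T u *v w) + w \<bullet> (T v *v u) + u \<bullet> (T w *v v)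
      + (3/2) * ((p \<bullet> u) * (v \<bullet> (\<omega> *v w)) + (p \<bullet> v) * (w \<bullet> (\<omega> *v u)) + (p \<bullet> w) * (u \<bullet> (\<omega> *v v))) = 0"
  shows "T u = hamiltonian_derivative G J p u - ((1/2) * (p \<bullet> u)) *\<^sub>R \<omega>"
proof -
  define P where "P u = hamiltonian_derivative G J p u - ((1/2) * (p \<bullet> u)) *\<^sub>R \<omega>" for u
  have P: "linear P"
    unfolding P_def linear_iff
    by (simp add: linear_add[OF linear_hamiltonian_derivative] linear_scale[OF linear_hamiltonian_derivative]
        inner_add_right scaleR_diff_right algebra_simps)
  define S where "S u = T u - P u" for u
  have S: "linear S" unfolding S_def by (intro linear_compose_sub T P)
  have P_apply: "v \<bullet> (P u *v w) = (1/2) *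
    ((p \<bullet> (J *v v)) * (w \<bullet> (G *v u)) - (p \<bullet> (J *v w)) * (v \<bullet> (G *v u))
     + ((J *v v) \<bullet> (G *v u)) * (p \<bullet> w) - ((J *v w) \<bullet> (G *v u)) * (p \<bullet> v)
     - (p \<bullet> u) * (v \<bullet> (\<omega> *v w)))" for u v w
    by (simp add: P_def matv_distrib inner_diff_right hamiltonian_derivative_apply)
  define p1 p2 p3 p4 where p_def: "p1 = p \<bullet> b 1" "p2 = p \<bullet> b 2" "p3 = p \<bullet> b 3" "p4 = p \<bullet> b 4"
  note vals = frame_J_b frame_inner frame_\<omega>_values p_def[symmetric]
  have "transpose (P u) = - P u" for u
    by (simp add: P_def transpose_linear transpose_hamiltonian_derivative transpose_\<omega>)
  moreover have "\<forall>a. b 1 \<bullet> (P (b a) *v b 2) = - (b 3 \<bullet> (P (b a) *v b 4)) \<and>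
     b 1 \<bullet> (P (b a) *v b 3) = b 2 \<bullet> (P (b a) *v b 4) \<and> b 1 \<bullet> (P (b a) *v b 4) = - (b 2 \<bullet> (P (b a) *v b 3))"
    unfolding forall_4 P_apply by (simp add: vals)
  ultimately have P_asd: "P u \<in> asd_forms G" for u
    using linear_in_subspace_frame[OF P subspace_asd_forms] by (simp add: asd_forms_frame)
  have T_axis: "T (axis i 1) \<in> asd_forms G" for i
    using V0 by (simp add: V0_def cotangent_asd_def)
  have T_asd: "T u \<in> asd_forms G" for u
    using linear_in_subspace_axis[OF T subspace_asd_forms] T_axis by blast
  have S_asd: "S u \<in> asd_forms G" for u
    unfolding S_def using subspace_diff[OF subspace_asd_forms] T_asd P_asd by blast
  define s where "s a c d = b c \<bullet> (S (b a) *v b d)" for a c d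
  have s_anti: "s a d c = - s a c d" for a c d
  proof -
    have "transpose (S (b a)) = - S (b a)" using S_asd by (simp add: asd_forms_frame)
    then show ?thesis unfolding s_def
      by (subst inner_matrix_transpose) (simp add: matv_distrib inner_commute)
  qed
  have s_zero: "s a c c = 0" for a c using s_anti[of a c c] by simp
  have s_asd: "s a 3 4 = - s a 1 2" "s a 2 4 = s a 1 3" "s a 2 3 = - s a 1 4" for a
    using S_asd[of "b a"] by (simp_all add: asd_forms_frame s_def)
  note s_rules = s_zero s_asd s_anti[of _ 2 1] s_anti[of _ 3 1] s_anti[of _ 4 1]
    s_anti[of _ 3 2] s_anti[of _ 4 2] s_anti[of _ 4 3]
  have s_cyclic: "s a c d + s c d a + s d a c = - (b c \<bullet> (P (b a) *v b d) + b d \<bullet> (P (b c) *v b a) + b a \<bullet> (P (b d) *v b c)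
      + (3/2) * ((p \<bullet> b a) * (b c \<bullet> (\<omega> *v b d)) + (p \<bullet> b c) * (b d \<bullet> (\<omega> *v b a)) + (p \<bullet> b d) * (b a \<bullet> (\<omega> *v b c))))" for a c d
    using closed[where u = "b a" and v = "b c" and w = "b d"]
    by (simp add: s_def S_def matv_distrib inner_diff_right)
  \<comment> \<open>For anti-selfdual values, closedness is the same as vanishing divergence.\<close>
  have div: "s 3 1 2 = s 1 1 4 + s 2 1 3" "s 4 1 2 = s 2 1 4 - s 1 1 3"
    "s 1 1 2 = s 4 1 3 - s 3 1 4" "s 2 1 2 = - s 3 1 3 - s 4 1 4"
    using s_cyclic[of 1 2 3] s_cyclic[of 1 2 4] s_cyclic[of 1 3 4] s_cyclic[of 2 3 4]
    unfolding P_apply by (simp_all add: vals s_rules)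
  have "\<forall>c. (\<Sum>a\<in>UNIV. s a a c) = 0"
    unfolding forall_4 sum_4 by (simp add: s_rules div)
  then have "(\<Sum>m\<in>UNIV. b m \<bullet> (S (b m) *v w)) = 0" for w
    using linear_eq_on_frame[of "\<lambda>w. \<Sum>m\<in>UNIV. b m \<bullet> (S (b m) *v w)" "\<lambda>_. 0" w]
    by (simp add: linear_iff inner_add_right matv_distrib sum.distrib sum_distrib_left s_def)
  then have "contraction G (\<chi> i. S (axis i 1)) = 0"
    by (simp add: vec_eq_iff contraction_frame[OF S])
  then have "(\<chi> i. S (axis i 1)) \<in> V1 G"
    by (simp add: V1_def cotangent_asd_def S_asd)
  then have "inner_3tensors G (\<chi> i. T (axis i 1)) (\<chi> i. S (axis i 1)) = 0"
    using V0 by (simp add: V0_def)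
  then have 1: "(\<Sum>a\<in>UNIV. \<Sum>c\<in>UNIV. \<Sum>d\<in>UNIV. (s a c d + b c \<bullet> (P (b a) *v b d)) * s a c d) = 0"
    unfolding inner_3tensors_frame[OF T S] inner_2forms_frame
    by (simp add: s_def S_def matv_distrib inner_diff_right)
  have "(\<Sum>a\<in>UNIV. \<Sum>c\<in>UNIV. \<Sum>d\<in>UNIV. (b c \<bullet> (P (b a) *v b d)) * s a c d) = 0"
    unfolding sum_4 P_apply by (simp add: vals s_rules div algebra_simps)
  with 1 have "(\<Sum>a\<in>UNIV. \<Sum>c\<in>UNIV. \<Sum>d\<in>UNIV. s a c d * s a c d) = 0"
    by (simp add: distrib_right sum.distrib)
  then have "s a c d = 0" for a c d
    by (simp add: sum_nonneg_eq_0_iff sum_nonneg)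
  then have "S (b a) = 0" for a
    by (intro matrix_eq_on_frame) (simp add: s_def)
  then have "S u = 0" for u
    using linear_eq_on_frame[OF S, of "\<lambda>_. 0"] by (simp add: linear_iff)
  then show ?thesis by (simp add: S_def P_def)
qed

text \<open>The map \<open>J\<close> takes the pairs \<open>(b\<^sub>1, b\<^sub>3)\<close> and \<open>(b\<^sub>1, b\<^sub>4)\<close> to \<open>(b\<^sub>2, b\<^sub>4)\<close> and
  \<open>(b\<^sub>2, -b\<^sub>3)\<close>. For these pairs the components of the hypothesis are linear equations for the
  entries of \<open>H\<close>, and they express exactly its \<open>J\<close>-invariance.\<close>

lemma hessian_J_invariant:
  fixes H :: "real^4^4"
  assumes sym: "transpose H = H"
    and K: "\<And>a c. hamiltonian_derivative G J (H *v (J *v a)) (J *v c) - hamiltonian_derivative G J (H *v (J *v c)) (J *v a) =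
       hamiltonian_derivative G J (H *v a) c - hamiltonian_derivative G J (H *v c) a"
  shows "transpose J ** H ** J = H"
proof -
  define h where "h m n = b m \<bullet> (H *v b n)" for m n
  have h_sym: "h n m = h m n" for m n
    unfolding h_def by (subst inner_matrix_transpose) (simp add: sym inner_commute)
  have Hb: "(H *v b m) \<bullet> b n = h n m" for m n by (simp add: h_def inner_commute)
  have K': "v \<bullet> (hamiltonian_derivative G J (H *v (J *v a)) (J *v c) *v w) - v \<bullet> (hamiltonian_derivative G J (H *v (J *v c)) (J *v a) *v w) =
       v \<bullet> (hamiltonian_derivative G J (H *v a) c *v w) - v \<bullet> (hamiltonian_derivative G J (H *v c) a *v w)" for a c v w
    using arg_cong[OF K[of a c], of "\<lambda>A. v \<bullet> (A *v w)"] by (simp add: matv_distrib inner_diff_right)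
  note s = h_sym[of 1 2] h_sym[of 1 3] h_sym[of 1 4] h_sym[of 2 3] h_sym[of 2 4] h_sym[of 3 4]
  have "\<forall>m n. b m \<bullet> ((transpose J ** H ** J) *v b n) = h m n"
    using K'[of "b 1" "b 1" "b 3" "b 3"] K'[of "b 1" "b 2" "b 3" "b 3"]
      K'[of "b 1" "b 1" "b 3" "b 4"] K'[of "b 1" "b 2" "b 3" "b 4"]
      K'[of "b 3" "b 1" "b 1" "b 3"]  K'[of "b 3" "b 1" "b 1" "b 4"] K'[of "b 1" "b 1" "b 3" "b 2"] K'[of "b 1" "b 3" "b 3" "b 4"]
      K'[of "b 1" "b 1" "b 4" "b 3"] K'[of "b 1" "b 2" "b 4" "b 3"]
      K'[of "b 1" "b 1" "b 4" "b 4"] K'[of "b 1" "b 2" "b 4" "b 4"]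
      K'[of "b 1" "b 1" "b 4" "b 2"] K'[of "b 1" "b 3" "b 4" "b 4"]
    unfolding forall_4 hamiltonian_derivative_apply
    by (simp add: matrix_vector_mul_assoc[symmetric] inner_matrix_transpose[of _ "transpose J"]
        frame_J_b matv_distrib frame_inner Hb h_def[symmetric] s)
  then show ?thesis by (intro matrix_eq_on_frame) (simp add: h_def)
qed

text \<open>In the frame write \<open>k\<close> for the components of \<open>\<phi>\<close>. Both \<open>\<psi> \<and> \<psi>\<close>, divided by \<open>\<omega> \<and> \<omega>\<close>, and the
  trace on the right are quadratic in \<open>r\<close> and \<open>k\<close>: they equal \<open>r\<^sup>2/4 - |k|\<^sup>2\<close> and
  \<open>r\<^sup>2 + 4|k|\<^sup>2\<close>, where \<open>|k|\<^sup>2 = k\<^sub>1\<^sub>2\<^sup>2 + k\<^sub>1\<^sub>3\<^sup>2 + k\<^sub>1\<^sub>4\<^sup>2\<close>.\<close>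

lemma pfaffian_trace:
  assumes \<phi>: "\<phi> \<in> asd_forms G" and \<psi>: "\<psi> = \<phi> + (r / 2) *\<^sub>R \<omega>"
    and S: "S = J ** matrix_inv G ** \<psi>"
  shows "wedge_2forms \<psi> \<psi> 1 2 3 4 = (r\<^sup>2 / 2 - trace (S ** S) / 4) * wedge_2forms \<omega> \<omega> 1 2 3 4"
    and "wedge_2forms \<omega> \<omega> 1 2 3 4 \<noteq> 0"
proof -
  define f where "f m n = b m \<bullet> (\<psi> *v b n)" for m n
  define k where "k m n = b m \<bullet> (\<phi> *v b n)" for m n
  have \<psi>_anti: "transpose \<psi> = - \<psi>"
    using \<phi> transpose_\<omega> by (simp add: \<psi> asd_forms_frame transpose_linear)
  have k_anti: "k n m = - k m n" for m n
    using \<phi> unfolding k_def by (subst inner_matrix_transpose) (simp add: asd_forms_frame matv_distrib inner_commute)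
  have k_zero: "k m m = 0" for m using k_anti[of m m] by simp
  have k_asd: "k 3 4 = - k 1 2" "k 2 4 = k 1 3" "k 2 3 = - k 1 4"
    using \<phi> by (simp_all add: asd_forms_frame k_def)
  note k_rules = k_zero k_asd k_anti[of 2 1] k_anti[of 3 1] k_anti[of 4 1] k_anti[of 3 2] k_anti[of 4 2] k_anti[of 4 3]
  have f: "f m n = k m n + (r / 2) * (b m \<bullet> (\<omega> *v b n))" for m n
    by (simp add: f_def k_def \<psi> matv_distrib inner_add_right)
  have dv: "det_vectors (b 1) (b 2) (b 3) (b 4) = det E"
    unfolding b_def det_vectors_matrix_mult by (simp add: det_vectors_eq axis_def)
  have w: "2 = det E * wedge_2forms \<omega> \<omega> 1 2 3 4"
    using wedge_vectors_det[OF transpose_\<omega>, of "b 1" "b 2" "b 3" "b 4"]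
    by (simp add: dv wedge_vectors_def frame_\<omega>_values)
  then show "wedge_2forms \<omega> \<omega> 1 2 3 4 \<noteq> 0" by auto
  have "transpose E ** (G ** J) ** E = standard_J"
    using frame_orthonormal by (simp add: matrix_mul_assoc[symmetric] frame_J) (simp add: matrix_mul_assoc)
  then have SJ: "transpose E ** G ** S ** E = standard_J ** (transpose E ** \<psi> ** E)"
    by (simp add: S G_inverse) (simp add: matrix_mul_assoc)
  have EEG: "E ** (transpose E ** G) = mat 1"
    using frame_orthonormal matrix_left_right_inverse by blast
  have "trace (S ** S) = trace ((S ** S ** E) ** (transpose E ** G))"
    by (simp add: matrix_mul_assoc[symmetric] EEG)
  also have "\<dots> = trace ((transpose E ** G) ** (S ** (E ** (transpose E ** G)) ** S ** E))"
    by (subst trace_mul_sym) (simp add: EEG)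
  also have "\<dots> = trace ((transpose E ** G ** S ** E) ** (transpose E ** G ** S ** E))"
    by (simp add: matrix_mul_assoc)
  also have "\<dots> = trace ((standard_J ** (transpose E ** \<psi> ** E)) ** (standard_J ** (transpose E ** \<psi> ** E)))"
    by (simp only: SJ)
  finally have tr: "trace (S ** S) = trace ((standard_J ** (transpose E ** \<psi> ** E)) ** (standard_J ** (transpose E ** \<psi> ** E)))" .
  have entry: "(transpose E ** \<psi> ** E) $ m $ n = f m n" for m n
    by (simp add: f_def b_def entry_eq_inner inner_matrix_transpose[of _ "transpose E"]
        matrix_vector_mul_assoc[symmetric])
  have tr': "trace (S ** S) = r\<^sup>2 + 4 * ((k 1 2)\<^sup>2 + (k 1 3)\<^sup>2 + (k 1 4)\<^sup>2)"
  proof -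
    define M where "M = standard_J ** (transpose E ** \<psi> ** E)"
    have M: "M $ 1 $ n = - f 2 n" "M $ 2 $ n = f 1 n" "M $ 3 $ n = - f 4 n" "M $ 4 $ n = f 3 n" for n
      unfolding M_def matrix_matrix_mult_def[of standard_J]
      by (simp_all add: entry sum_4 standard_J_def vector_4_nth)
    have "trace (S ** S) = trace (M ** M)" unfolding M_def by (rule tr)
    also have "\<dots> = (\<Sum>m\<in>UNIV. \<Sum>n\<in>UNIV. M $ m $ n * M $ n $ m)"
      by (simp add: trace_def matrix_matrix_mult_def)
    finally show ?thesis
      unfolding sum_4 M by (simp add: f frame_\<omega>_values k_rules power2_eq_square algebra_simps)
  qed
  have "det E * wedge_2forms \<psi> \<psi> 1 2 3 4 = 2 * (r\<^sup>2 / 2 - trace (S ** S) / 4)"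
    using wedge_vectors_det[OF \<psi>_anti, of "b 1" "b 2" "b 3" "b 4"]
    unfolding dv wedge_vectors_def f_def[symmetric] tr'
    by (simp add: f frame_\<omega>_values k_rules power2_eq_square field_simps)
  also have "\<dots> = det E * ((r\<^sup>2 / 2 - trace (S ** S) / 4) * wedge_2forms \<omega> \<omega> 1 2 3 4)"
    unfolding w by (simp add: mult_ac)
  finally show "wedge_2forms \<psi> \<psi> 1 2 3 4 = (r\<^sup>2 / 2 - trace (S ** S) / 4) * wedge_2forms \<omega> \<omega> 1 2 3 4"
    using frame_oriented by simp
qed

end

section \<open>Covariant derivatives along a chart\<close>

lemma bounded_bilinear_wedge_1forms: "bounded_bilinear wedge_1forms"
  unfolding bilinear_conv_bounded_bilinear[symmetric] bilinear_def linear_iff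
  by (simp add: wedge_1forms_def vec_eq_iff algebra_simps)

lemma wedge_1forms_derivation:
  "transpose A ** wedge_1forms p q + wedge_1forms p q ** A =
    wedge_1forms (transpose A *v p) q + wedge_1forms p (transpose A *v q)"
proof (rule matrix_eq_by_inner)
  fix u w
  have 1: "(transpose A *v x) \<bullet> y = x \<bullet> (A *v y)" for x y by (simp add: inner_matrix_transpose)
  show "u \<bullet> ((transpose A ** wedge_1forms p q + wedge_1forms p q ** A) *v w) =
      u \<bullet> ((wedge_1forms (transpose A *v p) q + wedge_1forms p (transpose A *v q)) *v w)"
    by (simp add: matv_distrib inner_add_right matrix_vector_mul_assoc[symmetric]
        inner_matrix_transpose[of _ "transpose A"] wedge_1forms_apply 1 algebra_simps)
qed

lemma linear_covector: "linear f \<Longrightarrow> (\<chi> i. f (axis i 1)) \<bullet> v = f v" for v :: "real^'n" and f :: "real^'n \<Rightarrow> real"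
  using linear_eq_sum_axis[of f v] by (simp add: inner_vec_def mult.commute)

lemma lie_deriv_endo_eq:
  assumes "J differentiable at x" "X differentiable at x"
  shows "lie_deriv_endo X J x *v v = D J x (X x) *v v - D X x (J x *v v) + J x *v (D X x v)"
proof -
  have J: "D J x u = (\<Sum>l\<in>UNIV. u $ l *\<^sub>R partial_deriv l J x)" for u
    unfolding partial_deriv_def by (rule linear_eq_sum_axis[OF D_linear[OF assms(1)]])
  have X: "D X x u = (\<Sum>l\<in>UNIV. u $ l *\<^sub>R partial_deriv l X x)" for u
    unfolding partial_deriv_def by (rule linear_eq_sum_axis[OF D_linear[OF assms(2)]])
  have l: "linear (\<lambda>v. D J x (X x) *v v - D X x (J x *v v) + J x *v (D X x v))"
    using D_linear[OF assms(2)] by (simp add: linear_iff matv_distrib scaleR_diff_right scaleR_add_right)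
  show ?thesis
  proof (rule linear_eq_on_axis[OF matrix_vector_mul_linear l])
    fix j
    show "lie_deriv_endo X J x *v axis j 1 =
        D J x (X x) *v axis j 1 - D X x (J x *v axis j 1) + J x *v D X x (axis j 1)"
      unfolding matrix_vector_mult_basis J[of "X x"] X[of "column j (J x)"] partial_deriv_def[of j X x, symmetric]
      by (simp add: vec_eq_iff column_def lie_deriv_endo_def sum.distrib sum_subtractf matrix_vector_mult_def)
  qed
qed

context metric_chart
begin

lemma nabla_cong:
  assumes "x \<in> U" "\<And>y. y \<in> U \<Longrightarrow> T y = T' y"
  shows "\<nabla> T x v = \<nabla> T' x v"
  using D_cong[OF open_U assms] assms by (simp add: covariant_derivative_def)

lemma nabla_add:
  assumes "S differentiable at x" "T differentiable at x"
  shows "\<nabla> (\<lambda>y. S y + T y) x v = \<nabla> S x v + \<nabla> T x v"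
proof -
  have "D (\<lambda>y. S y + T y) x v = D S x v + D T x v"
    by (rule D_eq[OF has_derivative_add[OF has_D[OF assms(1)] has_D[OF assms(2)]]])
  then show ?thesis by (simp add: covariant_derivative_def mat_distrib)
qed

lemma nabla_scaleR:
  assumes "f differentiable at x" "T differentiable at x"
  shows "\<nabla> (\<lambda>y. f y *\<^sub>R T y) x v = f x *\<^sub>R \<nabla> T x v + D f x v *\<^sub>R T x"
  unfolding covariant_derivative_def D_bilinear[OF bounded_bilinear_scaleR assms]
  by (simp add: mat_distrib scaleR_diff_right)

text \<open>For a torsion-free connection the exterior derivative is the cyclic sum of the covariant
  derivative.\<close>

lemma closed_nabla:
  assumes x: "x \<in> U" and d: "\<phi> differentiable at x" and skew: "transpose (\<phi> x) = - \<phi> x"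
    and closed: "\<And>i j k. partial_deriv i \<phi> x $ j $ k + partial_deriv j \<phi> x $ k $ i
       + partial_deriv k \<phi> x $ i $ j = 0"
  shows "v \<bullet> (\<nabla> \<phi> x u *v w) + w \<bullet> (\<nabla> \<phi> x v *v u) + u \<bullet> (\<nabla> \<phi> x w *v v) = 0"
proof -
  let ?c = "\<lambda>u v w. v \<bullet> (D \<phi> x u *v w) + w \<bullet> (D \<phi> x v *v u) + u \<bullet> (D \<phi> x w *v v)"
  note l = D_linear[OF d]
  have lin: "linear (\<lambda>u. ?c u v w)" "linear (\<lambda>v. ?c u v w)" "linear (\<lambda>w. ?c u v w)" for u v w
    by (simp_all add: linear_iff linear_add[OF l] linear_scale[OF l] matv_distrib inner_add_left
        inner_add_right algebra_simps)
  have z: "linear (\<lambda>u :: real^4. 0 :: real)" by (simp add: linear_iff)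
  have 1: "?c (axis i 1) (axis j 1) (axis k 1) = 0" for i j k
    using closed[of i j k] by (simp add: partial_deriv_def entry_eq_inner)
  have 2: "?c u (axis j 1) (axis k 1) = 0" for u j k
    by (rule linear_eq_on_axis[OF lin(1) z]) (rule 1)
  have 3: "?c u v (axis k 1) = 0" for u v k
    by (rule linear_eq_on_axis[OF lin(2) z]) (rule 2)
  have 4: "?c u v w = 0"
    by (rule linear_eq_on_axis[OF lin(3) z]) (rule 3)
  have sk: "a \<bullet> (\<phi> x *v c) = - (c \<bullet> (\<phi> x *v a))" for a c
    by (subst inner_matrix_transpose) (simp add: skew matv_distrib inner_commute)
  have e: "a \<bullet> (\<nabla> \<phi> x d *v c) = a \<bullet> (D \<phi> x d *v c) - (\<Gamma> x d *v a) \<bullet> (\<phi> x *v c) - a \<bullet> (\<phi> x *v (\<Gamma> x d *v c))" for a d c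
    by (simp add: covariant_derivative_def matv_distrib inner_diff_right matrix_vector_mul_assoc[symmetric]
        inner_matrix_transpose[of _ "transpose (\<Gamma> x d)"])
  show ?thesis
    unfolding e
    using 4 sk[of "\<Gamma> x u *v v" w] sk[of "\<Gamma> x v *v w" u] sk[of "\<Gamma> x w *v u" v]
      connection_symmetric[OF x, of u v] connection_symmetric[OF x, of v w] connection_symmetric[OF x, of w u]
    by simp
qed

end

context kaehler_chart
begin

lemma \<omega>_apply: "x \<in> U \<Longrightarrow> u \<bullet> (\<omega> x *v w) = (J x *v u) \<bullet> (g x *v w)"
  by (simp add: matrix_vector_mul_assoc[symmetric] inner_matrix_transpose[of _ "transpose (J x)"])

lemma frame_exists: "x \<in> U \<Longrightarrow> \<exists>E. hermitian_frame (g x) (J x) E"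
  using metric_symmetric metric_positive J_square J_orthogonal J_oriented
  by (intro hermitian_frame_exists) auto

text \<open>\<open>J g\<^sup>-\<^sup>1\<close> is the inverse of the Kaehler form; in particular it is skew.\<close>

lemma J_g_inv_skew: "x \<in> U \<Longrightarrow> transpose (J x ** g_inv x) = - (J x ** g_inv x)"
  by (simp add: matrix_transpose_mul transpose_g_inv g_inv_transpose_J)

lemma J_g_inv_\<omega>: "x \<in> U \<Longrightarrow> J x ** g_inv x ** \<omega> x = mat 1"
proof -
  assume x: "x \<in> U"
  have "J x ** g_inv x ** \<omega> x = J x ** (g_inv x ** transpose (J x)) ** g x"
    by (simp add: matrix_mul_assoc)
  also have "\<dots> = - ((J x ** J x) ** (g_inv x ** g x))"
    unfolding g_inv_transpose_J[OF x] by (simp add: mat_distrib matrix_mul_assoc)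
  finally show ?thesis by (simp add: x J_square metric_inverse)
qed

text \<open>Since \<open>J\<close> is parallel and the connection has no torsion, the Lie derivative of \<open>J\<close> along \<open>X\<close> is
  the commutator of \<open>J\<close> with \<open>\<nabla>X\<close>. For the gradient field with covector \<open>q\<close>, \<open>\<nabla>X\<close> is the covariant
  derivative of \<open>q\<close> with its index raised, so \<open>J\<close>-invariance of that bilinear form suffices.\<close>

lemma lie_deriv_gradient:
  assumes x: "x \<in> U" and q: "smooth_on U q"
    and inv: "\<And>a w. (J x *v w) \<bullet> (D q x (J x *v a) - transpose (\<Gamma> x (J x *v a)) *v q x) =
      w \<bullet> (D q x a - transpose (\<Gamma> x a) *v q x)"
  shows "lie_deriv_endo (\<lambda>y. g_inv y *v q y) J x = 0"
proof -
  let ?X = "\<lambda>y. g_inv y *v q y"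
  define h where "h a = D q x a - transpose (\<Gamma> x a) *v q x" for a
  note dJ = smooth_on_differentiable[OF smooth_J x]
  note dq = smooth_on_differentiable[OF q x]
  note dgi = smooth_on_differentiable[OF smooth_g_inv x]
  have dX: "?X differentiable at x"
    using smooth_on_differentiable[OF smooth_on_matrix_vector_mult[OF open_U smooth_g_inv q] x] .
  have DX: "D ?X x v = g_inv x *v h v - \<Gamma> x v *v ?X x" for v
    unfolding D_matrix_vector_mult[OF dgi dq] D_g_inv[OF x] h_def
    by (simp add: matv_distrib matrix_vector_mul_assoc)
  have "transpose (J x) *v h (J x *v a) = h a" for a
  proof -
    have "w \<bullet> (transpose (J x) *v h (J x *v a)) = w \<bullet> h a" for w
      using inv[of w a] by (simp add: h_def inner_matrix_transpose[of _ "transpose (J x)"])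
    then show ?thesis using vector_eq_ldot by blast
  qed
  then have 1: "h (J x *v a) = - (transpose (J x) *v h a)" for a
  proof -
    have "transpose (J x) *v h (J x *v (J x *v a)) = - (transpose (J x) *v h a)"
    proof -
      have "h (- a) = - h a"
        using D_linear[OF dq] linear_connection_matrix[of g x]
        by (simp add: h_def linear_neg transpose_linear matv_distrib)
      then show ?thesis by (simp add: J_J x matv_distrib)
    qed
    then show ?thesis using \<open>\<And>a. transpose (J x) *v h (J x *v a) = h a\<close> by metis
  qed
  have 2: "g_inv x *v (transpose (J x) *v v) = - (J x *v (g_inv x *v v))" for v
    by (simp add: matrix_vector_mul_assoc g_inv_transpose_J x matv_distrib)
  have "lie_deriv_endo ?X J x *v v = 0" for v
    unfolding lie_deriv_endo_eq[OF dJ dX] DX D_J[OF x]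
    using connection_symmetric[OF x, of "?X x" v] connection_symmetric[OF x, of "?X x" "J x *v v"]
    by (simp add: matv_distrib 1 2 matrix_vector_mul_assoc[symmetric])
  then show ?thesis by (simp add: matrix_eq)
qed

end

section \<open>Hamiltonian two-forms in a chart\<close>

locale hamiltonian_chart = kaehler_chart +
  fixes \<phi> \<phi>\<^sub>0 :: "real^4 \<Rightarrow> real^4^4" and s :: "real^4 \<Rightarrow> real"
  assumes smooth_\<phi>: "smooth_on U \<phi>" and smooth_\<phi>\<^sub>0: "smooth_on U \<phi>\<^sub>0"
    and \<phi>_skew: "x \<in> U \<Longrightarrow> transpose (\<phi> x) = - \<phi> x"
    and \<phi>_closed: "x \<in> U \<Longrightarrow> partial_deriv i \<phi> x $ j $ k + partial_deriv j \<phi> x $ k $ i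
       + partial_deriv k \<phi> x $ i $ j = 0"
    and \<phi>_J_invariant: "x \<in> U \<Longrightarrow> transpose (J x) ** \<phi> x ** J x = \<phi> x"
    and \<phi>\<^sub>0_trace_free: "x \<in> U \<Longrightarrow> \<phi>\<^sub>0 x = \<phi> x - (inner_2forms (g x) (\<phi> x) (transpose (J x) ** g x) /
       inner_2forms (g x) (transpose (J x) ** g x) (transpose (J x) ** g x)) *\<^sub>R (transpose (J x) ** g x)"
    and \<phi>_decomposition: "x \<in> U \<Longrightarrow> \<phi> x = \<phi>\<^sub>0 x + ((3/2) * s x) *\<^sub>R (transpose (J x) ** g x)"
    and \<phi>\<^sub>0_asd: "x \<in> U \<Longrightarrow> \<phi>\<^sub>0 x \<in> asd_forms (g x)"
    and \<phi>\<^sub>0_twistor: "x \<in> U \<Longrightarrow> nabla_form g \<phi>\<^sub>0 x \<in> V0 (g x)"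
begin

lemma norm_\<omega>: "x \<in> U \<Longrightarrow> inner_2forms (g x) (\<omega> x) (\<omega> x) = 4"
  using frame_exists[of x] hermitian_frame.inner_2forms_\<omega> by blast

lemma s_eq:
  assumes x: "x \<in> U" shows "s x = inner_2forms (g x) (\<phi> x) (\<omega> x) / 6"
proof -
  have "\<omega> x \<noteq> 0"
  proof
    assume "\<omega> x = 0"
    then have "inner_2forms (g x) (\<omega> x) (\<omega> x) = 0" by (simp only: inner_2forms_def) simp
    then show False using norm_\<omega>[OF x] by simp
  qed
  moreover have "((3/2) * s x - inner_2forms (g x) (\<phi> x) (\<omega> x) / 4) *\<^sub>R \<omega> x = 0"
    using \<phi>\<^sub>0_trace_free[OF x] \<phi>_decomposition[OF x] unfolding norm_\<omega>[OF x]
    by (simp add: scaleR_diff_left)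
  ultimately show ?thesis by simp
qed

lemma smooth_s: "smooth_on U s"
proof -
  have "smooth_on U (\<lambda>x. inner_2forms (g x) (\<phi> x) (\<omega> x) * (1/6))"
    unfolding inner_2forms_def
    by (intro smooth_on_mult smooth_on_sum smooth_on_const smooth_on_matrix_nth smooth_g_inv smooth_\<phi>
        smooth_\<omega> open_U)
  then show ?thesis by (rule smooth_on_cong[OF open_U, rotated]) (simp add: s_eq)
qed

text \<open>The differential of the trace, as a covector field.\<close>

definition p :: "real^4 \<Rightarrow> real^4" where "p x = (\<chi> i. D s x (axis i 1))"

lemma p_apply: "x \<in> U \<Longrightarrow> p x \<bullet> v = D s x v"
  unfolding p_def by (rule linear_covector[OF D_linear[OF smooth_on_differentiable[OF smooth_s]]])

lemma smooth_p: "smooth_on U p"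
proof (rule smooth_on_vecI[OF open_U])
  show "smooth_on U (\<lambda>x. p x $ i)" for i
    using smooth_on_D[OF smooth_s, of "axis i 1"] by (simp add: p_def)
qed

text \<open>Among the combinations of \<open>\<phi>\<^sub>0\<close> and \<open>s \<omega>\<close> this one has the simplest covariant derivative, with
  no separate multiple of \<open>\<omega>\<close>.\<close>

definition \<psi> :: "real^4 \<Rightarrow> real^4^4" where "\<psi> x = \<phi>\<^sub>0 x + (s x / 2) *\<^sub>R \<omega> x"

lemma smooth_\<psi>: "smooth_on U \<psi>"
  unfolding \<psi>_def[abs_def] divide_inverse
  by (intro smooth_on_add smooth_on_scaleR smooth_on_mult smooth_on_const smooth_s smooth_\<phi>\<^sub>0 smooth_\<omega> open_U)

lemma \<psi>_eq: "x \<in> U \<Longrightarrow> \<psi> x = \<phi> x - s x *\<^sub>R \<omega> x"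
  using \<phi>_decomposition[of x] by (simp add: \<psi>_def scaleR_add_left[symmetric] algebra_simps)

lemma \<psi>_skew: "x \<in> U \<Longrightarrow> transpose (\<psi> x) = - \<psi> x"
  by (simp add: \<psi>_eq transpose_linear \<phi>_skew transpose_\<omega>)

lemma \<psi>_J: "x \<in> U \<Longrightarrow> \<psi> x ** J x = - (transpose (J x) ** \<psi> x)"
proof -
  assume x: "x \<in> U"
  have "transpose (J x) ** \<omega> x ** J x = \<omega> x"
    by (simp add: matrix_mul_assoc[symmetric] J_orthogonal[OF x, simplified matrix_mul_assoc[symmetric]])
  then have 1: "transpose (J x) ** \<psi> x ** J x = \<psi> x"
    by (simp add: \<psi>_eq x mat_distrib \<phi>_J_invariant)
  have "\<psi> x ** J x = transpose (J x) ** \<psi> x ** (J x ** J x)"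
    by (subst 1[symmetric]) (simp add: matrix_mul_assoc)
  then show ?thesis by (simp add: J_square x mat_distrib)
qed

lemma nabla_s_\<omega>:
  assumes x: "x \<in> U"
  shows "\<nabla> (\<lambda>y. (r * s y) *\<^sub>R \<omega> y) x v = (r * (p x \<bullet> v)) *\<^sub>R \<omega> x"
proof -
  have "smooth_on U (\<lambda>y. r * s y)" by (intro smooth_on_mult smooth_on_const smooth_s open_U)
  note d = smooth_on_differentiable[OF this x]
  have "D (\<lambda>y. r * s y) x v = r * D s x v"
    by (rule D_bounded_linear[OF bounded_linear_mult_right smooth_on_differentiable[OF smooth_s x]])
  then show ?thesis
    using nabla_scaleR[OF d smooth_on_differentiable[OF smooth_\<omega> x]] by (simp add: \<omega>_parallel x p_apply)
qed

lemma smooth_s_\<omega>: "smooth_on U (\<lambda>y. (r * s y) *\<^sub>R \<omega> y)"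
  by (intro smooth_on_scaleR smooth_on_mult smooth_on_const smooth_s smooth_\<omega> open_U)

lemma nabla_\<phi>\<^sub>0:
  assumes x: "x \<in> U"
  shows "\<nabla> \<phi>\<^sub>0 x u = hamiltonian_derivative (g x) (J x) (p x) u - ((1/2) * (p x \<bullet> u)) *\<^sub>R \<omega> x"
proof -
  obtain E where "hermitian_frame (g x) (J x) E" using frame_exists[OF x] by blast
  then interpret F: hermitian_frame "g x" "J x" E .
  note d = smooth_on_differentiable[OF smooth_\<phi>\<^sub>0 x]
  have n: "\<nabla> \<phi> x u = \<nabla> \<phi>\<^sub>0 x u + ((3/2) * (p x \<bullet> u)) *\<^sub>R \<omega> x" for u
  proof -
    have "\<nabla> \<phi> x u = \<nabla> (\<lambda>y. \<phi>\<^sub>0 y + ((3/2) * s y) *\<^sub>R \<omega> y) x u"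
      by (rule nabla_cong[OF x]) (rule \<phi>_decomposition)
    also have "\<dots> = \<nabla> \<phi>\<^sub>0 x u + \<nabla> (\<lambda>y. ((3/2) * s y) *\<^sub>R \<omega> y) x u"
      by (rule nabla_add[OF d smooth_on_differentiable[OF smooth_s_\<omega> x]])
    finally show ?thesis by (simp only: nabla_s_\<omega>[OF x])
  qed
  have "nabla_form g \<phi>\<^sub>0 x = (\<chi> i. \<nabla> \<phi>\<^sub>0 x (axis i 1))"
    by (simp add: vec_eq_iff[of "nabla_form g \<phi>\<^sub>0 x"] nabla_form_eq)
  with \<phi>\<^sub>0_twistor[OF x] have V: "(\<chi> i. \<nabla> \<phi>\<^sub>0 x (axis i 1)) \<in> V0 (g x)" by simp
  show ?thesis
  proof (rule F.twistor_derivative[OF linear_covariant_derivative[OF d] V])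
    fix u v w
    show "v \<bullet> (\<nabla> \<phi>\<^sub>0 x u *v w) + w \<bullet> (\<nabla> \<phi>\<^sub>0 x v *v u) + u \<bullet> (\<nabla> \<phi>\<^sub>0 x w *v v) + 3 / 2 *
        (p x \<bullet> u * (v \<bullet> (\<omega> x *v w)) + p x \<bullet> v * (w \<bullet> (\<omega> x *v u)) + p x \<bullet> w * (u \<bullet> (\<omega> x *v v))) = 0"
      using closed_nabla[OF x smooth_on_differentiable[OF smooth_\<phi> x] \<phi>_skew[OF x] \<phi>_closed[OF x], of v u w]
      unfolding n by (simp add: matv_distrib inner_add_right algebra_simps)
  qed
qed

lemma nabla_\<psi>:
  assumes x: "x \<in> U"
  shows "\<nabla> \<psi> x u = hamiltonian_derivative (g x) (J x) (p x) u"
proof -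
  have "\<nabla> \<psi> x u = \<nabla> (\<lambda>y. \<phi>\<^sub>0 y + ((1/2) * s y) *\<^sub>R \<omega> y) x u"
    by (rule nabla_cong[OF x]) (simp add: \<psi>_def)
  also have "\<dots> = \<nabla> \<phi>\<^sub>0 x u + \<nabla> (\<lambda>y. ((1/2) * s y) *\<^sub>R \<omega> y) x u"
    by (rule nabla_add[OF smooth_on_differentiable[OF smooth_\<phi>\<^sub>0 x] smooth_on_differentiable[OF smooth_s_\<omega> x]])
  finally show ?thesis unfolding nabla_s_\<omega>[OF x] nabla_\<phi>\<^sub>0[OF x] by simp
qed

text \<open>The covariant Hessian of the trace.\<close>

definition h :: "real^4 \<Rightarrow> real^4 \<Rightarrow> real^4" where
  "h x a = D p x a - transpose (\<Gamma> x a) *v p x"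

lemma linear_h: "x \<in> U \<Longrightarrow> linear (h x)"
  using D_linear[OF smooth_on_differentiable[OF smooth_p, of x]] linear_connection_matrix[of g x]
  by (simp add: h_def[abs_def] linear_iff transpose_linear matv_distrib scaleR_diff_right)

lemma h_symmetric:
  assumes x: "x \<in> U" shows "h x a \<bullet> w = h x w \<bullet> a"
proof -
  have "D p x a \<bullet> w = D (\<lambda>y. D s y w) x a" for a w
  proof -
    have "D p x a \<bullet> w = D (\<lambda>y. p y \<bullet> w) x a"
      by (rule D_bounded_linear[OF bounded_linear_inner_left smooth_on_differentiable[OF smooth_p x], symmetric])
    also have "\<dots> = D (\<lambda>y. D s y w) x a" by (rule D_cong[OF open_U x]) (rule p_apply)
    finally show ?thesis .
  qed
  then have "h x a \<bullet> w = D (\<lambda>y. D s y w) x a - p x \<bullet> (\<Gamma> x a *v w)" for a w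
    by (simp add: h_def inner_diff_left inner_matrix_transpose)
  then show ?thesis
    using symmetric_second_derivative[OF open_U smooth_s x, of a w] connection_symmetric[OF x, of a w] by simp
qed

text \<open>As \<open>g\<close>, \<open>J\<close> and \<open>\<omega>\<close> are parallel, only \<open>p\<close> is differentiated. The second summand is due to
  the constant vector \<open>c\<close>, whose covariant derivative is \<open>\<Gamma> x a *v c\<close>; being symmetric in \<open>a\<close> and
  \<open>c\<close>, it cancels in the Ricci identity.\<close>

lemma nabla_hamiltonian_derivative:
  assumes x: "x \<in> U"
  shows "\<nabla> (\<lambda>y. hamiltonian_derivative (g y) (J y) (p y) c) x a =
    hamiltonian_derivative (g x) (J x) (h x a) c + hamiltonian_derivative (g x) (J x) (p x) (\<Gamma> x a *v c)"
proof -
  let ?P1 = "\<lambda>y. g y *v c" and ?Q1 = "\<lambda>y. - (transpose (J y) *v p y)" and ?Q2 = "\<lambda>y. - (\<omega> y *v c)"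
  have w: "\<nabla> (\<lambda>y. wedge_1forms (P y) (Q y)) x a =
      wedge_1forms (D P x a - transpose (\<Gamma> x a) *v P x) (Q x) + wedge_1forms (P x) (D Q x a - transpose (\<Gamma> x a) *v Q x)"
    if "smooth_on U P" "smooth_on U Q" for P Q
    unfolding covariant_derivative_def
      D_bilinear[OF bounded_bilinear_wedge_1forms smooth_on_differentiable[OF that(1) x] smooth_on_differentiable[OF that(2) x]]
    using wedge_1forms_derivation[of "\<Gamma> x a" "P x" "Q x"]
    by (simp add: bounded_bilinear.diff_left[OF bounded_bilinear_wedge_1forms]
        bounded_bilinear.diff_right[OF bounded_bilinear_wedge_1forms] algebra_simps)
  have sm: "smooth_on U ?P1" "smooth_on U ?Q1" "smooth_on U ?Q2"
    by (intro smooth_on_minus smooth_on_matrix_vector_mult smooth_on_transpose smooth_on_const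
      smooth_g smooth_J smooth_p smooth_\<omega> open_U)+
  have Jp: "smooth_on U (\<lambda>y. transpose (J y) *v p y)" "smooth_on U (\<lambda>y. \<omega> y *v c)"
    by (intro smooth_on_matrix_vector_mult smooth_on_transpose smooth_on_const
      smooth_J smooth_p smooth_\<omega> open_U)+
  have 1: "D ?P1 x a - transpose (\<Gamma> x a) *v ?P1 x = g x *v (\<Gamma> x a *v c)"
    unfolding D_matrix_const[OF smooth_on_differentiable[OF smooth_g x]] D_metric[OF x]
    by (simp add: matv_distrib matrix_vector_mul_assoc)
  have 2: "D ?Q1 x a - transpose (\<Gamma> x a) *v ?Q1 x = - (transpose (J x) *v h x a)"
  proof -
    have "D ?Q1 x a = - D (\<lambda>y. transpose (J y) *v p y) x a"
      by (rule D_bounded_linear[OF bounded_linear_minus[OF bounded_linear_ident] smooth_on_differentiable[OF Jp(1) x]])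
    also have "D (\<lambda>y. transpose (J y) *v p y) x a = transpose (J x) *v D p x a + transpose (D J x a) *v p x"
      unfolding D_matrix_vector_mult[OF smooth_on_differentiable[OF smooth_on_transpose[OF open_U smooth_J] x]
          smooth_on_differentiable[OF smooth_p x]] D_transpose[OF smooth_on_differentiable[OF smooth_J x]] ..
    finally show ?thesis
      unfolding D_J[OF x] h_def
      by (simp add: transpose_linear matrix_transpose_mul matv_distrib matrix_vector_mul_assoc)
  qed
  have 3: "D ?Q2 x a - transpose (\<Gamma> x a) *v ?Q2 x = - (\<omega> x *v (\<Gamma> x a *v c))"
  proof -
    have "D ?Q2 x a = - D (\<lambda>y. \<omega> y *v c) x a"
      by (rule D_bounded_linear[OF bounded_linear_minus[OF bounded_linear_ident] smooth_on_differentiable[OF Jp(2) x]])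
    then show ?thesis
      unfolding D_matrix_const[OF smooth_on_differentiable[OF smooth_\<omega> x]] D_\<omega>[OF x]
      by (simp add: matv_distrib matrix_vector_mul_assoc)
  qed
  have sw: "smooth_on U (\<lambda>y. wedge_1forms (?P1 y) (?Q1 y))" "smooth_on U (\<lambda>y. wedge_1forms (p y) (?Q2 y))"
    by (intro smooth_on_bilinear[OF bounded_bilinear_wedge_1forms] sm smooth_p open_U)+
  have "\<nabla> (\<lambda>y. hamiltonian_derivative (g y) (J y) (p y) c) x a =
      (1/2) *\<^sub>R \<nabla> (\<lambda>y. wedge_1forms (?P1 y) (?Q1 y) + wedge_1forms (p y) (?Q2 y)) x a"
    unfolding hamiltonian_derivative_def
    using nabla_scaleR[OF differentiable_const smooth_on_differentiable[OF smooth_on_add[OF open_U sw] x], of "1/2" a]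
    by (simp add: frechet_derivative_const bounded_bilinear.minus_left[OF bounded_bilinear_matrix_vector_mult])
  also have "\<dots> = (1/2) *\<^sub>R (\<nabla> (\<lambda>y. wedge_1forms (?P1 y) (?Q1 y)) x a + \<nabla> (\<lambda>y. wedge_1forms (p y) (?Q2 y)) x a)"
    unfolding nabla_add[OF smooth_on_differentiable[OF sw(1) x] smooth_on_differentiable[OF sw(2) x]] ..
  also have "\<dots> = (1/2) *\<^sub>R (wedge_1forms (g x *v (\<Gamma> x a *v c)) (?Q1 x) + wedge_1forms (?P1 x) (- (transpose (J x) *v h x a))
      + (wedge_1forms (h x a) (?Q2 x) + wedge_1forms (p x) (- (\<omega> x *v (\<Gamma> x a *v c)))))"
    unfolding w[OF sm(1,2)] w[OF smooth_p sm(3)] 1 2 3 h_def[symmetric] ..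
  finally show ?thesis
    by (simp add: hamiltonian_derivative_def scaleR_add_right[symmetric])
qed

text \<open>The Ricci identity for \<open>\<psi>\<close> equates an expression in the Hessian with a curvature term. The
  latter is invariant under \<open>J\<close> in the two directions of differentiation.\<close>

lemma h_J_invariant:
  assumes x: "x \<in> U" shows "h x (J x *v a) \<bullet> (J x *v w) = h x a \<bullet> w"
proof -
  obtain E where "hermitian_frame (g x) (J x) E" using frame_exists[OF x] by blast
  then interpret F: hermitian_frame "g x" "J x" E .
  let ?H = "matrix (h x)"
  have H: "?H *v v = h x v" for v
    using linear_h[OF x] by (simp add: matrix_works)
  have K: "hamiltonian_derivative (g x) (J x) (h x a) c - hamiltonian_derivative (g x) (J x) (h x c) a =
      - (transpose (curvature g x a c) ** \<psi> x + \<psi> x ** curvature g x a c)" for a c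
  proof -
    have 1: "D (\<lambda>y. \<nabla> \<psi> y c) x a - transpose (\<Gamma> x a) ** \<nabla> \<psi> x c - \<nabla> \<psi> x c ** \<Gamma> x a =
        hamiltonian_derivative (g x) (J x) (h x a) c + hamiltonian_derivative (g x) (J x) (p x) (\<Gamma> x a *v c)" for a c
    proof -
      have "D (\<lambda>y. \<nabla> \<psi> y c) x a = D (\<lambda>y. hamiltonian_derivative (g y) (J y) (p y) c) x a"
        by (rule D_cong[OF open_U x]) (rule nabla_\<psi>)
      then show ?thesis
        using nabla_hamiltonian_derivative[OF x, of c a]
        by (simp add: nabla_\<psi>[OF x] covariant_derivative_def[of g "\<lambda>y. hamiltonian_derivative (g y) (J y) (p y) c"])
    qed
    show ?thesis
      using ricci_identity[OF x smooth_\<psi>, of c a] unfolding 1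
      by (simp add: connection_symmetric[OF x, of c a])
  qed
  have "transpose (J x) ** ?H ** J x = ?H"
  proof (rule F.hessian_J_invariant)
    show "transpose ?H = ?H"
      by (rule matrix_eq_by_inner, subst inner_matrix_transpose)
        (simp add: H, metis h_symmetric[OF x] inner_commute)
  next
    fix a c
    show "hamiltonian_derivative (g x) (J x) (?H *v (J x *v a)) (J x *v c) - hamiltonian_derivative (g x) (J x) (?H *v (J x *v c)) (J x *v a) =
       hamiltonian_derivative (g x) (J x) (?H *v a) c - hamiltonian_derivative (g x) (J x) (?H *v c) a"
      unfolding H K curvature_J_invariant[OF x] ..
  qed
  then have "w \<bullet> (transpose (J x) ** ?H ** J x *v a) = w \<bullet> (?H *v a)" by simp
  then show ?thesis
    by (simp add: matrix_vector_mul_assoc[symmetric] inner_matrix_transpose[of _ "transpose (J x)"] H inner_commute)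
qed

end

section \<open>The pfaffian in a chart\<close>

context hamiltonian_chart
begin

text \<open>The endomorphism \<open>S\<close> represents \<open>\<psi>\<close> with respect to the Kaehler form. It has two double
  eigenvalues, with sum \<open>s\<close>, and \<open>pf\<close> is their product.\<close>

definition S :: "real^4 \<Rightarrow> real^4^4" where "S x = J x ** g_inv x ** \<psi> x"

definition pf :: "real^4 \<Rightarrow> real" where "pf x = (s x)\<^sup>2 / 2 - trace (S x ** S x) / 4"

definition dpf :: "real^4 \<Rightarrow> real^4" where "dpf x = s x *\<^sub>R p x - transpose (S x) *v p x"

lemma wedge_\<psi>:
  assumes x: "x \<in> U"
  shows "wedge_2forms (\<psi> x) (\<psi> x) 1 2 3 4 = pf x * wedge_2forms (\<omega> x) (\<omega> x) 1 2 3 4"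
    and "wedge_2forms (\<omega> x) (\<omega> x) 1 2 3 4 \<noteq> 0"
proof -
  obtain E where "hermitian_frame (g x) (J x) E" using frame_exists[OF x] by blast
  then interpret F: hermitian_frame "g x" "J x" E .
  show "wedge_2forms (\<psi> x) (\<psi> x) 1 2 3 4 = pf x * wedge_2forms (\<omega> x) (\<omega> x) 1 2 3 4"
    and "wedge_2forms (\<omega> x) (\<omega> x) 1 2 3 4 \<noteq> 0"
    unfolding pf_def
    by (rule F.pfaffian_trace[OF \<phi>\<^sub>0_asd[OF x] \<psi>_def S_def])+
qed

lemma smooth_S: "smooth_on U S"
  unfolding S_def[abs_def]
  by (intro smooth_on_matrix_mult smooth_J smooth_g_inv smooth_\<psi> open_U)

lemma smooth_trace: "smooth_on U A \<Longrightarrow> smooth_on U (\<lambda>x. trace (A x))" for A :: "real^4 \<Rightarrow> real^4^4"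
  unfolding trace_def by (intro smooth_on_sum smooth_on_matrix_nth open_U)

lemma smooth_pf: "smooth_on U pf"
  unfolding pf_def[abs_def] divide_inverse power2_eq_square
  by (intro smooth_on_diff smooth_on_mult smooth_on_const smooth_trace smooth_on_matrix_mult smooth_S
      smooth_s open_U)

lemma smooth_dpf: "smooth_on U dpf"
  unfolding dpf_def[abs_def]
  by (intro smooth_on_diff smooth_on_scaleR smooth_on_matrix_vector_mult smooth_on_transpose smooth_S
      smooth_s smooth_p open_U)

lemma S_J:
  assumes x: "x \<in> U" shows "S x ** J x = J x ** S x"
proof -
  have "S x ** J x = J x ** g_inv x ** (\<psi> x ** J x)" by (simp add: S_def matrix_mul_assoc)
  also have "\<dots> = - (J x ** (g_inv x ** transpose (J x)) ** \<psi> x)"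
    unfolding \<psi>_J[OF x] by (simp add: mat_distrib matrix_mul_assoc)
  also have "\<dots> = J x ** S x"
    unfolding g_inv_transpose_J[OF x] by (simp add: S_def mat_distrib matrix_mul_assoc)
  finally show ?thesis .
qed

lemma D_S:
  assumes x: "x \<in> U"
  shows "D S x u = S x ** \<Gamma> x u - \<Gamma> x u ** S x + J x ** g_inv x ** hamiltonian_derivative (g x) (J x) (p x) u"
proof -
  note d = smooth_on_differentiable[OF smooth_J x] smooth_on_differentiable[OF smooth_g_inv x]
    smooth_on_differentiable[OF smooth_\<psi> x]
    smooth_on_differentiable[OF smooth_on_matrix_mult[OF open_U smooth_J smooth_g_inv] x]
  have D\<psi>: "D \<psi> x u = transpose (\<Gamma> x u) ** \<psi> x + \<psi> x ** \<Gamma> x u + hamiltonian_derivative (g x) (J x) (p x) u"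
    using nabla_\<psi>[OF x, of u] by (simp add: covariant_derivative_def algebra_simps)
  show ?thesis
    unfolding S_def[abs_def] D_matrix_mult[OF d(4,3)] D_matrix_mult[OF d(1,2)] D\<psi> D_J[OF x] D_g_inv[OF x]
    by (simp add: mat_distrib matrix_mul_assoc)
qed

text \<open>The terms of \<open>D S\<close> with the connection are a commutator with \<open>S\<close> and have no trace against
  \<open>S\<close>. In what remains each of the two wedge products contributes \<open>p \<bullet> (S x *v u)\<close>, because \<open>S\<close>
  commutes with \<open>J\<close>.\<close>

lemma D_pf:
  assumes x: "x \<in> U" shows "D pf x u = dpf x \<bullet> u"
proof -
  let ?N = "hamiltonian_derivative (g x) (J x) (p x) u"
  let ?A = "S x ** (J x ** g_inv x)"
  have Bs: "transpose (J x ** g_inv x) = - (J x ** g_inv x)" by (rule J_g_inv_skew[OF x])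
  have A: "transpose ?A = - ?A"
    unfolding S_def matrix_transpose_mul[of _ "J x ** g_inv x"] matrix_transpose_mul[of _ "\<psi> x"] Bs \<psi>_skew[OF x]
    by (simp add: mat_distrib matrix_mul_assoc)
  have A_skew: "a \<bullet> (?A *v c) = - ((?A *v a) \<bullet> c)" for a c
    by (subst inner_matrix_transpose) (simp add: A matv_distrib)
  have 1: "?A *v (g x *v u) = S x *v (J x *v u)"
    by (simp add: matrix_vector_mul_assoc) (simp add: matrix_mul_assoc[symmetric] metric_inverse[OF x])
  have 2: "?A *v (\<omega> x *v u) = S x *v u"
    by (simp add: matrix_vector_mul_assoc)
      (simp only: matrix_mul_assoc[symmetric] J_g_inv_\<omega>[OF x, unfolded matrix_mul_assoc[symmetric]] matrix_mul_rid)
  have 3: "J x *v (S x *v (J x *v u)) = - (S x *v u)"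
  proof -
    have "J x ** (S x ** J x) = - S x"
      unfolding S_J[OF x] by (simp add: matrix_mul_assoc J_square[OF x] mat_distrib)
    then show ?thesis by (simp add: matrix_vector_mul_assoc matv_distrib)
  qed
  have trace_scale: "trace (r *\<^sub>R A) = r * trace A" for r and A :: "real^4^4"
    by (simp add: trace_def sum_distrib_left)
  have "trace (?A ** ?N) = (- (transpose (J x) *v p x)) \<bullet> (?A *v (g x *v u)) + (- (\<omega> x *v u)) \<bullet> (?A *v p x)"
    using trace_wedge_1forms[OF A]
    by (simp add: hamiltonian_derivative_def mat_distrib trace_add trace_scale scaleR_right_distrib)
  also have "\<dots> = 2 * (p x \<bullet> (S x *v u))"
    unfolding 1 using A_skew[of "\<omega> x *v u" "p x"] unfolding 2
    using 3 inner_matrix_transpose[of "p x" "J x" "S x *v (J x *v u)"]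
    by (simp add: inner_commute)
  finally have tr: "trace (?A ** ?N) = 2 * (p x \<bullet> (S x *v u))" .
  have L: "bounded_linear (trace :: real^4^4 \<Rightarrow> real)"
    unfolding linear_conv_bounded_linear[symmetric] linear_iff
    by (simp add: trace_def sum.distrib sum_distrib_left)
  note dS = smooth_on_differentiable[OF smooth_S x]
  note dSS = smooth_on_differentiable[OF smooth_on_matrix_mult[OF open_U smooth_S smooth_S] x]
  have "D (\<lambda>y. trace (S y ** S y)) x u = trace (S x ** D S x u + D S x u ** S x)"
    unfolding D_bounded_linear[OF L dSS] D_matrix_mult[OF dS dS] ..
  also have "\<dots> = 2 * trace (S x ** D S x u)"
    by (simp add: trace_add trace_mul_sym[of "D S x u"])
  also have "trace (S x ** D S x u) = trace (?A ** ?N)"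
    unfolding D_S[OF x] by (simp add: mat_distrib trace_add trace_sub matrix_mul_assoc)
      (simp add: matrix_mul_assoc[symmetric] trace_mul_sym[of "S x ** _"] trace_mul_sym[of "S x"])
  finally have t: "D (\<lambda>y. trace (S y ** S y)) x u = 4 * (p x \<bullet> (S x *v u))"
    by (simp add: tr)
  note hs = smooth_on_has_D[OF smooth_s x]
    and ht = smooth_on_has_D[OF smooth_trace[OF smooth_on_matrix_mult[OF open_U smooth_S smooth_S]] x]
  have pf': "pf = (\<lambda>y. (1/2) * (s y * s y) - (1/4) * trace (S y ** S y))"
    by (simp add: fun_eq_iff pf_def power2_eq_square)
  have "(pf has_derivative (\<lambda>u. (1/2) * (s x * D s x u + D s x u * s x)
      - (1/4) * D (\<lambda>y. trace (S y ** S y)) x u)) (at x)"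
    unfolding pf'
    by (intro has_derivative_diff has_derivative_mult_right has_derivative_mult hs ht)
  from D_eq[OF this] have "D pf x u = s x * D s x u - D (\<lambda>y. trace (S y ** S y)) x u / 4" by simp
  then show ?thesis
    by (simp add: t dpf_def p_apply[OF x, symmetric] inner_diff_left inner_matrix_transpose[of "p x" "S x" u, symmetric])
qed

text \<open>The covariant derivative of \<open>dpf = s p - p \<circ> S\<close> by the product rule; the three terms quadratic in
  \<open>p\<close> come from \<open>p(u) p\<close> and from the derivative of \<open>S\<close>. Each summand is \<open>J\<close>-invariant in \<open>a\<close> and
  \<open>w\<close> once the Hessian \<open>h\<close> is.\<close>

lemma dpf_hessian:
  assumes x: "x \<in> U"
  shows "w \<bullet> (D dpf x a - transpose (\<Gamma> x a) *v dpf x) =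
    (1/2) * (p x \<bullet> a) * (p x \<bullet> w) + (1/2) * (p x \<bullet> (J x *v a)) * (p x \<bullet> (J x *v w))
    - (1/2) * (p x \<bullet> (g_inv x *v p x)) * (w \<bullet> (g x *v a)) + s x * (h x a \<bullet> w) - h x a \<bullet> (S x *v w)"
proof -
  let ?N = "hamiltonian_derivative (g x) (J x) (p x) a"
  let ?v = "J x *v (g_inv x *v p x)"
  note dS = smooth_on_differentiable[OF smooth_S x]
  note dSt = smooth_on_differentiable[OF smooth_on_transpose[OF open_U smooth_S] x]
  note dp = smooth_on_differentiable[OF smooth_p x]
  note ds = smooth_on_differentiable[OF smooth_s x]
  have sm: "smooth_on U (\<lambda>y. s y *\<^sub>R p y)" "smooth_on U (\<lambda>y. transpose (S y) *v p y)"
    by (intro smooth_on_scaleR smooth_on_matrix_vector_mult smooth_on_transpose smooth_S smooth_s smooth_p open_U)+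
  have "D dpf x a = D (\<lambda>y. s y *\<^sub>R p y) x a - D (\<lambda>y. transpose (S y) *v p y) x a"
    unfolding dpf_def[abs_def]
    by (rule D_eq[OF has_derivative_diff[OF smooth_on_has_D[OF sm(1) x] smooth_on_has_D[OF sm(2) x]]])
  also have "\<dots> = s x *\<^sub>R D p x a + (p x \<bullet> a) *\<^sub>R p x - (transpose (S x) *v D p x a + transpose (D S x a) *v p x)"
    unfolding D_bilinear[OF bounded_bilinear_scaleR ds dp] D_matrix_vector_mult[OF dSt dp] D_transpose[OF dS] p_apply[OF x] ..
  finally have K: "D dpf x a - transpose (\<Gamma> x a) *v dpf x =
      (p x \<bullet> a) *\<^sub>R p x + s x *\<^sub>R h x a - transpose (S x) *v h x a - transpose (J x ** g_inv x ** ?N) *v p x"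
    unfolding D_S[OF x] dpf_def h_def
    by (simp add: transpose_linear matrix_transpose_mul[of _ "\<Gamma> x a"] matrix_transpose_mul[of "\<Gamma> x a"] matv_distrib
        matrix_vector_mul_assoc[symmetric] scaleR_diff_right algebra_simps)
  have N: "w \<bullet> (transpose (J x ** g_inv x ** ?N) *v p x) = - (?v \<bullet> (?N *v w))"
  proof -
    have "w \<bullet> (transpose (J x ** g_inv x ** ?N) *v p x) = p x \<bullet> ((J x ** g_inv x) *v (?N *v w))"
      by (simp add: inner_matrix_transpose[of w] matrix_vector_mul_assoc inner_commute)
    also have "\<dots> = (transpose (J x ** g_inv x) *v p x) \<bullet> (?N *v w)"
      by (rule inner_matrix_transpose)
    finally show ?thesis
      unfolding J_g_inv_skew[OF x] by (simp add: matv_distrib matrix_vector_mul_assoc)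
  qed
  have v: "J x *v ?v = - (g_inv x *v p x)" by (rule J_J[OF x])
  have pv: "p x \<bullet> ?v = 0"
  proof -
    have "p x \<bullet> ?v = (transpose (J x ** g_inv x) *v p x) \<bullet> p x"
      unfolding inner_matrix_transpose[symmetric] by (simp add: matrix_vector_mul_assoc)
    then show ?thesis
      unfolding J_g_inv_skew[OF x] by (simp add: matv_distrib matrix_vector_mul_assoc inner_commute)
  qed
  have gi: "(g_inv x *v p x) \<bullet> (g x *v u) = p x \<bullet> u" for u
    by (subst inner_matrix_transpose)
      (simp add: metric_symmetric[OF x] matrix_vector_mul_assoc metric_inverse[OF x])
  have vg: "?v \<bullet> (g x *v a) = - (p x \<bullet> (J x *v a))"
  proof -
    have "?v \<bullet> (g x *v a) = (g_inv x *v p x) \<bullet> (\<omega> x *v a)"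
      using \<omega>_apply[OF x] by simp
    then show ?thesis
      unfolding transpose_J_metric[OF x] using gi[of "J x *v a"]
      by (simp add: matv_distrib matrix_vector_mul_assoc[symmetric])
  qed
  have "?v \<bullet> (?N *v w) = (1/2) * (- (p x \<bullet> (g_inv x *v p x)) * (w \<bullet> (g x *v a))
      + (p x \<bullet> (J x *v w)) * (p x \<bullet> (J x *v a)) - (p x \<bullet> a) * (p x \<bullet> w))"
    unfolding hamiltonian_derivative_apply v vg pv by (simp add: gi algebra_simps)
  moreover have "w \<bullet> (transpose (S x) *v h x a) = h x a \<bullet> (S x *v w)"
    by (simp add: inner_matrix_transpose[of w] inner_commute)
  ultimately show ?thesis
    unfolding K inner_diff_right inner_add_right N by (simp add: inner_commute[of w] field_simps)
qed

lemma dpf_hessian_J_invariant: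
  assumes x: "x \<in> U"
  shows "(J x *v w) \<bullet> (D dpf x (J x *v a) - transpose (\<Gamma> x (J x *v a)) *v dpf x) =
      w \<bullet> (D dpf x a - transpose (\<Gamma> x a) *v dpf x)"
proof -
  have g: "(J x *v w) \<bullet> (g x *v (J x *v a)) = w \<bullet> (g x *v a)"
    using J_orthogonal[OF x]
    by (metis inner_matrix_transpose matrix_vector_mul_assoc transpose_transpose)
  have S: "S x *v (J x *v w) = J x *v (S x *v w)"
    by (simp add: matrix_vector_mul_assoc S_J[OF x])
  show ?thesis
    unfolding dpf_hessian[OF x] g S h_J_invariant[OF x] J_J[OF x] by simp
qed

lemma trace_holomorphic:
  assumes x: "x \<in> U" shows "lie_deriv_endo (\<lambda>y. g_inv y *v p y) J x = 0"
  by (rule lie_deriv_gradient[OF x smooth_p])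
    (use h_J_invariant[OF x] in \<open>simp add: h_def inner_commute\<close>)

lemma pf_holomorphic:
  assumes x: "x \<in> U" shows "lie_deriv_endo (\<lambda>y. g_inv y *v dpf y) J x = 0"
  by (rule lie_deriv_gradient[OF x smooth_dpf dpf_hessian_J_invariant[OF x]])

text \<open>The bracket is a quadratic form in \<open>p\<close> whose matrix is skew.\<close>

lemma poisson_zero:
  assumes x: "x \<in> U"
  shows "(matrix_inv (transpose (\<omega> x)) *v p x) \<bullet> (\<omega> x *v (matrix_inv (transpose (\<omega> x)) *v dpf x)) = 0"
proof -
  let ?B = "J x ** g_inv x"
  have skew0: "p x \<bullet> (A *v p x) = 0" if "transpose A = - A" for A :: "real^4^4"
    using inner_matrix_transpose[of "p x" A "p x"] that by (simp add: matv_distrib inner_commute)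
  have Bs: "transpose ?B = - ?B" by (rule J_g_inv_skew[OF x])
  have inv: "matrix_inv (transpose (\<omega> x)) = - ?B"
    unfolding transpose_\<omega>[OF x]
    by (rule matrix_inv_eqI) (simp add: mat_distrib J_g_inv_\<omega>[OF x])
  have "\<omega> x ** ?B = mat 1"
    using J_g_inv_\<omega>[OF x] matrix_left_right_inverse by blast
  then have 1: "\<omega> x *v (- ?B *v dpf x) = - dpf x"
    by (simp add: matv_distrib matrix_vector_mul_assoc)
  have St: "transpose (S x) = \<psi> x ** ?B"
    unfolding S_def matrix_transpose_mul[of _ "\<psi> x"] Bs \<psi>_skew[OF x] by (simp add: mat_distrib)
  have A: "transpose (?B ** \<psi> x ** ?B) = - (?B ** \<psi> x ** ?B)"
    unfolding matrix_transpose_mul[of _ ?B] matrix_transpose_mul[of _ "\<psi> x"] Bs \<psi>_skew[OF x]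
    by (simp add: mat_distrib matrix_mul_assoc)
  have "(?B *v p x) \<bullet> dpf x = - (p x \<bullet> (?B *v dpf x))"
    using inner_matrix_transpose[of "p x" ?B "dpf x"] by (simp only: Bs) (simp add: matv_distrib)
  also have "p x \<bullet> (?B *v dpf x) = s x * (p x \<bullet> (?B *v p x)) - p x \<bullet> ((?B ** \<psi> x ** ?B) *v p x)"
    by (simp add: dpf_def St matv_distrib inner_diff_right matrix_vector_mul_assoc matrix_mul_assoc)
  finally show ?thesis
    unfolding inv 1 using skew0[OF Bs] skew0[OF A] by (simp add: matv_distrib)
qed

end

section \<open>From charts to the manifold\<close>

lemma lie_deriv_endo_cong:
  assumes "open U" "x \<in> U" "\<And>y. y \<in> U \<Longrightarrow> X y = Y y"
  shows "lie_deriv_endo X J x = lie_deriv_endo Y J x"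
proof -
  have "partial_deriv i X x = partial_deriv i Y x" for i
    unfolding partial_deriv_def by (rule D_cong[OF assms])
  then show ?thesis by (simp add: lie_deriv_endo_def assms)
qed

lemma chart_facts:
  assumes A: "oriented_atlas M A" and c: "c \<in> A"
  shows chart_img_open: "open (chart_img c)"
    and chart_inj: "inj_on (chart_map c) (chart_dom c)"
proof -
  have "is_chart M c" using A c by (simp add: oriented_atlas_def)
  then have o: "openin M (chart_dom c)" "open (chart_img c)"
    and h: "homeomorphic_map (subtopology M (chart_dom c)) (top_of_set (chart_img c)) (chart_map c)"
    by (auto simp: is_chart_def)
  show "open (chart_img c)" by (rule o(2))
  show "inj_on (chart_map c) (chart_dom c)"
    using h topspace_subtopology_subset[OF openin_subset[OF o(1)]]
    by (simp add: homeomorphic_map_def)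
qed

lemma chart_inv_facts:
  assumes "x \<in> chart_img c"
  shows "chart_inv c x \<in> chart_dom c" "chart_map c (chart_inv c x) = x"
  using assms inv_into_into[of x "chart_map c" "chart_dom c"] f_inv_into_f[of x "chart_map c" "chart_dom c"]
  by (auto simp: chart_img_def chart_inv_def)

lemma kaehler_surface_chart:
  assumes K: "kaehler_surface M A g J" and c: "c \<in> A"
  shows "kaehler_chart (chart_img c) (g c) (J c)"
proof
  have A: "oriented_atlas M A" using K by (simp add: kaehler_surface_def oriented_4_manifold_def)
  show "open (chart_img c)" by (rule chart_img_open[OF A c])
  show "smooth_on (chart_img c) (g c)" "smooth_on (chart_img c) (J c)"
    using K c by (auto simp: kaehler_surface_def riemannian_metric_def covariant_2_tensor_def
        complex_structure_def endomorphism_field_def)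
  fix x assume x: "x \<in> chart_img c"
  show "transpose (g c x) = g c x" "\<And>v. v \<noteq> 0 \<Longrightarrow> 0 < v \<bullet> (g c x *v v)"
    using K c x by (auto simp: kaehler_surface_def riemannian_metric_def)
  show "J c x ** J c x = - mat 1" "transpose (J c x) ** g c x ** J c x = g c x"
    "nabla_endo (g c) (J c) x = 0"
    using K c x by (auto simp: kaehler_surface_def complex_structure_def orthogonal_structure_def
        parallel_structure_def)
  show "\<And>X Y. det (vector [X, J c x *v X, Y, J c x *v Y] :: real^4^4) \<noteq> 0 \<Longrightarrow>
      0 < det (vector [X, J c x *v X, Y, J c x *v Y] :: real^4^4)"
    using K c x unfolding kaehler_surface_def induces_orientation_def Let_def by blast
qed

lemma hamiltonian_form_chart:
  assumes K: "kaehler_surface M A g J" and H: "hamiltonian_2_form A g J \<phi>" and c: "c \<in> A"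
    and dec: "\<And>x. x \<in> chart_img c \<Longrightarrow> \<phi> c x = trace_free_part g J \<phi> c x +
       ((3/2) * s x) *\<^sub>R kaehler_form g J c x"
  shows "hamiltonian_chart (chart_img c) (g c) (J c) (\<phi> c) (trace_free_part g J \<phi> c) s"
proof -
  interpret kaehler_chart "chart_img c" "g c" "J c" by (rule kaehler_surface_chart[OF K c])
  show ?thesis
  proof
    show "smooth_on (chart_img c) (\<phi> c)" "smooth_on (chart_img c) (trace_free_part g J \<phi> c)"
      using H c by (auto simp: hamiltonian_2_form_def twistor_2_form_def two_form_def covariant_2_tensor_def)
    fix x assume x: "x \<in> chart_img c"
    show "transpose (\<phi> c x) = - \<phi> c x"
      using H c x by (auto simp: hamiltonian_2_form_def two_form_def)
    show "partial_deriv i (\<phi> c) x $ j $ k + partial_deriv j (\<phi> c) x $ k $ i + partial_deriv k (\<phi> c) x $ i $ j = 0" for i j k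
      using H c x by (auto simp: hamiltonian_2_form_def closed_form_def)
    show "transpose (J c x) ** \<phi> c x ** J c x = \<phi> c x"
      using H c x by (auto simp: hamiltonian_2_form_def J_invariant_def)
    show "trace_free_part g J \<phi> c x \<in> asd_forms (g c x)"
      "nabla_form (g c) (trace_free_part g J \<phi> c) x \<in> V0 (g c x)"
      using H c x by (auto simp: hamiltonian_2_form_def twistor_2_form_def)
    show "trace_free_part g J \<phi> c x = \<phi> c x - (inner_2forms (g c x) (\<phi> c x) (transpose (J c x) ** g c x) /
       inner_2forms (g c x) (transpose (J c x) ** g c x) (transpose (J c x) ** g c x)) *\<^sub>R (transpose (J c x) ** g c x)"
      by (simp add: trace_free_part_def kaehler_form_def Let_def)
    show "\<phi> c x = trace_free_part g J \<phi> c x + ((3/2) * s x) *\<^sub>R (transpose (J c x) ** g c x)"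
      using dec[OF x] by (simp add: kaehler_form_def)
  qed
qed

lemma wedge_2forms_scaleR: "wedge_2forms (r *\<^sub>R \<alpha>) (r *\<^sub>R \<alpha>) i j k l = r\<^sup>2 * wedge_2forms \<alpha> \<alpha> i j k l"
  by (simp add: wedge_2forms_def power2_eq_square algebra_simps)

theorem proposition2:
  fixes M :: "'a topology" and A :: "'a chart set"
    and g J \<omega> \<phi> \<phi>\<^sub>0 \<phi>t :: "'a tensor2" and \<sigma> \<pi> :: "'a \<Rightarrow> real"
  assumes "kaehler_surface M A g J"
    and "\<omega> = kaehler_form g J"
    and "hamiltonian_2_form A g J \<phi>"
    and "\<phi>\<^sub>0 = trace_free_part g J \<phi>"
    and "\<And>c x. c \<in> A \<Longrightarrow> x \<in> chart_img c \<Longrightarrow>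
           \<phi> c x = \<phi>\<^sub>0 c x + ((3/2) * coord_rep c \<sigma> x) *\<^sub>R \<omega> c x"
    and "\<phi>t = (\<lambda>c x. (1/2) *\<^sub>R \<phi>\<^sub>0 c x + ((1/4) * coord_rep c \<sigma> x) *\<^sub>R \<omega> c x)"
    and "\<pi> = pfaffian A g J \<phi>t"
  shows "holomorphic_potential A g J \<sigma> \<and> holomorphic_potential A g J \<pi> \<and>
         poisson_commute A g J \<sigma> \<pi>"
proof -
  note K = assms(1) and \<omega>_def = assms(2) and H = assms(3) and \<phi>\<^sub>0_def = assms(4) and dec = assms(5)
    and \<phi>t_def = assms(6) and \<pi>_def = assms(7)
  have atlas: "oriented_atlas M A" using K by (simp add: kaehler_surface_def oriented_4_manifold_def)
  have chart: "hamiltonian_chart (chart_img c) (g c) (J c) (\<phi> c) (\<phi>\<^sub>0 c) (coord_rep c \<sigma>)" if "c \<in> A" for c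
    unfolding \<phi>\<^sub>0_def using dec[OF that] by (intro hamiltonian_form_chart[OF K H that]) (simp add: \<phi>\<^sub>0_def \<omega>_def)
  define chart_pf where "chart_pf c = hamiltonian_chart.pf (g c) (J c) (\<phi>\<^sub>0 c) (coord_rep c \<sigma>)" for c
  have \<omega>_chart: "\<omega> c x = transpose (J c x) ** g c x" for c x by (simp add: \<omega>_def kaehler_form_def)
  have wedge: "wedge_2forms (\<phi>t c x) (\<phi>t c x) 1 2 3 4 = (1/4) * chart_pf c x * wedge_2forms (\<omega> c x) (\<omega> c x) 1 2 3 4"
    and wedge_nz: "wedge_2forms (\<omega> c x) (\<omega> c x) 1 2 3 4 \<noteq> 0"
    and \<phi>t_skew: "transpose (\<phi>t c x) = - \<phi>t c x" and \<omega>_skew: "transpose (\<omega> c x) = - \<omega> c x"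
    if c: "c \<in> A" and x: "x \<in> chart_img c" for c x
  proof -
    interpret hamiltonian_chart "chart_img c" "g c" "J c" "\<phi> c" "\<phi>\<^sub>0 c" "coord_rep c \<sigma>" by (rule chart[OF c])
    have t: "\<phi>t c x = (1/2) *\<^sub>R \<psi> x" by (simp add: \<phi>t_def \<psi>_def \<omega>_chart scaleR_right_distrib)
    show "wedge_2forms (\<phi>t c x) (\<phi>t c x) 1 2 3 4 = (1/4) * chart_pf c x * wedge_2forms (\<omega> c x) (\<omega> c x) 1 2 3 4"
      unfolding t wedge_2forms_scaleR wedge_\<psi>(1)[OF x] chart_pf_def \<omega>_chart by (simp add: power2_eq_square)
    show "wedge_2forms (\<omega> c x) (\<omega> c x) 1 2 3 4 \<noteq> 0"
      unfolding \<omega>_chart by (rule wedge_\<psi>(2)[OF x])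
    show "transpose (\<phi>t c x) = - \<phi>t c x" "transpose (\<omega> c x) = - \<omega> c x"
      by (simp_all add: t transpose_linear \<psi>_skew[OF x] \<omega>_chart transpose_\<omega>[OF x])
  qed
  \<comment> \<open>On an overlap both four-forms are multiplied by the Jacobian determinant of the transition,
    so their ratio does not change. Hence the defining property of the pfaffian can be met in all
    charts at once.\<close>
  have pf_invariant: "chart_pf d (chart_map d q) = chart_pf c (chart_map c q)"
    if c: "c \<in> A" and d: "d \<in> A" and qc: "q \<in> chart_dom c" and qd: "q \<in> chart_dom d" for c d q
  proof -
    define x y where "x = chart_map c q" and "y = chart_map d q"
    have x: "x \<in> chart_img c" and y: "y \<in> chart_img d" using qc qd by (auto simp: x_def y_def chart_img_def)
    have xo: "x \<in> overlap c d" using qc qd by (auto simp: x_def overlap_def)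
    have ix: "chart_inv c x = q" and iy: "chart_inv d y = q"
      using chart_inj[OF atlas c] chart_inj[OF atlas d] qc qd
      by (auto simp: x_def y_def chart_inv_def)
    have t: "transition c d x = y" by (simp add: transition_def ix y_def)
    define B where "B = jacobian (transition c d) (at x)"
    have B: "0 < det B" using atlas c d xo by (simp add: oriented_atlas_def B_def)
    have \<phi>: "\<phi> c x = transpose B ** \<phi> d y ** B"
      using H c d xo unfolding hamiltonian_2_form_def two_form_def covariant_2_tensor_def Let_def
      by (simp add: B_def t)
    have g: "g c x = transpose B ** g d y ** B"
      using K c d xo unfolding kaehler_surface_def riemannian_metric_def covariant_2_tensor_def Let_def
      by (simp add: B_def t)
    have J: "B ** J c x = J d y ** B"
      using K c d xo unfolding kaehler_surface_def complex_structure_def endomorphism_field_def Let_def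
      by (simp add: B_def t)
    have \<omega>: "\<omega> c x = transpose B ** \<omega> d y ** B"
    proof -
      have "\<omega> c x = transpose (B ** J c x) ** g d y ** B"
        by (simp add: \<omega>_chart g matrix_transpose_mul matrix_mul_assoc)
      then show ?thesis by (simp add: J \<omega>_chart matrix_transpose_mul matrix_mul_assoc)
    qed
    have s: "coord_rep c \<sigma> x = coord_rep d \<sigma> y" by (simp add: coord_rep_def ix iy)
    have \<phi>t: "\<phi>t c x = (1/2) *\<^sub>R \<phi> c x - ((1/2) * coord_rep c \<sigma> x) *\<^sub>R \<omega> c x" if "c \<in> A" "x \<in> chart_img c" for c x
      by (simp add: \<phi>t_def dec[OF that] scaleR_right_distrib scaleR_add_left[symmetric] scaleR_diff_left[symmetric] algebra_simps)
    have \<phi>t': "\<phi>t c x = transpose B ** \<phi>t d y ** B"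
      unfolding \<phi>t[OF c x] \<phi>t[OF d y] \<phi> \<omega> s by (simp add: mat_distrib)
    have "(1/4) * chart_pf c x * (det B * wedge_2forms (\<omega> d y) (\<omega> d y) 1 2 3 4) =
        det B * ((1/4) * chart_pf d y * wedge_2forms (\<omega> d y) (\<omega> d y) 1 2 3 4)"
      using wedge[OF c x] wedge[OF d y] wedge_2forms_pullback[OF \<phi>t_skew[OF d y], of B]
        wedge_2forms_pullback[OF \<omega>_skew[OF d y], of B]
      by (auto simp: \<phi>t'[symmetric] \<omega>[symmetric])
    then show ?thesis using B wedge_nz[OF d y] by (simp add: x_def y_def)
  qed
  have \<pi>_chart: "coord_rep c \<pi> x = chart_pf c x" if c: "c \<in> A" and x: "x \<in> chart_img c" for c x
  proof -
    define q where "q = chart_inv c x"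
    have q: "q \<in> chart_dom c" "chart_map c q = x" using chart_inv_facts[OF x] by (simp_all add: q_def)
    have "\<pi> q = chart_pf c x"
      unfolding \<pi>_def pfaffian_def Let_def
    proof (rule the_equality)
      show "\<forall>d\<in>A. q \<in> chart_dom d \<longrightarrow> (\<forall>i j k l. wedge_2forms (\<phi>t d (chart_map d q)) (\<phi>t d (chart_map d q)) i j k l =
          1 / 4 * chart_pf c x * wedge_2forms (kaehler_form g J d (chart_map d q)) (kaehler_form g J d (chart_map d q)) i j k l)"
      proof (intro ballI impI allI)
        fix d i j k l assume d: "d \<in> A" and qd: "q \<in> chart_dom d"
        let ?y = "chart_map d q"
        have y: "?y \<in> chart_img d" using qd by (simp add: chart_img_def)
        have "chart_pf d ?y = chart_pf c x" using pf_invariant[OF c d q(1) qd] q(2) by simp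
        then show "wedge_2forms (\<phi>t d ?y) (\<phi>t d ?y) i j k l =
          1 / 4 * chart_pf c x * wedge_2forms (kaehler_form g J d ?y) (kaehler_form g J d ?y) i j k l"
          using wedge[OF d y] unfolding \<omega>_def[symmetric] wedge_2forms_det[OF \<phi>t_skew[OF d y], of i j k l]
            wedge_2forms_det[OF \<omega>_skew[OF d y], of i j k l] by simp
      qed
    next
      fix r assume "\<forall>d\<in>A. q \<in> chart_dom d \<longrightarrow> (\<forall>i j k l. wedge_2forms (\<phi>t d (chart_map d q)) (\<phi>t d (chart_map d q)) i j k l =
          1 / 4 * r * wedge_2forms (kaehler_form g J d (chart_map d q)) (kaehler_form g J d (chart_map d q)) i j k l)"
      then have "wedge_2forms (\<phi>t c x) (\<phi>t c x) 1 2 3 4 = 1 / 4 * r * wedge_2forms (\<omega> c x) (\<omega> c x) 1 2 3 4"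
        using c q by (auto simp: \<omega>_def)
      then show "r = chart_pf c x" using wedge[OF c x] wedge_nz[OF c x] by simp
    qed
    then show ?thesis by (simp add: coord_rep_def q_def)
  qed
  have local: "smooth_on (chart_img c) (coord_rep c \<sigma>) \<and> smooth_on (chart_img c) (coord_rep c \<pi>) \<and>
      (\<forall>x\<in>chart_img c. lie_deriv_endo (gradient g c \<sigma>) (J c) x = 0 \<and>
        lie_deriv_endo (gradient g c \<pi>) (J c) x = 0 \<and> poisson_bracket g J c \<sigma> \<pi> x = 0)"
    if c: "c \<in> A" for c
  proof -
    interpret hamiltonian_chart "chart_img c" "g c" "J c" "\<phi> c" "\<phi>\<^sub>0 c" "coord_rep c \<sigma>" by (rule chart[OF c])
    have \<pi>: "coord_rep c \<pi> y = pf y" if "y \<in> chart_img c" for y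
      using \<pi>_chart[OF c that] by (simp add: chart_pf_def)
    have d\<sigma>: "differential c \<sigma> y = p y" for y
      by (simp add: differential_def p_def partial_deriv_def)
    have d\<pi>: "differential c \<pi> y = dpf y" if y: "y \<in> chart_img c" for y
    proof -
      have "D (coord_rep c \<pi>) y (axis i 1) = dpf y $ i" for i
      proof -
        have "D (coord_rep c \<pi>) y (axis i 1) = D pf y (axis i 1)" by (rule D_cong[OF open_U y]) (rule \<pi>)
        then show ?thesis using D_pf[OF y] by (simp add: inner_axis)
      qed
      then show ?thesis by (simp add: differential_def partial_deriv_def vec_eq_iff)
    qed
    show ?thesis
    proof (intro conjI ballI)
      show "smooth_on (chart_img c) (coord_rep c \<sigma>)" by (rule smooth_s)
      show "smooth_on (chart_img c) (coord_rep c \<pi>)"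
        by (rule smooth_on_cong[OF open_U _ smooth_pf]) (simp add: \<pi>)
      fix x assume x: "x \<in> chart_img c"
      show "lie_deriv_endo (gradient g c \<sigma>) (J c) x = 0"
        using trace_holomorphic[OF x] by (simp add: gradient_def[abs_def] d\<sigma>)
      have "lie_deriv_endo (gradient g c \<pi>) (J c) x = lie_deriv_endo (\<lambda>y. g_inv y *v dpf y) (J c) x"
        by (rule lie_deriv_endo_cong[OF open_U x]) (simp add: gradient_def d\<pi>)
      then show "lie_deriv_endo (gradient g c \<pi>) (J c) x = 0" by (simp add: pf_holomorphic[OF x])
      show "poisson_bracket g J c \<sigma> \<pi> x = 0"
        using poisson_zero[OF x]
        by (simp add: poisson_bracket_def hamiltonian_field_def kaehler_form_def d\<sigma> d\<pi>[OF x])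
    qed
  qed
  show ?thesis
    using local unfolding holomorphic_potential_def smooth_function_def poisson_commute_def by blast
qed

end
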